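(* Let $f_1,\dots,f_r\in\mathbb{Z}[x]$ be primitive irreducible polynomials of degree at least $2$ whose discriminants $D_1,\dots,D_r$ are pairwise coprime, and let $D=D_1\cdots D_r$. For each $i$ let $\alpha_i$ be a root of $f_i$, and let $L=\mathbb{Q}(\alpha_1,\dots,\alpha_r)$ with ring of integers $\mathcal{O}$. Let $\eta$ be a positive integer with $\eta\alpha_i\in\mathcal{O}$ for all $i$, and $R=\mathcal{O}[1/\eta]$. Then for every integer $n\ge2$ with $\gcd(n,\eta D)=1$, the maps $$\mathfrak{a}\mapsto(\alpha_1(\mathfrak{a}),\dots,\alpha_r(\mathfrak{a}))\quad\text{and}\quad(v_1,\dots,v_r)\mapsto(\alpha_1-v_1,\dots,\alpha_r-v_r,n)R$$ are mutually inverse bijections between $S_\eta(n)$ and the set of $r$-tuples $(v_1,\dots,v_r)\in\{0,\dots,n-1\}^r$ with $f_i(v_i)\equiv0\pmod n$ for all $1\le i\le r$.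
   Context: For a number field $L$ with ring of integers $\mathcal{O}$, positive integer $\eta$, $R=\mathcal{O}[1/\eta]$ and $Z_\eta=\mathbb{Z}[1/\eta]$: a proper nonzero ideal $\mathfrak{a}$ of $R$ is of degree one if $R/\mathfrak{a}\cong Z_\eta/(\mathfrak{a}\cap Z_\eta)$; its norm is $\mathfrak{N}(\mathfrak{a})=|R/\mathfrak{a}|$; $S_\eta(n)$ is the set of degree one ideals of norm $n$. For $\beta\in R$ and $\mathfrak{a}\in S_\eta(n)$, $\beta(\mathfrak{a})$ is the unique integer in $[0,n)$ with $\beta-\beta(\mathfrak{a})\in\mathfrak{a}$. $(x_1,\dots,x_k)R$ is the ideal of $R$ generated by $x_1,\dots,x_k$. *)

theory Defs
  imports "HOL-Computational_Algebra.Polynomial" "HOL-Library.FuncSet"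
    "HOL-Algebra.QuotRing" "Subresultants.Resultant_Prelim"
begin

text \<open>Discriminant of a polynomial of degree n with leading coefficient a:
  disc f = (-1)^(n(n-1)/2) * Res(f, f') / a  (the division is exact).\<close>
definition poly_disc :: "int poly \<Rightarrow> int" where
  "poly_disc f = (let n = degree f in
     (-1) ^ (n * (n - 1) div 2) * resultant f (pderiv f) div lead_coeff f)"

definition is_subfield :: "complex set \<Rightarrow> bool" where
  "is_subfield K \<longleftrightarrow> 0 \<in> K \<and> 1 \<in> K \<and> (\<forall>x\<in>K. \<forall>y\<in>K. x + y \<in> K \<and> x * y \<in> K)
     \<and> (\<forall>x\<in>K. - x \<in> K \<and> inverse x \<in> K)"

definition gen_field :: "complex set \<Rightarrow> complex set" where
  "gen_field S = \<Inter>{K. is_subfield K \<and> S \<subseteq> K}"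

definition ring_of_integers :: "complex set \<Rightarrow> complex set" where
  "ring_of_integers L = {x \<in> L. algebraic_int x}"

definition localize :: "complex set \<Rightarrow> nat \<Rightarrow> complex set" where
  "localize A \<eta> = {x / of_nat \<eta> ^ k | x k. x \<in> A}"

definition Z_eta :: "nat \<Rightarrow> complex set" where
  "Z_eta \<eta> = localize \<int> \<eta>"

definition subring_C :: "complex set \<Rightarrow> complex ring" where
  "subring_C A = \<lparr>carrier = A, monoid.mult = (*), one = 1, zero = 0, add = (+)\<rparr>"

text \<open>Degree-one ideals of R = O[1/eta] of norm n:
  proper nonzero ideals a with R/a isomorphic to Z_eta/(a \<inter> Z_eta) and |R/a| = n.\<close>
definition S_eta :: "complex set \<Rightarrow> nat \<Rightarrow> nat \<Rightarrow> complex set set" where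
  "S_eta Ok \<eta> n = (let R = localize Ok \<eta>; RR = subring_C R; ZZ = subring_C (Z_eta \<eta>) in
     {a. ideal a RR \<and> a \<noteq> {0} \<and> a \<noteq> R
         \<and> (RR Quot a) \<simeq> (ZZ Quot (a \<inter> Z_eta \<eta>))
         \<and> card (carrier (RR Quot a)) = n})"

definition beta_at :: "complex \<Rightarrow> nat \<Rightarrow> complex set \<Rightarrow> int" where
  "beta_at \<beta> n a = (THE k. 0 \<le> k \<and> k < int n \<and> \<beta> - of_int k \<in> a)"

end

(*
  The coefficients of f_i/(x - alpha_i) are, up to the factor f_i'(alpha_i), dual to the powers of
  alpha_i with respect to the trace.  Since f_i'(alpha_i) divides the resultant of f_i and f_i', which is
  a unit modulo n, this duality gives R = Z + psi(v) for every tuple v of roots modulo n.  Multiplying an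
  integer of psi(v) by the product of the (f_i(alpha_i) - f_i(v_i))/(alpha_i - v_i) and taking the trace
  shows that psi(v) meets Z in nZ.  The ideals of S_eta(n) are exactly those with these two properties.

  Both traces are sums over all tuples of roots, so the fields Q(alpha_i) have to be linearly disjoint.
  A field inside both Q(alpha_1, ..., alpha_(k-1)) and the splitting field of f_k inherits from each of
  them an integral separability idempotent up to a factor, and the two factors are products of coprime
  discriminants.  It is therefore unramified, its discriminant is a unit, and Minkowski's linear forms
  theorem shows that it is Q.
*)

theory Submission
  imports Defs "Jordan_Normal_Form.Char_Poly" "Subresultants.Subresultant"
begin

section \<open>Algebraic integers\<close>

text \<open>Ramification theory and finite Galois groups are avoided: \<open>galois\<close> acts on
  all algebraic numbers at once, and a number field is seen through its finite set of embeddings. A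
  discriminant enters only through identities between sums of y * \<sigma> w, one for each
  automorphism \<sigma>. Such families multiply (composita), admit a relative trace on w
  (subfields), and their factors form an ideal of Z, so coprime factors yield the factor 1. The
  splitting field of f_k is used instead of Q(\<alpha>_k) because normality is what turns a trivial
  intersection into disjointness: the orbit polynomial of \<alpha>_k over the earlier field has
  coefficients in both fields. As f_i need not be monic, its root need not be integral; the
  coefficients of f_i/(x - \<alpha>_i) are integral, and with 1 in place of the leading one their
  discriminant is that of f_i up to sign. The leading coefficient is the other factor of the
  resultant; it divides a power of \<eta> because \<eta> times \<alpha>_i is integral. The last
  trace is evaluated by Lagrange interpolation of the constant 1.\<close>

lemma algebraic_int_if_module:
  fixes v :: "nat \<Rightarrow> complex"
  assumes k: "k < n" "v k \<noteq> 0"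
    and eq: "\<And>i. i < n \<Longrightarrow> x * v i = (\<Sum>j<n. of_int (A i j) * v j)"
  shows "algebraic_int x"
proof -
  define M :: "int mat" where "M = mat n n (\<lambda>(i,j). A i j)"
  have M: "M \<in> carrier_mat n n" by (simp add: M_def)
  let ?M = "map_mat of_int M :: complex mat"
  have M': "?M \<in> carrier_mat n n" using M by simp
  \<comment> \<open>The hypotheses say that \<open>x\<close> is an eigenvalue of an integer matrix;
    the entry \<open>v k\<close> makes the eigenvector nonzero. So \<open>x\<close> is a root of the
    monic characteristic polynomial.\<close>
  have "eigenvector ?M (vec n v) x"
    unfolding eigenvector_def
  proof (intro conjI)
    show "vec n v \<in> carrier_vec (dim_row ?M)" using M by simp
    have "vec n v $ k \<noteq> 0\<^sub>v n $ k" using k by simp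
    thus "vec n v \<noteq> 0\<^sub>v (dim_row ?M)" using M by auto
    show "?M *\<^sub>v vec n v = x \<cdot>\<^sub>v vec n v"
    proof (rule eq_vecI)
      fix i assume "i < dim_vec (x \<cdot>\<^sub>v vec n v)"
      hence i: "i < n" by simp
      show "(?M *\<^sub>v vec n v) $ i = (x \<cdot>\<^sub>v vec n v) $ i"
        using i eq[OF i] by (simp add: M_def scalar_prod_def atLeast0LessThan)
    qed (simp add: M_def)
  qed
  hence "eigenvalue ?M x" unfolding eigenvalue_def by blast
  hence "poly (char_poly ?M) x = 0" using eigenvalue_root_char_poly[OF M'] by simp
  hence "poly (map_poly of_int (char_poly M)) x = 0"
    by (simp add: of_int_hom.char_poly_hom[OF M])
  moreover have "lead_coeff (char_poly M) = 1" using degree_monic_char_poly[OF M] by simp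
  ultimately show ?thesis using algebraic_int_altdef_ipoly by blast
qed

section \<open>Closure properties of algebraic integers and algebraic numbers\<close>

definition zspan :: "complex set \<Rightarrow> complex set" where
  "zspan V = {\<Sum>v\<in>V. of_int (c v) * v | c. True}"

lemma zspan_add: "a \<in> zspan V \<Longrightarrow> b \<in> zspan V \<Longrightarrow> a + b \<in> zspan V"
  unfolding zspan_def mem_Collect_eq
  by (elim exE conjE, rule_tac x = "\<lambda>v. c v + ca v" in exI) (simp add: sum.distrib algebra_simps)

lemma zspan_of_int_mult: "a \<in> zspan V \<Longrightarrow> of_int k * a \<in> zspan V"
  unfolding zspan_def mem_Collect_eq
  by (elim exE conjE, rule_tac x = "\<lambda>v. k * c v" in exI) (simp add: sum_distrib_left algebra_simps)

lemma zspan_base: "finite V \<Longrightarrow> a \<in> V \<Longrightarrow> a \<in> zspan V"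
  unfolding zspan_def mem_Collect_eq
  by (rule exI[of _ "\<lambda>v. if v = a then 1 else 0"]) (simp add: if_distrib[of of_int] if_distrib[of "\<lambda>x. x * _"] cong: if_cong)

lemma zspan_0: "0 \<in> zspan V"
  unfolding zspan_def mem_Collect_eq by (rule exI[of _ "\<lambda>v. 0"]) simp

lemma zspan_sum: "(\<And>i. i \<in> I \<Longrightarrow> g i \<in> zspan V) \<Longrightarrow> sum g I \<in> zspan V"
  by (induction I rule: infinite_finite_induct) (auto simp: zspan_0 intro: zspan_add)

lemma zspan_mult_closed:
  assumes "\<And>v. v \<in> V \<Longrightarrow> x * v \<in> zspan V" and "a \<in> zspan V"
  shows "x * a \<in> zspan V"
proof -
  from assms(2) obtain c where c: "a = (\<Sum>v\<in>V. of_int (c v) * v)" by (auto simp: zspan_def)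
  have "x * a = (\<Sum>v\<in>V. of_int (c v) * (x * v))" by (simp add: c sum_distrib_left algebra_simps)
  also have "\<dots> \<in> zspan V" by (intro zspan_sum zspan_of_int_mult assms)
  finally show ?thesis .
qed

lemma algebraic_int_if_zspan:
  assumes fin: "finite V" and u: "u \<in> V" "u \<noteq> 0"
    and mult: "\<And>v. v \<in> V \<Longrightarrow> x * v \<in> zspan V"
  shows "algebraic_int x"
proof -
  obtain e where e: "bij_betw e {..<card V} V"
    using ex_bij_betw_nat_finite[OF fin] atLeast0LessThan by auto
  have "\<forall>v\<in>V. \<exists>c. x * v = (\<Sum>w\<in>V. of_int (c w) * w)" using mult by (auto simp: zspan_def)
  then obtain C where C: "\<And>v. v \<in> V \<Longrightarrow> x * v = (\<Sum>w\<in>V. of_int (C v w) * w)" by metis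
  from e u obtain k where k: "k < card V" "e k = u"
    by (metis bij_betw_imp_surj_on imageE lessThan_iff)
  show ?thesis
  proof (rule algebraic_int_if_module[of k "card V" e x "\<lambda>i j. C (e i) (e j)"])
    fix i assume "i < card V"
    hence "e i \<in> V" using e by (auto simp: bij_betw_def)
    thus "x * e i = (\<Sum>j<card V. of_int (C (e i) (e j)) * e j)"
      using sum.reindex_bij_betw[OF e, of "\<lambda>w. of_int (C (e i) w) * w"] C by simp
  qed (use k u in auto)
qed

lemma algebraic_int_power_eq:
  assumes "algebraic_int (x :: complex)"
  obtains n c where "n > 0" "x ^ n = (\<Sum>i<n. of_int (c i) * x ^ i)"
proof -
  from assms obtain p where p: "poly (map_poly of_int p) x = 0" "lead_coeff p = 1"
    using algebraic_int_altdef_ipoly by blast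
  have n: "degree p > 0"
  proof (rule ccontr)
    assume "\<not> degree p > 0"
    then obtain a where "p = [:a:]" by (metis degree_eq_zeroE neq0_conv)
    thus False using p by simp
  qed
  have "0 = (\<Sum>i\<le>degree p. of_int (coeff p i) * x ^ i)"
    using p(1) by (simp add: poly_altdef)
  also have "\<dots> = (\<Sum>i<degree p. of_int (coeff p i) * x ^ i) + x ^ degree p"
    using p(2) by (simp flip: lessThan_Suc_atMost)
  finally have "x ^ degree p = (\<Sum>i<degree p. of_int (- coeff p i) * x ^ i)"
    by (simp add: sum_negf eq_neg_iff_add_eq_0 add.commute)
  with n show thesis by (rule that)
qed

text \<open>With \<open>m\<close> and \<open>n\<close> the degrees of monic equations for
  \<open>x\<close> and \<open>y\<close>, multiplication by either number preserves the group spanned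
  by the monomials \<open>x ^ i * y ^ j\<close> with \<open>i < m\<close> and \<open>j < n\<close>;
  hence so does multiplication by their sum and product. The group contains 1, a nonzero
  element.\<close>

lemma
  assumes x: "algebraic_int (x :: complex)" and y: "algebraic_int y"
  shows algebraic_int_add [intro]: "algebraic_int (x + y)"
    and algebraic_int_mult [intro]: "algebraic_int (x * y)"
proof -
  obtain m c where m: "m > 0" "x ^ m = (\<Sum>i<m. of_int (c i) * x ^ i)"
    by (rule algebraic_int_power_eq[OF x])
  obtain n d where n: "n > 0" "y ^ n = (\<Sum>i<n. of_int (d i) * y ^ i)"
    by (rule algebraic_int_power_eq[OF y])
  define V where "V = (\<lambda>(i,j). x ^ i * y ^ j) ` ({..<m} \<times> {..<n})"
  have fin: "finite V" by (simp add: V_def)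
  have V: "x ^ i * y ^ j \<in> zspan V" if "i < m" "j < n" for i j
    by (rule zspan_base[OF fin]) (use that in \<open>auto simp: V_def\<close>)
  have one: "1 \<in> V" unfolding V_def using m(1) n(1) by (auto intro!: image_eqI[of _ _ "(0,0)"])
  have mx: "x * v \<in> zspan V" if "v \<in> V" for v
  proof -
    from that obtain i j where ij: "i < m" "j < n" "v = x ^ i * y ^ j" by (auto simp: V_def)
    show ?thesis
    proof (cases "Suc i < m")
      case True
      thus ?thesis using V[of "Suc i" j] ij by (simp add: mult_ac)
    next
      case False
      hence "x * v = x ^ m * y ^ j" using ij by (simp add: mult.assoc[symmetric] flip: power_Suc)
          (metis Suc_lessI)
      also have "\<dots> = (\<Sum>i<m. of_int (c i) * (x ^ i * y ^ j))"
        by (simp add: m(2) sum_distrib_left sum_distrib_right mult_ac)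
      also have "\<dots> \<in> zspan V" by (intro zspan_sum zspan_of_int_mult V) (use ij in auto)
      finally show ?thesis .
    qed
  qed
  have my: "y * v \<in> zspan V" if "v \<in> V" for v
  proof -
    from that obtain i j where ij: "i < m" "j < n" "v = x ^ i * y ^ j" by (auto simp: V_def)
    show ?thesis
    proof (cases "Suc j < n")
      case True
      thus ?thesis using V[of i "Suc j"] ij by (simp add: mult_ac)
    next
      case False
      hence "Suc j = n" using ij by simp
      hence "y * v = x ^ i * y ^ n" using ij by (auto simp: mult_ac)
      also have "\<dots> = (\<Sum>j<n. of_int (d j) * (x ^ i * y ^ j))"
        by (simp add: n(2) sum_distrib_left mult_ac)
      also have "\<dots> \<in> zspan V" by (intro zspan_sum zspan_of_int_mult V) (use ij in auto)
      finally show ?thesis .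
    qed
  qed
  show "algebraic_int (x + y)"
    by (rule algebraic_int_if_zspan[OF fin one])
      (auto simp: distrib_right intro!: zspan_add mx my)
  show "algebraic_int (x * y)"
    by (rule algebraic_int_if_zspan[OF fin one])
      (auto simp: mult.assoc intro!: zspan_mult_closed[OF mx] my)
qed

lemma algebraic_int_diff [intro]:
  "algebraic_int (x :: complex) \<Longrightarrow> algebraic_int y \<Longrightarrow> algebraic_int (x - y)"
  using algebraic_int_add[of x "- y"] by auto

lemma algebraic_int_sum [intro]:
  "(\<And>i. i \<in> I \<Longrightarrow> algebraic_int (g i :: complex)) \<Longrightarrow> algebraic_int (sum g I)"
  by (induction I rule: infinite_finite_induct) auto

lemma algebraic_int_prod [intro]:
  "(\<And>i. i \<in> I \<Longrightarrow> algebraic_int (g i :: complex)) \<Longrightarrow> algebraic_int (prod g I)"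
  by (induction I rule: infinite_finite_induct) auto

lemma algebraic_int_power [intro]: "algebraic_int (x :: complex) \<Longrightarrow> algebraic_int (x ^ k)"
  by (induction k) auto

lemma algebraic_int_det:
  assumes A: "A \<in> carrier_mat n n"
    and int: "\<And>i j. i < n \<Longrightarrow> j < n \<Longrightarrow> algebraic_int (A $$ (i,j) :: complex)"
  shows "algebraic_int (det A)"
  unfolding det_def'[OF A]
proof (intro algebraic_int_sum algebraic_int_mult algebraic_int_prod)
  fix p assume p: "p \<in> {p. p permutes {0..<n}}"
  show "algebraic_int (signof p :: complex)" by (cases p rule: sign_cases) auto
  fix i assume i: "i \<in> {0..<n}"
  hence "p i < n" using p permutes_in_image[of p "{0..<n}" i] by auto
  thus "algebraic_int (A $$ (i, p i))" using int i by auto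
qed

text \<open>Reduces closure properties of algebraic numbers to those of algebraic integers. The
  multiplier is the leading coefficient \<open>a\<close> of an integer equation of degree n:
  multiplication by \<open>a * x\<close> preserves the group spanned by the powers of
  \<open>x\<close> below n.\<close>

lemma algebraic_iff_multiple:
  "algebraic (x :: complex) \<longleftrightarrow> (\<exists>k::int. k \<noteq> 0 \<and> algebraic_int (of_int k * x))"
proof
  assume "algebraic x"
  then obtain p where p: "p \<noteq> 0" "poly (map_poly of_int p) x = 0" by (erule algebraicE')
  let ?n = "degree p" and ?a = "lead_coeff p"
  have n: "?n > 0"
  proof (rule ccontr)
    assume "\<not> ?n > 0"
    then obtain a where "p = [:a:]" by (metis degree_eq_zeroE neq0_conv)
    thus False using p by simp
  qed
  define V where "V = (\<lambda>i. x ^ i) ` {..<?n}"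
  have fin: "finite V" by (simp add: V_def)
  have V: "x ^ i \<in> zspan V" if "i < ?n" for i
    by (rule zspan_base[OF fin]) (use that in \<open>auto simp: V_def\<close>)
  have "algebraic_int (of_int ?a * x)"
  proof (rule algebraic_int_if_zspan[OF fin, of 1])
    show "1 \<in> V" unfolding V_def using n by (auto intro!: image_eqI[of _ _ 0])
    fix v assume "v \<in> V"
    then obtain i where i: "i < ?n" "v = x ^ i" by (auto simp: V_def)
    show "of_int ?a * x * v \<in> zspan V"
    proof (cases "Suc i < ?n")
      case True
      thus ?thesis using zspan_of_int_mult[OF V[of "Suc i"], of ?a] i by (simp add: mult_ac)
    next
      case False
      hence n': "Suc i = ?n" using i by simp
      have "0 = (\<Sum>i\<le>?n. of_int (coeff p i) * x ^ i)"
        using p(2) by (simp add: poly_altdef)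
      also have "\<dots> = (\<Sum>i<?n. of_int (coeff p i) * x ^ i) + of_int ?a * x ^ ?n"
        by (simp flip: lessThan_Suc_atMost)
      finally have "of_int ?a * x ^ ?n = (\<Sum>i<?n. of_int (- coeff p i) * x ^ i)"
        by (simp add: sum_negf eq_neg_iff_add_eq_0 add.commute)
      moreover have "of_int ?a * x * v = of_int ?a * x ^ ?n"
        using i by (simp flip: n' add: mult_ac)
      ultimately show ?thesis by (auto intro!: zspan_sum zspan_of_int_mult V simp del: of_int_minus)
    qed
  qed auto
  thus "\<exists>k::int. k \<noteq> 0 \<and> algebraic_int (of_int k * x)" using p(1) by (intro exI[of _ ?a]) auto
next
  assume "\<exists>k::int. k \<noteq> 0 \<and> algebraic_int (of_int k * x)"
  then obtain k :: int where k: "k \<noteq> 0" "algebraic_int (of_int k * x)" by blast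
  from k(2) obtain p where p: "poly (map_poly of_int p) (of_int k * x) = 0" "lead_coeff p = 1"
    using algebraic_int_altdef_ipoly by blast
  have "p \<noteq> 0" using p(2) by auto
  define q where "q = pcompose (map_poly of_int p) [:0, of_int k :: complex:]"
  have "poly q x = 0" using p(1) by (simp add: q_def poly_pcompose mult.commute)
  moreover have "q \<noteq> 0" unfolding q_def using k(1) \<open>p \<noteq> 0\<close>
    by (subst pcompose_eq_0_iff) auto
  moreover have "coeff q i \<in> \<int>" for i
    unfolding q_def using coeff_pcompose_linear by (auto simp: coeff_pcompose_linear coeff_map_poly)
  ultimately show "algebraic x" by (intro algebraicI) auto
qed

lemma
  assumes "algebraic (x :: complex)" "algebraic y"
  shows algebraic_add [intro]: "algebraic (x + y)"
    and algebraic_mult [intro]: "algebraic (x * y)"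
proof -
  from assms obtain k l :: int where k: "k \<noteq> 0" "algebraic_int (of_int k * x)"
    and l: "l \<noteq> 0" "algebraic_int (of_int l * y)"
    by (auto simp: algebraic_iff_multiple)
  have "algebraic_int (of_int l * (of_int k * x) + of_int k * (of_int l * y))"
    by (intro algebraic_int_add algebraic_int_mult[OF algebraic_int_of_int] k l)
  hence "algebraic_int (of_int (k * l) * (x + y))" by (simp add: algebra_simps)
  thus "algebraic (x + y)" unfolding algebraic_iff_multiple using k l by (intro exI[of _ "k * l"]) auto
  have "algebraic_int ((of_int k * x) * (of_int l * y))"
    by (intro algebraic_int_mult k l)
  hence "algebraic_int (of_int (k * l) * (x * y))" by (simp add: algebra_simps)
  thus "algebraic (x * y)" unfolding algebraic_iff_multiple using k l by (intro exI[of _ "k * l"]) auto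
qed

lemma algebraic_rat: "x \<in> \<rat> \<Longrightarrow> algebraic (x :: complex)"
proof (erule Rats_cases')
  fix a b :: int assume "b > 0" "x = of_int a / of_int b"
  thus "algebraic x" unfolding algebraic_iff_multiple by (intro exI[of _ b]) auto
qed

text \<open>Once a relation a + x q(x) = 0 with nonzero a is at hand, the inverse of
  \<open>x\<close> is the polynomial - q(x)/a in \<open>x\<close>. Thus a ring of algebraic numbers
  that contains the rationals is a field.\<close>

lemma inverse_in_algebraic_ring:
  assumes alg: "algebraic (x :: complex)" "x \<noteq> 0"
    and K: "\<rat> \<subseteq> K" "\<And>a b. a \<in> K \<Longrightarrow> b \<in> K \<Longrightarrow> a + b \<in> K \<and> a * b \<in> K" "x \<in> K"
  shows "inverse x \<in> K"
proof -
  \<comment> \<open>Since \<open>x\<close> is nonzero, factors of \<open>x\<close> can be split off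
    until the constant coefficient is nonzero; the induction removes vanishing constant
    coefficients.\<close>
  have "\<exists>q a. a \<noteq> 0 \<and> of_int a + x * poly (map_poly of_int q) x = 0"
    if "p \<noteq> 0" "poly (map_poly of_int p) x = 0" for p :: "int poly"
    using that
  proof (induction p)
    case (pCons a p)
    show ?case
    proof (cases "a = 0")
      case True
      thus ?thesis using pCons alg by auto
    next
      case False
      thus ?thesis using pCons.prems by (intro exI[of _ p] exI[of _ a]) auto
    qed
  qed simp
  note ex = this
  obtain p where p: "p \<noteq> 0" "poly (map_poly of_int p) x = 0" using alg(1) by (erule algebraicE')
  obtain q a where q: "a \<noteq> 0" "of_int a + x * poly (map_poly of_int q) x = 0"
    using ex[OF p] by blast
  have poly: "poly (map_poly of_int q) x \<in> K" for q
  proof (induction q)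
    case (pCons a q)
    have "of_int a \<in> K" using K(1) by auto
    hence "of_int a + x * poly (map_poly of_int q) x \<in> K" using K pCons.IH by blast
    thus ?case by (simp add: of_int_hom.map_poly_pCons_hom)
  qed (use K(1) in auto)
  have xq: "x * poly (map_poly of_int q) x = - of_int a" using q(2) by (simp add: eq_neg_iff_add_eq_0 add.commute)
  have "x * ((- 1 / of_int a) * poly (map_poly of_int q) x) = (- 1 / of_int a) * (x * poly (map_poly of_int q) x)"
    by (simp only: mult_ac)
  also have "\<dots> = 1" unfolding xq using q(1) by simp
  finally have "inverse x = (- 1 / of_int a) * poly (map_poly of_int q) x" by (rule inverse_unique)
  also have "\<dots> \<in> K" using K(1,2) poly[of q]
    by (meson Rats_1 Rats_divide Rats_minus_iff Rats_of_int subsetD)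
  finally show ?thesis .
qed

section \<open>Minkowski's linear forms theorem\<close>

text \<open>Vectors of the lattice with minimal first nonzero entry form a triangular basis. Its determinant
  divides that of the given matrix and bounds the number of classes modulo the lattice, so two points
  of a larger box are congruent.\<close>

lemma lattice_box_collision:
  fixes a :: "nat \<Rightarrow> nat \<Rightarrow> int" and h :: "nat \<Rightarrow> nat" and m :: nat
  assumes nz: "det (mat m m (\<lambda>(i,j). a i j)) \<noteq> 0"
    and small: "\<bar>det (mat m m (\<lambda>(i,j). a i j))\<bar> < (\<Prod>i<m. int (h i))"
  obtains x where "\<exists>j<m. x j \<noteq> 0" "\<And>i. i < m \<Longrightarrow> \<bar>\<Sum>j<m. a i j * x j\<bar> < int (h i)"
proof -
  define M where "M = mat m m (\<lambda>(i,j). a i j)"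
  have M: "M \<in> carrier_mat m m" by (simp add: M_def)
  define ap where "ap x i = (\<Sum>j<m. a i j * x j)" for x i
  have ap_lin: "ap (\<lambda>j. x j + c * y j) i = ap x i + c * ap y i" for x y c i
    by (simp add: ap_def algebra_simps sum.distrib sum_distrib_left)
  \<comment> \<open>Some lattice point vanishes in all coordinates before \<open>k\<close> and has
    the positive entry \<open>n\<close> at \<open>k\<close>. The least such \<open>n\<close> becomes
    the \<open>k\<close>-th diagonal entry \<open>d k\<close> of the triangular basis.\<close>
  define P where "P k n \<longleftrightarrow> n > 0 \<and> (\<exists>x. (\<forall>i<k. ap x i = 0) \<and> ap x k = int n)" for k n
  define d where "d k = (LEAST n. P k n)" for k
  have ex: "P k (nat \<bar>det M\<bar>)" if k: "k < m" for k
  proof -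
    \<comment> \<open>The \<open>k\<close>-th column of the adjugate is mapped to det M times the
      \<open>k\<close>-th unit vector, and the sign makes the entry positive. So the set whose least
      element is taken is not empty.\<close>
    define x where "x j = sgn (det M) * adj_mat M $$ (j,k)" for j
    have adj: "adj_mat M \<in> carrier_mat m m" "M * adj_mat M = det M \<cdot>\<^sub>m 1\<^sub>m m"
      using adj_mat[OF M] by auto
    have "ap x i = sgn (det M) * (M * adj_mat M) $$ (i,k)" if "i < m" for i
      using that k adj(1) M
      by (simp add: ap_def x_def scalar_prod_def M_def atLeast0LessThan sum_distrib_left algebra_simps)
    hence "ap x i = (if i = k then \<bar>det M\<bar> else 0)" if "i < m" for i
      using that k by (simp add: adj(2) sgn_mult_abs abs_sgn mult.commute)
    thus ?thesis using k nz unfolding P_def by (auto simp: M_def intro!: exI[of _ x])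
  qed
  have Pd: "P k (d k)" if "k < m" for k
    unfolding d_def by (rule LeastI_ex) (use ex[OF that] in blast)
  hence dpos: "d k > 0" if "k < m" for k using that by (auto simp: P_def)
  from Pd have "\<forall>k. \<exists>x. k < m \<longrightarrow> (\<forall>i<k. ap x i = 0) \<and> ap x k = int (d k)"
    unfolding P_def by blast
  then obtain b where b: "\<And>k i. k < m \<Longrightarrow> i < k \<Longrightarrow> ap (b k) i = 0"
      "\<And>k. k < m \<Longrightarrow> ap (b k) k = int (d k)" by metis
  have dvd: "int (d k) dvd ap x k" if k: "k < m" and x: "\<And>i. i < k \<Longrightarrow> ap x i = 0" for k x
  proof (rule ccontr)
    assume nd: "\<not> int (d k) dvd ap x k"
    define r where "r = ap x k mod int (d k)"
    define y where "y = (\<lambda>j. x j + (- (ap x k div int (d k))) * b k j)"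
    have r: "0 < r" "r < int (d k)" using nd dpos[OF k]
      by (auto simp: r_def dvd_eq_mod_eq_0 intro: order.not_eq_order_implies_strict)
    have "ap y k = r" unfolding y_def ap_lin b(2)[OF k] r_def
      by (simp add: minus_div_mult_eq_mod[symmetric])
    moreover have "\<forall>i<k. ap y i = 0" unfolding y_def ap_lin using b(1)[OF k] x by auto
    ultimately have "P k (nat r)" using r unfolding P_def by auto
    hence "d k \<le> nat r" unfolding d_def by (rule Least_le)
    thus False using r by simp
  qed
  have repr: "\<exists>c. \<forall>i<k. ap (\<lambda>l. x l - (\<Sum>j<k. c j * b j l)) i = 0" if "k \<le> m" for x k
    using that
  proof (induction k)
    case (Suc k)
    then obtain c where c: "\<forall>i<k. ap (\<lambda>l. x l - (\<Sum>j<k. c j * b j l)) i = 0" by auto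
    define y where "y = (\<lambda>l. x l - (\<Sum>j<k. c j * b j l))"
    have k: "k < m" using Suc.prems by simp
    have "int (d k) dvd ap y k" by (rule dvd[OF k]) (use c y_def in auto)
    then obtain q where q: "ap y k = int (d k) * q" by (auto simp: dvd_def)
    define c' where "c' = c(k := q)"
    have "(\<lambda>l. x l - (\<Sum>j<Suc k. c' j * b j l)) = (\<lambda>l. y l + (- q) * b k l)"
      by (simp add: fun_eq_iff y_def c'_def)
    moreover have "ap (\<lambda>l. y l + (- q) * b k l) i = 0" if "i < Suc k" for i
      unfolding ap_lin using that c b[OF k] q by (cases "i = k") (auto simp: y_def)
    ultimately show ?case by metis
  qed auto
  have coords: "\<exists>c. \<forall>i<m. ap x i = (\<Sum>j<m. c j * ap (b j) i)" for x
  proof -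
    obtain c where c: "\<forall>i<m. ap (\<lambda>l. x l - (\<Sum>j<m. c j * b j l)) i = 0" using repr[of m x] by auto
    have "ap (\<lambda>l. x l - (\<Sum>j<m. c j * b j l)) i = ap x i - (\<Sum>j<m. c j * ap (b j) i)" for i
    proof -
      have "ap (\<lambda>l. x l - (\<Sum>j<m. c j * b j l)) i
          = ap x i - (\<Sum>l<m. \<Sum>j<m. a i l * (c j * b j l))"
        by (simp add: ap_def algebra_simps sum_subtractf sum_distrib_left)
      also have "(\<Sum>l<m. \<Sum>j<m. a i l * (c j * b j l)) = (\<Sum>j<m. c j * ap (b j) i)"
        by (subst sum.swap) (simp add: ap_def sum_distrib_left algebra_simps)
      finally show ?thesis .
    qed
    thus ?thesis using c by (intro exI[of _ c]) auto
  qed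
  have reduce: "\<exists>x. \<forall>i<k. 0 \<le> z i - ap x i \<and> z i - ap x i < int (d i)" if "k \<le> m" for z k
    using that
  proof (induction k)
    case (Suc k)
    then obtain x where x: "\<forall>i<k. 0 \<le> z i - ap x i \<and> z i - ap x i < int (d i)" by auto
    have k: "k < m" using Suc.prems by simp
    define q where "q = (z k - ap x k) div int (d k)"
    define y where "y = (\<lambda>j. x j + q * b k j)"
    have "z i - ap y i = z i - ap x i" if "i < k" for i
      using b(1)[OF k that] by (simp add: y_def ap_lin)
    moreover have "z k - ap y k = (z k - ap x k) mod int (d k)"
      unfolding y_def ap_lin b(2)[OF k] q_def by (simp add: minus_div_mult_eq_mod[symmetric] algebra_simps)
    ultimately have "0 \<le> z i - ap y i \<and> z i - ap y i < int (d i)" if "i < Suc k" for i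
      using that x dpos[OF k] by (cases "i = k") auto
    thus ?case by blast
  qed auto
  \<comment> \<open>The columns of \<open>M\<close> are integer combinations of the triangular
    basis, so M = B Y with det B the product of the \<open>d k\<close>; the nonzero integer det Y
    has absolute value at least 1.\<close>
  have "(\<Prod>k<m. int (d k)) \<le> \<bar>det M\<bar>"
  proof -
    have "\<forall>l. \<exists>c. \<forall>i<m. ap (\<lambda>j. if j = l then 1 else 0) i = (\<Sum>j<m. c j * ap (b j) i)"
      using coords by blast
    then obtain C where C: "\<And>l i. i < m \<Longrightarrow>
        ap (\<lambda>j. if j = l then 1 else 0) i = (\<Sum>j<m. C l j * ap (b j) i)" by metis
    have unit: "ap (\<lambda>j. if j = l then 1 else 0) i = a i l" if "l < m" for i l
      using that by (simp add: ap_def if_distrib[of "\<lambda>x. _ * x"] cong: if_cong)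
    define B where "B = mat m m (\<lambda>(i,j). ap (b j) i)"
    define Y where "Y = mat m m (\<lambda>(j,l). C l j)"
    have B: "B \<in> carrier_mat m m" and Y: "Y \<in> carrier_mat m m" by (auto simp: B_def Y_def)
    have "M = B * Y"
      by (rule eq_matI)
        (auto simp: M_def B_def Y_def scalar_prod_def atLeast0LessThan C mult.commute simp flip: unit)
    hence det: "det M = det B * det Y" using det_mult[OF B Y] by simp
    have "det B = prod_list (diag_mat B)"
      by (rule det_lower_triangular[OF _ B]) (auto simp: B_def b(1))
    also have "\<dots> = (\<Prod>k<m. int (d k))"
      by (simp add: prod_list_diag_prod atLeast0LessThan B_def b(2))
    finally have detB: "det B = (\<Prod>k<m. int (d k))" .
    have "det Y \<noteq> 0" using det nz by (auto simp: M_def)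
    hence "1 \<le> \<bar>det Y\<bar>" by simp
    moreover have "0 \<le> (\<Prod>k<m. int (d k))" by (intro prod_nonneg) auto
    ultimately show ?thesis unfolding det abs_mult detB
      by (metis abs_of_nonneg mult_left_mono mult.right_neutral)
  qed
  also have "\<dots> < (\<Prod>i<m. int (h i))" using small by (simp add: M_def)
  finally have "(\<Prod>k<m. d k) < (\<Prod>i<m. h i)"
    by (simp flip: of_nat_prod)
  moreover define box where "box g = PiE {..<m} (\<lambda>i. {0..<int (g i)})" for g :: "nat \<Rightarrow> nat"
  have "card (box g) = (\<Prod>i<m. g i)" for g by (simp add: box_def card_PiE)
  ultimately have less: "card (box d) < card (box h)" by simp
  have "\<forall>z. \<exists>x. \<forall>i<m. 0 \<le> z i - ap x i \<and> z i - ap x i < int (d i)" using reduce by blast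
  then obtain X where X: "\<And>z i. i < m \<Longrightarrow> 0 \<le> z i - ap (X z) i"
      "\<And>z i. i < m \<Longrightarrow> z i - ap (X z) i < int (d i)" by metis
  define \<rho> where "\<rho> z = (\<lambda>i\<in>{..<m}. z i - ap (X z) i)" for z
  have "\<rho> ` box h \<subseteq> box d" using X by (auto simp: \<rho>_def box_def)
  moreover have "finite (box g)" for g by (simp add: box_def finite_PiE)
  ultimately have "\<not> inj_on \<rho> (box h)"
    using less card_inj_on_le[of \<rho> "box h" "box d"] by auto
  then obtain z z' where z: "z \<in> box h" "z' \<in> box h" "z \<noteq> z'" "\<rho> z = \<rho> z'"
    by (auto simp: inj_on_def)
  define x where "x = (\<lambda>j. X z j + (- 1) * X z' j)"
  have eq: "ap x i = z i - z' i" if "i < m" for i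
  proof -
    have "z i - ap (X z) i = z' i - ap (X z') i"
      using fun_cong[OF z(4), of i] that by (simp add: \<rho>_def)
    thus ?thesis unfolding x_def ap_lin by simp
  qed
  show thesis
  proof (rule that[of x])
    show "\<exists>j<m. x j \<noteq> 0"
    proof (rule ccontr)
      assume "\<not> ?thesis"
      hence "ap x i = 0" for i by (simp add: ap_def)
      hence "z i = z' i" if "i < m" for i using eq that by simp
      hence "z = z'" using z(1,2) by (intro PiE_ext) (auto simp: box_def)
      thus False using z(3) by simp
    qed
    fix i assume i: "i < m"
    have "z i \<in> {0..<int (h i)}" "z' i \<in> {0..<int (h i)}" using z i by (auto simp: box_def PiE_def Pi_def)
    thus "\<bar>\<Sum>j<m. a i j * x j\<bar> < int (h i)" using eq[OF i] by (auto simp: ap_def)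
  qed
qed

lemma tendsto_det:
  fixes f :: "nat \<Rightarrow> nat \<Rightarrow> nat \<Rightarrow> real"
  assumes "\<And>i j. i < m \<Longrightarrow> j < m \<Longrightarrow> (\<lambda>q. f q i j) \<longlonglongrightarrow> A i j"
  shows "(\<lambda>q. det (mat m m (\<lambda>(i,j). f q i j))) \<longlonglongrightarrow> det (mat m m (\<lambda>(i,j). A i j))"
proof -
  have less: "p i < m" if "p permutes {0..<m}" "i < m" for p i
    using permutes_in_image[OF that(1), of i] that(2) by simp
  have eq: "det (mat m m (\<lambda>(i,j). g i j))
      = (\<Sum>p | p permutes {0..<m}. signof p * (\<Prod>i = 0..<m. g i (p i)))" for g :: "nat \<Rightarrow> nat \<Rightarrow> real"
    by (subst det_def'[of _ m]) (auto intro!: sum.cong prod.cong simp: less)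
  show ?thesis unfolding eq
    by (intro tendsto_sum tendsto_mult tendsto_const tendsto_prod assms)
      (auto simp: less)
qed

text \<open>The matrix scaled by a large natural number \<open>q\<close> is rounded to an integer matrix. The vectors found
  in this way are bounded independently of \<open>q\<close>, so one of them survives the limit.\<close>

lemma minkowski_linear_forms:
  fixes A :: "nat \<Rightarrow> nat \<Rightarrow> real"
  assumes m: "m > 0" and det1: "\<bar>det (mat m m (\<lambda>(i,j). A i j))\<bar> = 1"
  obtains x :: "nat \<Rightarrow> int" where "\<exists>j<m. x j \<noteq> 0" "\<bar>\<Sum>j<m. A 0 j * x j\<bar> \<le> 1"
    "\<And>i. 0 < i \<Longrightarrow> i < m \<Longrightarrow> \<bar>\<Sum>j<m. A i j * x j\<bar> < 1"
proof -
  define AM where "AM = mat m m (\<lambda>(i,j). A i j)"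
  have AM: "AM \<in> carrier_mat m m" by (simp add: AM_def)
  define y where "y x i = (\<Sum>j<m. A i j * real_of_int (x j))" for x i
  \<comment> \<open>The adjugate inverts the matrix up to sign because the determinant is 1 or -1,
    so the coordinates of \<open>x\<close> are bounded by the values of the forms.\<close>
  obtain K where K: "K > 0" "\<And>x j. j < m \<Longrightarrow> \<bar>real_of_int (x j)\<bar> \<le> K * (\<Sum>i<m. \<bar>y x i\<bar>)"
  proof -
    define C where "C = adj_mat AM"
    have C: "C \<in> carrier_mat m m" "C * AM = det AM \<cdot>\<^sub>m 1\<^sub>m m" using adj_mat[OF AM] by (auto simp: C_def)
    define K where "K = 1 + (\<Sum>i<m. \<Sum>j<m. \<bar>C $$ (i,j)\<bar>)"
    have bound: "\<bar>C $$ (i,j)\<bar> \<le> K" if "i < m" "j < m" for i j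
    proof -
      have "\<bar>C $$ (i,j)\<bar> \<le> (\<Sum>j<m. \<bar>C $$ (i,j)\<bar>)"
        using that by (intro member_le_sum) auto
      also have "\<dots> \<le> (\<Sum>i<m. \<Sum>j<m. \<bar>C $$ (i,j)\<bar>)"
        using that by (intro member_le_sum[of i "{..<m}" "\<lambda>i. \<Sum>j<m. \<bar>C $$ (i,j)\<bar>"]) (auto intro: sum_nonneg)
      finally show ?thesis by (simp add: K_def)
    qed
    have "K > 0" unfolding K_def by (intro add_pos_nonneg sum_nonneg) auto
    moreover have "\<bar>real_of_int (x j)\<bar> \<le> K * (\<Sum>i<m. \<bar>y x i\<bar>)" if j: "j < m" for x j
    proof -
      have "det AM * x j = (\<Sum>k<m. (det AM \<cdot>\<^sub>m 1\<^sub>m m) $$ (j,k) * x k)"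
        using j by (simp add: if_distrib[of "\<lambda>x. _ * x"] if_distrib[of "\<lambda>x. x * _"] cong: if_cong)
      also have "\<dots> = (\<Sum>k<m. \<Sum>i<m. C $$ (j,i) * A i k * x k)"
        unfolding C(2)[symmetric] using j C(1)
        by (intro sum.cong refl) (simp add: scalar_prod_def AM_def atLeast0LessThan sum_distrib_right)
      also have "\<dots> = (\<Sum>i<m. C $$ (j,i) * y x i)"
        by (subst sum.swap) (simp add: y_def sum_distrib_left mult.assoc)
      finally have "\<bar>det AM * x j\<bar> = \<bar>\<Sum>i<m. C $$ (j,i) * y x i\<bar>" by simp
      hence "\<bar>real_of_int (x j)\<bar> = \<bar>\<Sum>i<m. C $$ (j,i) * y x i\<bar>"
        using det1 by (simp add: AM_def abs_mult)
      also have "\<dots> \<le> (\<Sum>i<m. \<bar>C $$ (j,i) * y x i\<bar>)" by (rule sum_abs)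
      also have "\<dots> \<le> (\<Sum>i<m. K * \<bar>y x i\<bar>)"
        using j by (intro sum_mono) (auto simp: abs_mult intro!: mult_right_mono bound)
      finally show ?thesis by (simp add: sum_distrib_left)
    qed
    ultimately show thesis by (rule that)
  qed
  \<comment> \<open>Let S be the sum of the absolute values of the forms and Y that of the
    coordinates. For large q, rounding gives q S <= m (3 q + Y) and m Y <= q S / 2, so S <= 6 m and
    Y <= m K S <= \<open>X\<close>. This bound does not involve q.\<close>
  define X where "X = real m * (K * (6 * real m))"
  have X0: "X \<ge> 0" using K(1) by (simp add: X_def)
  \<comment> \<open>\<open>c\<close> exceeds the rounding error Y <= \<open>X\<close>; shortening
    the sides of the box by it keeps the inequalities strict after rounding.\<close>
  define c where "c = nat \<lceil>X\<rceil> + 1"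
  have c: "X + 1 \<le> real c" using X0 by (simp add: c_def)
  define good where "good x \<longleftrightarrow> (\<exists>j<m. x j \<noteq> 0) \<and> (\<forall>j<m. \<bar>real_of_int (x j)\<bar> \<le> X) \<and>
      (\<forall>i. 0 < i \<longrightarrow> i < m \<longrightarrow> \<bar>y x i\<bar> < 1)" for x
  \<comment> \<open>Slack in form 0 pays for the volume lost by shortening the other sides from
    \<open>q\<close> to \<open>q - c\<close>; a minimum over finitely many vectors removes it
    afterwards.\<close>
  have main: "\<exists>x. good x \<and> \<bar>y x 0\<bar> \<le> 1 + 2 * \<epsilon>" if \<epsilon>: "0 < \<epsilon>" "\<epsilon> \<le> 1" for \<epsilon> :: real
  proof -
    define a where "a q i j = \<lfloor>real q * A i j\<rfloor>" for q i j :: nat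
    define h where "h q i = (if i = 0 then nat \<lceil>real q * (1 + \<epsilon>)\<rceil> else q - c)" for q i :: nat
    have lim: "(\<lambda>q. real_of_int (a q i j) / real q) \<longlonglongrightarrow> A i j" for i j
    proof (rule real_tendsto_sandwich)
      have fl: "real q * A i j - 1 \<le> real_of_int (a q i j)" "real_of_int (a q i j) \<le> real q * A i j" for q
        unfolding a_def by linarith+
      show "\<forall>\<^sub>F q in sequentially. A i j - 1 / real q \<le> real_of_int (a q i j) / real q"
        using eventually_gt_at_top[of 0]
      proof eventually_elim
        case (elim q)
        thus ?case using divide_right_mono[OF fl(1), of "real q" q] by (simp add: diff_divide_distrib)
      qed
      show "\<forall>\<^sub>F q in sequentially. real_of_int (a q i j) / real q \<le> A i j"
        using eventually_gt_at_top[of 0]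
      proof eventually_elim
        case (elim q)
        thus ?case using divide_right_mono[OF fl(2), of "real q" q] by simp
      qed
      show "(\<lambda>q. A i j - 1 / real q) \<longlonglongrightarrow> A i j"
        by (rule tendsto_eq_intros tendsto_const lim_1_over_n refl | simp)+
    qed auto
    define D where "D q = det (mat m m (\<lambda>(i,j). a q i j))" for q
    have D: "real_of_int (D q) / real q ^ m = det (mat m m (\<lambda>(i,j). real_of_int (a q i j) / real q))"
      if "q > 0" for q
    proof -
      have "mat m m (\<lambda>(i,j). real_of_int (a q i j) / real q)
          = (1 / real q) \<cdot>\<^sub>m map_mat real_of_int (mat m m (\<lambda>(i,j). a q i j))"
        by (rule eq_matI) auto
      hence "det (mat m m (\<lambda>(i,j). real_of_int (a q i j) / real q)) = (1 / real q) ^ m * real_of_int (D q)"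
        by (simp add: D_def)
      thus ?thesis by (simp add: power_divide)
    qed
    have "(\<lambda>q. \<bar>det (mat m m (\<lambda>(i,j). real_of_int (a q i j) / real q))\<bar>) \<longlonglongrightarrow> \<bar>det (mat m m (\<lambda>(i,j). A i j))\<bar>"
      by (intro tendsto_rabs tendsto_det lim)
    hence limD: "(\<lambda>q. \<bar>det (mat m m (\<lambda>(i,j). real_of_int (a q i j) / real q))\<bar>) \<longlonglongrightarrow> 1"
      by (simp add: det1)
    have "(\<lambda>q. (1 + \<epsilon>) * (1 - real c * (1 / real q)) ^ (m - 1)) \<longlonglongrightarrow> (1 + \<epsilon>) * (1 - real c * 0) ^ (m - 1)"
      by (intro tendsto_intros lim_1_over_n)
    hence limh: "(\<lambda>q. (1 + \<epsilon>) * (1 - real c / real q) ^ (m - 1)) \<longlonglongrightarrow> 1 + \<epsilon>" by simp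
    have "\<forall>\<^sub>F q in sequentially. \<bar>det (mat m m (\<lambda>(i,j). real_of_int (a q i j) / real q))\<bar> > 1 / 2"
      by (rule order_tendstoD(1)[OF limD]) simp
    moreover have "\<forall>\<^sub>F q in sequentially. \<bar>det (mat m m (\<lambda>(i,j). real_of_int (a q i j) / real q))\<bar> < 1 + \<epsilon> / 2"
      by (rule order_tendstoD(2)[OF limD]) (use \<epsilon> in simp)
    moreover have "\<forall>\<^sub>F q in sequentially. (1 + \<epsilon>) * (1 - real c / real q) ^ (m - 1) > 1 + \<epsilon> / 2"
      by (rule order_tendstoD(1)[OF limh]) (use \<epsilon> in simp)
    moreover have "\<forall>\<^sub>F q in sequentially. real q \<ge> 2 * real m * real m * K"
      using filterlim_real_sequentially by (auto simp: filterlim_at_top)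
    moreover have "\<forall>\<^sub>F q in sequentially. real q \<ge> (2 + X) / \<epsilon>"
      using filterlim_real_sequentially by (auto simp: filterlim_at_top)
    moreover have "\<forall>\<^sub>F q in sequentially. q > c" by (rule eventually_gt_at_top)
    ultimately have "\<forall>\<^sub>F q in sequentially. \<exists>x. good x \<and> \<bar>y x 0\<bar> \<le> 1 + 2 * \<epsilon>"
    proof eventually_elim
      \<comment> \<open>The first threshold makes the integer determinant nonzero; the next two put
        it below the volume of the box; the fourth gives m Y <= q S / 2; the fifth absorbs the error
        \<open>2 + X\<close> of form 0 into \<open>q * \<epsilon>\<close>.\<close>
      case (elim q)
      have q: "q > 0" "q > c" using elim by auto
      have D': "\<bar>real_of_int (D q)\<bar> / real q ^ m = \<bar>det (mat m m (\<lambda>(i,j). real_of_int (a q i j) / real q))\<bar>"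
        using D[OF q(1)] by (metis abs_divide abs_of_nat power_abs)
      have Dnz: "D q \<noteq> 0" using D' elim(1) by auto
      have "real_of_int \<bar>D q\<bar> < (1 + \<epsilon>) * (1 - real c / real q) ^ (m - 1) * real q ^ m"
        using D' elim(2,3) q(1) by (simp add: pos_divide_less_eq[symmetric])
      also have "\<dots> = (real q * (1 + \<epsilon>)) * (real q - real c) ^ (m - 1)"
      proof -
        have "real q ^ m = real q * real q ^ (m - 1)" using m by (cases m) auto
        moreover have "(1 - real c / real q) ^ (m - 1) * real q ^ (m - 1) = (real q - real c) ^ (m - 1)"
          using q by (simp flip: power_mult_distrib add: left_diff_distrib)
        ultimately show ?thesis by (simp add: mult_ac)
      qed
      also have "\<dots> \<le> (\<Prod>i<m. real (h q i))"
      proof -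
        have "(\<Prod>i<m. real (h q i)) = real (h q 0) * (\<Prod>i\<in>{..<m} - {0}. real (h q i))"
          using m by (intro prod.remove) auto
        also have "(\<Prod>i\<in>{..<m} - {0}. real (h q i)) = (\<Prod>i\<in>{..<m} - {0}. (real q - real c))"
          using q by (intro prod.cong) (auto simp: h_def of_nat_diff)
        also have "\<dots> = (real q - real c) ^ (m - 1)" using m by simp
        finally have "(\<Prod>i<m. real (h q i)) = real (h q 0) * (real q - real c) ^ (m - 1)" .
        moreover have "real q * (1 + \<epsilon>) \<le> real (h q 0)" unfolding h_def if_P[OF refl] by (rule real_nat_ceiling_ge)
        ultimately show ?thesis using q by (simp only:) (intro mult_right_mono; simp)
      qed
      finally have "real_of_int \<bar>D q\<bar> < real_of_int (\<Prod>i<m. int (h q i))" by simp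
      hence "\<bar>D q\<bar> < (\<Prod>i<m. int (h q i))" by (simp only: of_int_less_iff)
      then obtain x where x: "\<exists>j<m. x j \<noteq> 0" "\<And>i. i < m \<Longrightarrow> \<bar>\<Sum>j<m. a q i j * x j\<bar> < int (h q i)"
        using lattice_box_collision[of m "a q" "h q"] Dnz unfolding D_def by blast
      define S where "S = (\<Sum>i<m. \<bar>y x i\<bar>)"
      define Y where "Y = (\<Sum>j<m. \<bar>real_of_int (x j)\<bar>)"
      have YS: "Y \<le> real m * (K * S)"
      proof -
        have "Y \<le> (\<Sum>j<m. K * S)" unfolding Y_def S_def by (intro sum_mono K) auto
        thus ?thesis by simp
      qed
      have err: "real q * \<bar>y x i\<bar> \<le> real_of_int \<bar>\<Sum>j<m. a q i j * x j\<bar> + Y" for i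
      proof -
        have "real q * y x i - real_of_int (\<Sum>j<m. a q i j * x j) = (\<Sum>j<m. (real q * A i j - a q i j) * x j)"
          by (simp add: y_def sum_distrib_left sum_subtractf algebra_simps)
        moreover have "\<bar>\<Sum>j<m. (real q * A i j - a q i j) * x j\<bar> \<le> Y" unfolding Y_def
        proof (rule order.trans[OF sum_abs], rule sum_mono)
          fix j
          have "\<bar>real q * A i j - a q i j\<bar> \<le> 1" unfolding a_def by linarith
          thus "\<bar>(real q * A i j - a q i j) * x j\<bar> \<le> \<bar>real_of_int (x j)\<bar>"
            by (simp add: abs_mult mult_left_le_one_le)
        qed
        moreover have "real q * \<bar>y x i\<bar> = \<bar>real q * y x i\<bar>" by (simp add: abs_mult)
        ultimately show ?thesis by simp
      qed
      have h3: "real (h q i) \<le> 3 * real q" if "i < m" for i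
      proof (cases "i = 0")
        case True
        have "real q * (1 + \<epsilon>) \<le> real q * 2" using \<epsilon> by (intro mult_left_mono) auto
        hence "real_of_int \<lceil>real q * (1 + \<epsilon>)\<rceil> \<le> 2 * real q + 1" by linarith
        moreover have "0 \<le> real q * (1 + \<epsilon>)" using \<epsilon> by simp
        ultimately show ?thesis using True q by (simp add: h_def)
      qed (use q in \<open>auto simp: h_def of_nat_diff\<close>)
      have "real q * S \<le> (\<Sum>i<m. 3 * real q + Y)"
        unfolding S_def sum_distrib_left
      proof (rule sum_mono)
        fix i assume "i \<in> {..<m}"
        hence i: "i < m" by simp
        have "real_of_int \<bar>\<Sum>j<m. a q i j * x j\<bar> \<le> real_of_int (int (h q i))"
          using x(2)[OF i] by (simp only: of_int_le_iff)
        thus "real q * \<bar>y x i\<bar> \<le> 3 * real q + Y" using err[of i] h3[OF i] by simp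
      qed
      hence "real q * S \<le> real m * (3 * real q) + real m * Y" by (simp add: algebra_simps)
      also have "real m * Y \<le> real m * (real m * (K * S))" using YS by (intro mult_left_mono) auto
      also have "real m * (real m * (K * S)) \<le> real q / 2 * S"
      proof -
        have "S \<ge> 0" by (simp add: S_def sum_nonneg)
        thus ?thesis using mult_right_mono[OF elim(4), of S] by (simp add: mult_ac)
      qed
      finally have "real q * S \<le> real q * (6 * real m)" by (simp add: algebra_simps)
      hence "S \<le> 6 * real m" using q by simp
      hence "real m * (K * S) \<le> X" unfolding X_def using K(1) by (intro mult_left_mono) auto
      hence YX: "Y \<le> X" using YS by simp
      have "\<bar>real_of_int (x j)\<bar> \<le> X" if "j < m" for j
      proof -
        have "\<bar>real_of_int (x j)\<bar> \<le> Y" unfolding Y_def using that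
          by (intro member_le_sum[of j "{..<m}" "\<lambda>j. \<bar>real_of_int (x j)\<bar>"]) auto
        thus ?thesis using YX by simp
      qed
      moreover have "\<bar>y x i\<bar> < 1" if i: "0 < i" "i < m" for i
      proof -
        have "real_of_int \<bar>\<Sum>j<m. a q i j * x j\<bar> < real_of_int (int (h q i))"
          using x(2)[OF i(2)] by (simp only: of_int_less_iff)
        also have "\<dots> = real q - real c" using i q by (simp add: h_def of_nat_diff)
        finally have "real q * \<bar>y x i\<bar> < real q * 1" using err[of i] c YX by linarith
        thus ?thesis using q by (simp only: mult_less_cancel_left_pos of_nat_0_less_iff)
      qed
      moreover have "\<bar>y x 0\<bar> \<le> 1 + 2 * \<epsilon>"
      proof -
        have "real_of_int \<bar>\<Sum>j<m. a q 0 j * x j\<bar> < real_of_int (int (h q 0))"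
          using x(2)[OF m] by (simp only: of_int_less_iff)
        also have "\<dots> \<le> real q * (1 + \<epsilon>) + 1"
          using \<epsilon> by (simp add: h_def)
        finally have "real q * \<bar>y x 0\<bar> \<le> real q * (1 + \<epsilon>) + (2 + X)" using err[of 0] YX by linarith
        also have "2 + X \<le> real q * \<epsilon>" using elim(5) \<epsilon> by (simp add: field_simps)
        finally have "real q * \<bar>y x 0\<bar> \<le> real q * (1 + 2 * \<epsilon>)" by (simp add: algebra_simps)
        thus ?thesis using q by (simp only: mult_le_cancel_left_pos of_nat_0_less_iff)
      qed
      ultimately show ?case using x(1) unfolding good_def by blast
    qed
    thus ?thesis by (auto simp: eventually_sequentially)
  qed
  \<comment> \<open>All vectors found for the various \<epsilon> lie, up to restriction, in this one
    finite set. So the value of form 0 has a minimum on it, and a minimum that is at most 1 + 2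
    \<epsilon> for every \<epsilon> is at most 1.\<close>
  define F where "F = {x \<in> PiE {..<m} (\<lambda>_. {-\<lceil>X\<rceil>..\<lceil>X\<rceil>}). good x}"
  have restr: "good (restrict x {..<m}) = good x" "y (restrict x {..<m}) i = y x i" for x i
    by (auto simp: good_def y_def intro!: sum.cong)
  have F: "restrict x {..<m} \<in> F" if "good x" for x
  proof -
    have "x j \<in> {-\<lceil>X\<rceil>..\<lceil>X\<rceil>}" if j: "j < m" for j
    proof -
      have "\<bar>real_of_int (x j)\<bar> \<le> X" using \<open>good x\<close> j by (auto simp: good_def)
      thus ?thesis by simp linarith
    qed
    thus ?thesis using that restr(1) by (auto simp: F_def)
  qed
  have finF: "finite F" unfolding F_def by (rule finite_subset[of _ "PiE {..<m} (\<lambda>_. {-\<lceil>X\<rceil>..\<lceil>X\<rceil>})"]) (auto intro!: finite_PiE)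
  obtain x0 where "good x0" using main[of 1] by auto
  hence neF: "F \<noteq> {}" using F by auto
  define \<mu> where "\<mu> = Min ((\<lambda>x. \<bar>y x 0\<bar>) ` F)"
  have "\<mu> \<in> (\<lambda>x. \<bar>y x 0\<bar>) ` F" unfolding \<mu>_def using finF neF by (intro Min_in) auto
  then obtain x where x: "x \<in> F" "\<bar>y x 0\<bar> = \<mu>" by auto
  have "\<mu> \<le> 1"
  proof (rule ccontr)
    assume "\<not> \<mu> \<le> 1"
    define \<epsilon> where "\<epsilon> = min 1 ((\<mu> - 1) / 3)"
    have \<epsilon>: "0 < \<epsilon>" "\<epsilon> \<le> 1" using \<open>\<not> \<mu> \<le> 1\<close> by (auto simp: \<epsilon>_def)
    have \<epsilon>3: "\<epsilon> \<le> (\<mu> - 1) / 3" unfolding \<epsilon>_def by (rule min.cobounded2)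
    obtain z where z: "good z" "\<bar>y z 0\<bar> \<le> 1 + 2 * \<epsilon>" using main[OF \<epsilon>] by blast
    have "\<mu> \<le> \<bar>y (restrict z {..<m}) 0\<bar>" unfolding \<mu>_def using finF F[OF z(1)] by (intro Min_le) auto
    thus False using z(2) \<epsilon> \<epsilon>3 \<open>\<not> \<mu> \<le> 1\<close> by (simp add: restr)
  qed
  thus thesis using x by (intro that[of x]) (auto simp: F_def good_def y_def)
qed

section \<open>Automorphisms of the field of algebraic numbers\<close>

subsection \<open>Polynomials over subfields\<close>

lemma
  assumes "is_subfield K"
  shows subfield_0: "0 \<in> K" and subfield_1: "1 \<in> K"
    and subfield_add: "x \<in> K \<Longrightarrow> y \<in> K \<Longrightarrow> x + y \<in> K"
    and subfield_mult: "x \<in> K \<Longrightarrow> y \<in> K \<Longrightarrow> x * y \<in> K"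
    and subfield_uminus: "x \<in> K \<Longrightarrow> - x \<in> K"
    and subfield_inverse: "x \<in> K \<Longrightarrow> inverse x \<in> K"
  using assms by (auto simp: is_subfield_def)

lemma subfield_diff: "is_subfield K \<Longrightarrow> x \<in> K \<Longrightarrow> y \<in> K \<Longrightarrow> x - y \<in> K"
  using subfield_add[of K x "- y"] subfield_uminus[of K y] by simp

lemma subfield_divide: "is_subfield K \<Longrightarrow> x \<in> K \<Longrightarrow> y \<in> K \<Longrightarrow> x / y \<in> K"
  using subfield_mult[of K x "inverse y"] subfield_inverse[of K y] by (simp add: divide_inverse)

lemma subfield_sum: "is_subfield K \<Longrightarrow> (\<And>i. i \<in> I \<Longrightarrow> g i \<in> K) \<Longrightarrow> sum g I \<in> K"
  by (induction I rule: infinite_finite_induct) (auto intro: subfield_0 subfield_add)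

lemma subfield_prod: "is_subfield K \<Longrightarrow> (\<And>i. i \<in> I \<Longrightarrow> g i \<in> K) \<Longrightarrow> prod g I \<in> K"
  by (induction I rule: infinite_finite_induct) (auto intro: subfield_1 subfield_mult)

lemma subfield_power: "is_subfield K \<Longrightarrow> x \<in> K \<Longrightarrow> x ^ n \<in> K"
  by (induction n) (auto intro: subfield_1 subfield_mult)

lemma subfield_of_nat: "is_subfield K \<Longrightarrow> of_nat n \<in> K"
  by (induction n) (auto intro: subfield_0 subfield_1 subfield_add)

lemma subfield_of_int: "is_subfield K \<Longrightarrow> of_int n \<in> K"
  by (cases n rule: int_cases2) (auto intro: subfield_of_nat subfield_uminus)

lemma Rats_subset_subfield: "is_subfield K \<Longrightarrow> \<rat> \<subseteq> K"
  by (auto elim!: Rats_cases' intro: subfield_divide subfield_of_int)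

lemma subfield_Rats: "is_subfield \<rat>"
  by (auto simp: is_subfield_def)

lemma subfield_Int: "is_subfield K \<Longrightarrow> is_subfield K' \<Longrightarrow> is_subfield (K \<inter> K')"
  by (auto simp: is_subfield_def)

lemma subfield_algebraic: "is_subfield {x. algebraic x}"
proof -
  have rat: "\<rat> \<subseteq> {x :: complex. algebraic x}" by (auto intro: algebraic_rat)
  have inv: "algebraic (inverse x)" if "algebraic x" for x :: complex
    using inverse_in_algebraic_ring[OF that _ rat] that
    by (cases "x = 0") (auto intro: algebraic_add algebraic_mult)
  have um: "algebraic (- x)" if "algebraic x" for x :: complex
    using algebraic_mult[OF algebraic_rat[of "- 1"] that] by simp
  show ?thesis by (auto simp: is_subfield_def intro: um inv)
qed

lemmas algebraic_diff [intro] = subfield_diff[OF subfield_algebraic, simplified]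
lemmas algebraic_sum [intro] = subfield_sum[OF subfield_algebraic, simplified]
lemmas algebraic_prod [intro] = subfield_prod[OF subfield_algebraic, simplified]
lemmas algebraic_power [intro] = subfield_power[OF subfield_algebraic, simplified]

lemma subfield_gen_field: "is_subfield (gen_field S)"
  by (auto simp: gen_field_def is_subfield_def)

lemma gen_field_superset: "S \<subseteq> gen_field S"
  by (auto simp: gen_field_def)

lemma gen_field_minimal: "is_subfield K \<Longrightarrow> S \<subseteq> K \<Longrightarrow> gen_field S \<subseteq> K"
  by (auto simp: gen_field_def)

lemma gen_field_algebraic: "(\<And>x. x \<in> S \<Longrightarrow> algebraic x) \<Longrightarrow> x \<in> gen_field S \<Longrightarrow> algebraic x"
  using gen_field_minimal[OF subfield_algebraic, of S] by auto

definition coeffs_in :: "complex set \<Rightarrow> complex poly \<Rightarrow> bool" where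
  "coeffs_in K p \<longleftrightarrow> (\<forall>i. coeff p i \<in> K)"

context
  fixes K assumes K: "is_subfield K"
begin

lemma coeffs_in_diff: "coeffs_in K p \<Longrightarrow> coeffs_in K q \<Longrightarrow> coeffs_in K (p - q)"
  using K by (auto simp: coeffs_in_def subfield_diff)

lemma coeffs_in_mult: "coeffs_in K p \<Longrightarrow> coeffs_in K q \<Longrightarrow> coeffs_in K (p * q)"
  using K by (auto simp: coeffs_in_def coeff_mult intro!: subfield_sum subfield_mult)

lemma coeffs_in_smult: "c \<in> K \<Longrightarrow> coeffs_in K q \<Longrightarrow> coeffs_in K (smult c q)"
  using K by (auto simp: coeffs_in_def subfield_mult)

lemma coeffs_in_pCons: "coeffs_in K (pCons c q) \<longleftrightarrow> c \<in> K \<and> coeffs_in K q"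
  using K by (auto simp: coeffs_in_def coeff_pCons split: nat.splits)

lemma coeffs_in_0: "coeffs_in K 0" and coeffs_in_1: "coeffs_in K 1"
  using K by (auto simp: coeffs_in_def subfield_0 subfield_1 coeff_1)

lemma coeffs_in_of_int: "coeffs_in K (map_poly of_int p)"
  using K by (auto simp: coeffs_in_def coeff_map_poly subfield_of_int)

lemma coeffs_in_pderiv: "coeffs_in K p \<Longrightarrow> coeffs_in K (pderiv p)"
  using K by (auto simp: coeffs_in_def coeff_pderiv simp del: of_nat_Suc intro!: subfield_mult subfield_of_nat)

lemma poly_coeffs_in: "coeffs_in K p \<Longrightarrow> x \<in> K \<Longrightarrow> poly p x \<in> K"
  using K by (auto simp: coeffs_in_def poly_altdef intro!: subfield_sum subfield_mult subfield_power)

lemma coeffs_in_division: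
  assumes p: "coeffs_in K p" "lead_coeff p = 1" and g: "coeffs_in K g"
  shows "\<exists>q r. coeffs_in K q \<and> coeffs_in K r \<and> g = p * q + r \<and> (\<forall>i\<ge>degree p. coeff r i = 0)"
  using g
proof (induction g)
  case 0
  thus ?case by (intro exI[of _ 0]) (auto intro: coeffs_in_0)
next
  case (pCons a g)
  from pCons.prems have a: "a \<in> K" "coeffs_in K g" by (auto simp: coeffs_in_pCons)
  from pCons.IH[OF a(2)] obtain q r where qr: "coeffs_in K q" "coeffs_in K r" "g = p * q + r"
    "\<And>i. i \<ge> degree p \<Longrightarrow> coeff r i = 0" by blast
  define t where "t = pCons a r"
  define c where "c = coeff t (degree p)"
  have t: "coeffs_in K t" using a qr by (auto simp: t_def coeffs_in_pCons)
  hence c: "c \<in> K" by (auto simp: c_def coeffs_in_def)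
  have "pCons a g = p * pCons c q + (t - smult c p)"
    by (simp add: qr(3) t_def algebra_simps)
  moreover have "coeff (t - smult c p) i = 0" if "i \<ge> degree p" for i
  proof (cases "i = degree p")
    case True
    thus ?thesis using p(2) by (simp add: c_def)
  next
    case False
    hence i: "i > degree p" using that by simp
    then obtain j where "i = Suc j" "j \<ge> degree p" by (cases i) auto
    thus ?thesis using qr(4)[of j] i by (simp add: t_def coeff_eq_0)
  qed
  moreover have "coeffs_in K (pCons c q)" "coeffs_in K (t - smult c p)"
    using c qr t p by (auto simp: coeffs_in_pCons intro!: coeffs_in_diff coeffs_in_smult)
  ultimately show ?case by blast
qed

text \<open>A monic polynomial of least degree divides the others by division with remainder. That
  the quotient again has coefficients in \<open>K\<close> matters: a homomorphism defined only on
  \<open>K\<close> can then be applied to it.\<close>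

lemma min_poly_exists:
  assumes "algebraic x"
  obtains p where "coeffs_in K p" "lead_coeff p = 1" "poly p x = 0"
    "\<And>g. coeffs_in K g \<Longrightarrow> poly g x = 0 \<Longrightarrow> \<exists>q. coeffs_in K q \<and> g = p * q"
proof -
  from assms obtain p0 where p0: "p0 \<noteq> 0" "poly (map_poly of_int p0) x = 0" by (erule algebraicE')
  let ?P = "\<lambda>n. \<exists>p. p \<noteq> 0 \<and> coeffs_in K p \<and> poly p x = 0 \<and> degree p = n"
  have "?P (degree p0)"
    using p0 by (intro exI[of _ "map_poly of_int p0"]) (auto simp: coeffs_in_of_int)
  hence ex: "?P (LEAST n. ?P n)" by (rule LeastI)
  have min: "(LEAST n. ?P n) \<le> degree g" if "g \<noteq> 0" "coeffs_in K g" "poly g x = 0" for g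
    using that by (intro Least_le) blast
  from ex obtain p1 where p1: "p1 \<noteq> 0" "coeffs_in K p1" "poly p1 x = 0" "degree p1 = (LEAST n. ?P n)"
    by blast
  define p where "p = smult (inverse (lead_coeff p1)) p1"
  have "lead_coeff p1 \<in> K" using p1(2) by (simp add: coeffs_in_def)
  hence p: "coeffs_in K p" "lead_coeff p = 1" "poly p x = 0"
    using p1(1-3) unfolding p_def by (auto intro!: coeffs_in_smult subfield_inverse[OF K])
  have p4: "degree p = (LEAST n. ?P n)"
    unfolding p1(4)[symmetric] using p1(1) by (simp add: p_def)
  have "\<exists>q. coeffs_in K q \<and> g = p * q" if g: "coeffs_in K g" "poly g x = 0" for g
  proof -
    obtain q r where qr: "coeffs_in K q" "coeffs_in K r" "g = p * q + r" "\<forall>i\<ge>degree p. coeff r i = 0"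
      using coeffs_in_division[OF p(1,2) g(1)] by blast
    have "poly r x = 0" using qr(3) g(2) p(3) by simp
    moreover have "degree r < degree p" if "r \<noteq> 0"
      using qr(4) that by (metis leading_coeff_0_iff not_le)
    ultimately have "r = 0" using min[of r] qr(2) p4 by (metis not_le)
    thus ?thesis using qr by auto
  qed
  with p show thesis using that by blast
qed

end

subsection \<open>Extension of homomorphisms\<close>

text \<open>A ring homomorphism from a ring of algebraic numbers to the complex numbers is encoded by its
  graph; chains of graphs then have their union as an upper bound.\<close>

definition hom_graph :: "(complex \<times> complex) set \<Rightarrow> bool" where
  "hom_graph R \<longleftrightarrow> (\<forall>q\<in>\<rat>. (q, q) \<in> R) \<and>
     (\<forall>a a' b b'. (a, a') \<in> R \<longrightarrow> (b, b') \<in> R \<longrightarrow> (a + b, a' + b') \<in> R \<and> (a * b, a' * b') \<in> R) \<and>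
     (\<forall>a a'. (a, a') \<in> R \<longrightarrow> algebraic a) \<and>
     (\<forall>a a' a''. (a, a') \<in> R \<longrightarrow> (a, a'') \<in> R \<longrightarrow> a' = a'')"

definition coeffs_rel :: "(complex \<times> complex) set \<Rightarrow> complex poly \<Rightarrow> complex poly \<Rightarrow> bool" where
  "coeffs_rel R p p' \<longleftrightarrow> (\<forall>i. (coeff p i, coeff p' i) \<in> R)"

context
  fixes R assumes R: "hom_graph R"
begin

lemma hom_graph_rat: "q \<in> \<rat> \<Longrightarrow> (q, q) \<in> R"
  and hom_graph_add: "(a, a') \<in> R \<Longrightarrow> (b, b') \<in> R \<Longrightarrow> (a + b, a' + b') \<in> R"
  and hom_graph_mult: "(a, a') \<in> R \<Longrightarrow> (b, b') \<in> R \<Longrightarrow> (a * b, a' * b') \<in> R"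
  and hom_graph_algebraic: "(a, a') \<in> R \<Longrightarrow> algebraic a"
  and hom_graph_unique: "(a, a') \<in> R \<Longrightarrow> (a, a'') \<in> R \<Longrightarrow> a' = a''"
  using R unfolding hom_graph_def by blast+

lemma hom_graph_uminus: "(a, a') \<in> R \<Longrightarrow> (- a, - a') \<in> R"
  using hom_graph_mult[OF hom_graph_rat[of "- 1"]] by simp

lemma hom_graph_sum: "(\<And>i. i \<in> I \<Longrightarrow> (g i, g' i) \<in> R) \<Longrightarrow> (sum g I, sum g' I) \<in> R"
  by (induction I rule: infinite_finite_induct) (auto intro: hom_graph_add hom_graph_rat)

lemma subfield_Domain: "is_subfield (Domain R)"
  unfolding is_subfield_def
proof (intro conjI ballI)
  have rat: "\<rat> \<subseteq> Domain R" using hom_graph_rat by auto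
  show "0 \<in> Domain R" "1 \<in> Domain R" using rat by auto
  fix x assume x: "x \<in> Domain R"
  show "- x \<in> Domain R" using x by (auto dest: hom_graph_uminus)
  show add: "x + y \<in> Domain R" "x * y \<in> Domain R" if "y \<in> Domain R" for y
    using x that by (auto dest: hom_graph_add hom_graph_mult)
  show "inverse x \<in> Domain R"
  proof (cases "x = 0")
    case False
    have "algebraic x" using x by (auto intro: hom_graph_algebraic)
    thus ?thesis
      by (rule inverse_in_algebraic_ring[OF _ False rat _ x]) (auto dest: hom_graph_add hom_graph_mult)
  qed (use rat in auto)
qed

lemma coeffs_rel_add: "coeffs_rel R p p' \<Longrightarrow> coeffs_rel R q q' \<Longrightarrow> coeffs_rel R (p + q) (p' + q')"
  by (auto simp: coeffs_rel_def intro: hom_graph_add)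

lemma coeffs_rel_uminus: "coeffs_rel R p p' \<Longrightarrow> coeffs_rel R (- p) (- p')"
  by (auto simp: coeffs_rel_def intro: hom_graph_uminus)

lemma coeffs_rel_mult: "coeffs_rel R p p' \<Longrightarrow> coeffs_rel R q q' \<Longrightarrow> coeffs_rel R (p * q) (p' * q')"
  by (auto simp: coeffs_rel_def coeff_mult intro!: hom_graph_sum hom_graph_mult)

lemma coeffs_rel_pCons: "(a, a') \<in> R \<Longrightarrow> coeffs_rel R q q' \<Longrightarrow> coeffs_rel R (pCons a q) (pCons a' q')"
  by (auto simp: coeffs_rel_def coeff_pCons split: nat.splits)

lemma coeffs_rel_0: "coeffs_rel R 0 0"
  by (auto simp: coeffs_rel_def hom_graph_rat)

lemma coeffs_rel_unique: "coeffs_rel R p p' \<Longrightarrow> coeffs_rel R p p'' \<Longrightarrow> p' = p''"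
  by (auto simp: coeffs_rel_def poly_eq_iff intro: hom_graph_unique)

lemma coeffs_rel_exists: "coeffs_in (Domain R) p \<Longrightarrow> \<exists>p'. coeffs_rel R p p'"
proof (induction p)
  case (pCons a p)
  thus ?case using coeffs_rel_pCons coeffs_in_pCons[OF subfield_Domain] by blast
qed (use coeffs_rel_0 in blast)

text \<open>The new graph consists of the values of corresponding polynomials at \<open>x\<close>
  and \<open>y\<close>. It is a function because polynomials with the same value at \<open>x\<close>
  differ by a multiple of \<open>p\<close>, so that their images differ by a multiple of
  \<open>p'\<close>, which vanishes at \<open>y\<close>.\<close>

lemma hom_graph_extend:
  assumes x: "algebraic x"
    and p: "coeffs_in (Domain R) p" "\<And>g. coeffs_in (Domain R) g \<Longrightarrow> poly g x = 0 \<Longrightarrow>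
      \<exists>q. coeffs_in (Domain R) q \<and> g = p * q"
    and p': "coeffs_rel R p p'" "poly p' y = 0"
  shows "\<exists>R'. hom_graph R' \<and> R \<subseteq> R' \<and> (x, y) \<in> R'"
proof -
  define R' where "R' = {(poly g x, poly g' y) | g g'. coeffs_rel R g g'}"
  have R'I: "(poly g x, poly g' y) \<in> R'" if "coeffs_rel R g g'" for g g'
    using that by (auto simp: R'_def)
  have in_dom: "coeffs_in (Domain R) g" if "coeffs_rel R g g'" for g g'
    using that by (auto simp: coeffs_rel_def coeffs_in_def)
  have "R \<subseteq> R'"
  proof
    fix z assume "z \<in> R"
    then obtain a a' where z: "z = (a, a')" "(a, a') \<in> R" by (cases z) auto
    show "z \<in> R'" using R'I[OF coeffs_rel_pCons[OF z(2) coeffs_rel_0]] z(1) by simp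
  qed
  moreover have "(x, y) \<in> R'"
    using R'I[OF coeffs_rel_pCons[OF hom_graph_rat coeffs_rel_pCons[OF hom_graph_rat coeffs_rel_0]], of 0 1] by simp
  moreover have "hom_graph R'"
    unfolding hom_graph_def
  proof (intro conjI ballI allI impI)
    fix q :: complex assume "q \<in> \<rat>"
    thus "(q, q) \<in> R'" using hom_graph_rat \<open>R \<subseteq> R'\<close> by blast
  next
    fix a a' b b' assume "(a, a') \<in> R'" "(b, b') \<in> R'"
    then obtain g g' h h' where g: "a = poly g x" "a' = poly g' y" "coeffs_rel R g g'"
        "b = poly h x" "b' = poly h' y" "coeffs_rel R h h'"
      by (auto simp: R'_def)
    show "(a + b, a' + b') \<in> R'" using R'I[OF coeffs_rel_add[OF g(3,6)]] g by simp
    show "(a * b, a' * b') \<in> R'" using R'I[OF coeffs_rel_mult[OF g(3,6)]] g by simp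
  next
    fix a a' assume "(a, a') \<in> R'"
    then obtain g g' where g: "a = poly g x" "coeffs_rel R g g'" by (auto simp: R'_def)
    thus "algebraic a" unfolding g(1)
      by (auto simp: coeffs_rel_def poly_altdef intro!: algebraic_sum algebraic_mult algebraic_power x
          dest: hom_graph_algebraic)
  next
    fix a a' a'' assume "(a, a') \<in> R'" "(a, a'') \<in> R'"
    obtain g g' where g1: "a = poly g x" "a' = poly g' y" "coeffs_rel R g g'"
      using \<open>(a, a') \<in> R'\<close> by (auto simp: R'_def)
    obtain h h' where g2: "a = poly h x" "a'' = poly h' y" "coeffs_rel R h h'"
      using \<open>(a, a'') \<in> R'\<close> by (auto simp: R'_def)
    note g = g1 g2
    have rel: "coeffs_rel R (g + - h) (g' + - h')"
      by (intro coeffs_rel_add coeffs_rel_uminus g)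
    have "poly (g + - h) x = 0" using g by simp
    then obtain q where q: "coeffs_in (Domain R) q" "g + - h = p * q"
      using p(2)[OF in_dom[OF rel]] by blast
    obtain q' where "coeffs_rel R q q'" using coeffs_rel_exists[OF q(1)] by blast
    hence "coeffs_rel R (g + - h) (p' * q')" unfolding q(2) by (rule coeffs_rel_mult[OF p'(1)])
    hence "g' + - h' = p' * q'" using coeffs_rel_unique[OF rel] by blast
    hence "poly (g' + - h') y = 0" using p'(2) by simp
    thus "a' = a''" using g by simp
  qed
  ultimately show ?thesis by blast
qed

text \<open>The complex numbers contain a root of the conjugate of the minimal polynomial of
  \<open>x\<close>. That conjugate is not constant, since its coefficient in the degree of
  \<open>p\<close> is the image of 1.\<close>

lemma hom_graph_extend_root:
  assumes x: "algebraic x"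
  shows "\<exists>R' y. hom_graph R' \<and> R \<subseteq> R' \<and> (x, y) \<in> R'"
proof -
  obtain p where p: "coeffs_in (Domain R) p" "lead_coeff p = 1" "poly p x = 0"
    "\<And>g. coeffs_in (Domain R) g \<Longrightarrow> poly g x = 0 \<Longrightarrow> \<exists>q. coeffs_in (Domain R) q \<and> g = p * q"
    using min_poly_exists[OF subfield_Domain x] by blast
  obtain p' where p': "coeffs_rel R p p'" using coeffs_rel_exists[OF p(1)] by blast
  have "(1, coeff p' (degree p)) \<in> R" using p' p(2) unfolding coeffs_rel_def by metis
  hence "coeff p' (degree p) = 1" using hom_graph_unique[OF _ hom_graph_rat[of 1]] by auto
  hence "degree p' \<ge> degree p" by (intro le_degree) auto
  moreover have "degree p > 0"
  proof (rule ccontr)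
    assume "\<not> degree p > 0"
    then obtain a where "p = [:a:]" by (metis degree_eq_zeroE neq0_conv)
    thus False using p by simp
  qed
  ultimately obtain y where "poly p' y = 0" using alg_closed_imp_poly_has_root[of p'] by auto
  thus ?thesis using hom_graph_extend[OF x p(1,4) p'] by blast
qed

end

text \<open>The absolute Galois group of the rationals, but made of total functions: outside the
  algebraic numbers the values are arbitrary, so elements can be compared on algebraic numbers only.
  Bijectivity there is a consequence, not part of the definition.\<close>

definition galois :: "(complex \<Rightarrow> complex) set" where
  "galois = {\<sigma>. (\<forall>q\<in>\<rat>. \<sigma> q = q) \<and>
     (\<forall>x y. algebraic x \<longrightarrow> algebraic y \<longrightarrow> \<sigma> (x + y) = \<sigma> x + \<sigma> y \<and> \<sigma> (x * y) = \<sigma> x * \<sigma> y)}"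

text \<open>Zorn's lemma yields a maximal graph above \<open>R\<close>. Its domain contains every
  algebraic number, as it could be extended otherwise; read as a function, it is the
  automorphism.\<close>

lemma hom_graph_galois:
  assumes "hom_graph R"
  obtains \<sigma> where "\<sigma> \<in> galois" "\<And>a a'. (a, a') \<in> R \<Longrightarrow> \<sigma> a = a'"
proof -
  define \<A> where "\<A> = {R'. hom_graph R' \<and> R \<subseteq> R'}"
  have "\<exists>M\<in>\<A>. \<forall>X\<in>\<A>. M \<subseteq> X \<longrightarrow> X = M"
  proof (rule subset_Zorn_nonempty)
    show "\<A> \<noteq> {}" using assms by (auto simp: \<A>_def)
    fix \<C> assume ne: "\<C> \<noteq> {}" and ch: "subset.chain \<A> \<C>"
    have two: "\<exists>X\<in>\<C>. u \<in> X \<and> v \<in> X" if "u \<in> \<Union>\<C>" "v \<in> \<Union>\<C>" for u v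
      using that ch unfolding subset_chain_def by blast
    have hg: "hom_graph X" "R \<subseteq> X" if "X \<in> \<C>" for X
      using that ch unfolding subset_chain_def \<A>_def by auto
    have "R \<subseteq> \<Union>\<C>" using ne hg(2) by auto
    moreover have "hom_graph (\<Union>\<C>)"
      unfolding hom_graph_def
    proof (intro conjI ballI allI impI)
      fix q :: complex assume "q \<in> \<rat>"
      thus "(q, q) \<in> \<Union>\<C>" using ne hg(1) hom_graph_rat by blast
    next
      fix a a' b b' assume ab: "(a, a') \<in> \<Union>\<C>" "(b, b') \<in> \<Union>\<C>"
      then obtain X where X: "X \<in> \<C>" "(a, a') \<in> X" "(b, b') \<in> X" using two by blast
      show "(a + b, a' + b') \<in> \<Union>\<C>" "(a * b, a' * b') \<in> \<Union>\<C>"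
        using X hom_graph_add[OF hg(1)[OF X(1)] X(2,3)] hom_graph_mult[OF hg(1)[OF X(1)] X(2,3)] by auto
    next
      fix a a' assume "(a, a') \<in> \<Union>\<C>"
      thus "algebraic a" using hg(1) hom_graph_algebraic by blast
    next
      fix a a' a'' assume ab: "(a, a') \<in> \<Union>\<C>" "(a, a'') \<in> \<Union>\<C>"
      then obtain X where X: "X \<in> \<C>" "(a, a') \<in> X" "(a, a'') \<in> X" using two by blast
      thus "a' = a''" using hom_graph_unique[OF hg(1)[OF X(1)]] by blast
    qed
    ultimately show "\<Union>\<C> \<in> \<A>" by (simp add: \<A>_def)
  qed
  then obtain M where M: "M \<in> \<A>" and max: "\<And>X. X \<in> \<A> \<Longrightarrow> M \<subseteq> X \<Longrightarrow> X = M" by blast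
  have hM: "hom_graph M" "R \<subseteq> M" using M by (auto simp: \<A>_def)
  define \<sigma> where "\<sigma> x = (THE y. (x, y) \<in> M)" for x
  have \<sigma>: "\<sigma> x = y" if "(x, y) \<in> M" for x y
    unfolding \<sigma>_def using that hom_graph_unique[OF hM(1)] by blast
  have total: "(x, \<sigma> x) \<in> M" if alg: "algebraic x" for x
  proof -
    obtain R' y where R': "hom_graph R'" "M \<subseteq> R'" "(x, y) \<in> R'"
      using hom_graph_extend_root[OF hM(1) alg] by blast
    hence "R' = M" using hM(2) by (intro max) (auto simp: \<A>_def)
    hence "(x, y) \<in> M" using R'(3) by simp
    thus ?thesis using \<sigma>[of x y] by simp
  qed
  show thesis
  proof (rule that[of \<sigma>])
    show "\<sigma> \<in> galois" unfolding galois_def mem_Collect_eq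
    proof (intro conjI ballI allI impI)
      fix q :: complex assume "q \<in> \<rat>"
      thus "\<sigma> q = q" by (intro \<sigma> hom_graph_rat[OF hM(1)])
    next
      fix x y :: complex assume "algebraic x" "algebraic y"
      note xy = total[OF this(1)] total[OF this(2)]
      show "\<sigma> (x + y) = \<sigma> x + \<sigma> y" by (rule \<sigma>[OF hom_graph_add[OF hM(1) xy]])
      show "\<sigma> (x * y) = \<sigma> x * \<sigma> y" by (rule \<sigma>[OF hom_graph_mult[OF hM(1) xy]])
    qed
    fix a a' assume "(a, a') \<in> R"
    thus "\<sigma> a = a'" using \<sigma> hM(2) by auto
  qed
qed

subsection \<open>The absolute Galois group of the rationals\<close>

context
  fixes \<sigma> assumes \<sigma>: "\<sigma> \<in> galois"
begin

lemma galois_rat: "q \<in> \<rat> \<Longrightarrow> \<sigma> q = q"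
  and galois_add: "algebraic x \<Longrightarrow> algebraic y \<Longrightarrow> \<sigma> (x + y) = \<sigma> x + \<sigma> y"
  and galois_mult: "algebraic x \<Longrightarrow> algebraic y \<Longrightarrow> \<sigma> (x * y) = \<sigma> x * \<sigma> y"
  using \<sigma> by (auto simp: galois_def)

lemma galois_0 [simp]: "\<sigma> 0 = 0" and galois_1 [simp]: "\<sigma> 1 = 1"
  and galois_of_int [simp]: "\<sigma> (of_int k) = of_int k" and galois_of_nat [simp]: "\<sigma> (of_nat n) = of_nat n"
  by (auto intro: galois_rat)

lemma galois_uminus: "algebraic x \<Longrightarrow> \<sigma> (- x) = - \<sigma> x"
  using galois_mult[of "- 1" x] galois_rat[of "- 1"] by (auto simp: algebraic_rat)

lemma galois_diff: "algebraic x \<Longrightarrow> algebraic y \<Longrightarrow> \<sigma> (x - y) = \<sigma> x - \<sigma> y"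
  using galois_add[of x "- y"] galois_uminus[of y] by auto

lemma galois_sum: "(\<And>i. i \<in> I \<Longrightarrow> algebraic (g i)) \<Longrightarrow> \<sigma> (sum g I) = (\<Sum>i\<in>I. \<sigma> (g i))"
  by (induction I rule: infinite_finite_induct) (auto simp: galois_add algebraic_sum)

lemma galois_prod: "(\<And>i. i \<in> I \<Longrightarrow> algebraic (g i)) \<Longrightarrow> \<sigma> (prod g I) = (\<Prod>i\<in>I. \<sigma> (g i))"
  by (induction I rule: infinite_finite_induct) (auto simp: galois_mult algebraic_prod)

lemma galois_power: "algebraic x \<Longrightarrow> \<sigma> (x ^ n) = \<sigma> x ^ n"
  by (induction n) (auto simp: galois_mult algebraic_power)

lemma galois_inverse:
  assumes "algebraic x"
  shows "\<sigma> (inverse x) = inverse (\<sigma> x)"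
proof (cases "x = 0")
  case False
  have "algebraic (inverse x)" using subfield_inverse[OF subfield_algebraic, of x] assms by simp
  hence "\<sigma> x * \<sigma> (inverse x) = 1" using galois_mult[OF assms, of "inverse x"] False by simp
  thus ?thesis by (simp add: inverse_unique)
qed auto

lemma galois_poly:
  assumes "algebraic x"
  shows "\<sigma> (poly (map_poly of_int p) x) = poly (map_poly of_int p) (\<sigma> x)"
  unfolding poly_altdef using assms
  by (subst galois_sum) (auto simp: galois_mult galois_power algebraic_power algebraic_rat)

lemma galois_algebraic: "algebraic x \<Longrightarrow> algebraic (\<sigma> x)"
proof -
  assume x: "algebraic x"
  then obtain p where p: "p \<noteq> 0" "poly (map_poly of_int p) x = 0" by (erule algebraicE')
  have "poly (map_poly of_int p) (\<sigma> x) = 0" using galois_poly[OF x, of p] p by simp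
  thus ?thesis by (intro algebraicI[of "map_poly of_int p"]) (use p in \<open>auto simp: coeff_map_poly\<close>)
qed

lemma galois_algebraic_int: "algebraic_int x \<Longrightarrow> algebraic_int (\<sigma> x)"
proof -
  assume x: "algebraic_int x"
  then obtain p where p: "poly (map_poly of_int p) x = 0" "lead_coeff p = 1"
    using algebraic_int_altdef_ipoly by blast
  have "poly (map_poly of_int p) (\<sigma> x) = 0" using galois_poly[of x p] p x by auto
  thus ?thesis using p algebraic_int_altdef_ipoly by blast
qed

lemma galois_inj: "algebraic x \<Longrightarrow> algebraic y \<Longrightarrow> \<sigma> x = \<sigma> y \<Longrightarrow> x = y"
proof (rule ccontr)
  assume xy: "algebraic x" "algebraic y" "\<sigma> x = \<sigma> y" "x \<noteq> y"
  have alg: "algebraic (x - y)" "algebraic (inverse (x - y))"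
    using xy subfield_inverse[OF subfield_algebraic, of "x - y"] by auto
  have "\<sigma> ((x - y) * inverse (x - y)) = 0"
    unfolding galois_mult[OF alg] using galois_diff xy by simp
  thus False using xy(4) by simp
qed

text \<open>An automorphism maps the finite set of roots of an integer polynomial injectively into
  itself, hence onto itself.\<close>

lemma galois_surj:
  assumes y: "algebraic y"
  shows "\<exists>x. algebraic x \<and> \<sigma> x = y"
proof -
  from y obtain p where p: "p \<noteq> 0" "poly (map_poly of_int p) y = 0" by (erule algebraicE')
  define Z where "Z = {z :: complex. poly (map_poly of_int p) z = 0}"
  have fin: "finite Z" unfolding Z_def using p(1) by (intro poly_roots_finite) auto
  have alg: "algebraic z" if "z \<in> Z" for z
    using that p(1) by (intro algebraicI[of "map_poly of_int p"]) (auto simp: Z_def coeff_map_poly)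
  have "\<sigma> ` Z \<subseteq> Z" using galois_poly[OF alg, of _ p] by (auto simp: Z_def)
  moreover have "inj_on \<sigma> Z" by (auto intro!: inj_onI galois_inj alg)
  ultimately have "\<sigma> ` Z = Z" using fin by (simp add: endo_inj_surj)
  moreover have "y \<in> Z" using p by (simp add: Z_def)
  ultimately show ?thesis using alg by (metis imageE)
qed

lemma galois_det:
  assumes "\<And>i j. i < m \<Longrightarrow> j < m \<Longrightarrow> algebraic (g i j)"
  shows "\<sigma> (det (mat m m (\<lambda>(i,j). g i j))) = det (mat m m (\<lambda>(i,j). \<sigma> (g i j)))"
proof -
  have less: "p i < m" if "p permutes {0..<m}" "i < m" for p i
    using permutes_in_image[OF that(1), of i] that(2) by simp
  have eq: "det (mat m m (\<lambda>(i,j). h i j))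
      = (\<Sum>p | p permutes {0..<m}. signof p * (\<Prod>i = 0..<m. h i (p i)))" for h :: "nat \<Rightarrow> nat \<Rightarrow> complex"
    by (subst det_def'[of _ m]) (auto intro!: sum.cong prod.cong simp: less)
  have "\<sigma> (signof p * (\<Prod>i = 0..<m. g i (p i))) = signof p * (\<Prod>i = 0..<m. \<sigma> (g i (p i)))"
    and "algebraic (signof p * (\<Prod>i = 0..<m. g i (p i)))" if p: "p permutes {0..<m}" for p
  proof -
    have alg: "algebraic (g i (p i))" if "i \<in> {0..<m}" for i
      using assms less[OF p] that by simp
    have P: "algebraic (\<Prod>i = 0..<m. g i (p i))" by (intro algebraic_prod alg)
    show "\<sigma> (signof p * (\<Prod>i = 0..<m. g i (p i))) = signof p * (\<Prod>i = 0..<m. \<sigma> (g i (p i)))"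
      using galois_uminus[OF P] galois_prod[of "{0..<m}" "\<lambda>i. g i (p i)"] alg
      by (cases p rule: sign_cases) auto
    show "algebraic (signof p * (\<Prod>i = 0..<m. g i (p i)))"
      using P by (cases p rule: sign_cases) auto
  qed
  note terms = this
  have "\<sigma> (\<Sum>p | p permutes {0..<m}. signof p * (\<Prod>i = 0..<m. g i (p i)))
      = (\<Sum>p | p permutes {0..<m}. \<sigma> (signof p * (\<Prod>i = 0..<m. g i (p i))))"
    by (rule galois_sum, rule terms(2)) simp
  also have "\<dots> = (\<Sum>p | p permutes {0..<m}. signof p * (\<Prod>i = 0..<m. \<sigma> (g i (p i))))"
    by (rule sum.cong[OF refl], rule terms(1)) simp
  finally show ?thesis unfolding eq .
qed

end

lemma galois_id: "(\<lambda>x. x) \<in> galois"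
  by (auto simp: galois_def)

lemma galois_comp: "\<sigma> \<in> galois \<Longrightarrow> \<tau> \<in> galois \<Longrightarrow> (\<lambda>x. \<sigma> (\<tau> x)) \<in> galois"
  \<comment> \<open>The definition is unfolded for the composite only, so that the two hypotheses
    keep the form expected by the rules.\<close>
  unfolding galois_def[THEN arg_cong, of "\<lambda>A. (\<lambda>x. \<sigma> (\<tau> x)) \<in> A"]
  by (auto simp: galois_rat galois_add galois_mult galois_algebraic)

lemma galois_cnj: "cnj \<in> galois"
proof -
  have "cnj q = q" if "q \<in> \<rat>" for q using that by (auto elim!: Rats_cases')
  thus ?thesis by (auto simp: galois_def)
qed

lemma galois_inv:
  assumes \<sigma>: "\<sigma> \<in> galois"
  obtains \<tau> where "\<tau> \<in> galois" "\<And>x. algebraic x \<Longrightarrow> \<tau> (\<sigma> x) = x" "\<And>x. algebraic x \<Longrightarrow> \<sigma> (\<tau> x) = x"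
proof -
  obtain \<tau> where \<tau>: "\<And>y. algebraic y \<Longrightarrow> algebraic (\<tau> y) \<and> \<sigma> (\<tau> y) = y"
    using galois_surj[OF \<sigma>] by metis
  have inv: "\<tau> (\<sigma> x) = x" if "algebraic x" for x
    using that \<tau>[OF galois_algebraic[OF \<sigma> that]] galois_inj[OF \<sigma>] by blast
  have "\<tau> \<in> galois" unfolding galois_def mem_Collect_eq
  proof (intro conjI ballI allI impI)
    fix q :: complex assume "q \<in> \<rat>"
    thus "\<tau> q = q" using inv[of q] galois_rat[OF \<sigma>] algebraic_rat by metis
  next
    fix x y :: complex assume a: "algebraic x" "algebraic y"
    show "\<tau> (x + y) = \<tau> x + \<tau> y"
      using galois_add[OF \<sigma>, of "\<tau> x" "\<tau> y"] \<tau>[OF a(1)] \<tau>[OF a(2)] inv[of "\<tau> x + \<tau> y"] by auto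
    show "\<tau> (x * y) = \<tau> x * \<tau> y"
      using galois_mult[OF \<sigma>, of "\<tau> x" "\<tau> y"] \<tau>[OF a(1)] \<tau>[OF a(2)] inv[of "\<tau> x * \<tau> y"] by auto
  qed
  thus thesis using that inv \<tau> by blast
qed

text \<open>If the minimal polynomial of \<^term>\<open>x\<close> over \<^term>\<open>E\<close> is not linear, separability provides a
  second root, to which \<^term>\<open>x\<close> can be moved.\<close>

lemma in_subfield_if_galois_fixed:
  assumes E: "is_subfield E" "\<And>e. e \<in> E \<Longrightarrow> algebraic e" and x: "algebraic x"
    and fixed: "\<And>\<sigma>. \<sigma> \<in> galois \<Longrightarrow> (\<And>e. e \<in> E \<Longrightarrow> \<sigma> e = e) \<Longrightarrow> \<sigma> x = x"
  shows "x \<in> E"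
proof -
  define R where "R = (\<lambda>e. (e, e)) ` E"
  have R: "hom_graph R" unfolding hom_graph_def R_def
    using E Rats_subset_subfield[OF E(1)] by (auto intro: subfield_add subfield_mult)
  have dom: "Domain R = E" by (auto simp: R_def)
  obtain p where p: "coeffs_in E p" "lead_coeff p = 1" "poly p x = 0"
    "\<And>g. coeffs_in E g \<Longrightarrow> poly g x = 0 \<Longrightarrow> \<exists>q. coeffs_in E q \<and> g = p * q"
    using min_poly_exists[OF E(1) x] by blast
  have rel: "coeffs_rel R p p" using p(1) by (auto simp: coeffs_rel_def coeffs_in_def R_def)
  have "p \<noteq> 0" using p(2) by auto
  obtain r where r: "p = [:- x, 1:] * r" using p(3) by (auto simp: poly_eq_0_iff_dvd elim: dvdE)
  \<comment> \<open>Separability: a double root \<open>x\<close> would be a root of the derivative,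
    which \<open>p\<close> would then divide in spite of its smaller degree.\<close>
  have rx: "poly r x \<noteq> 0"
  proof
    assume "poly r x = 0"
    moreover have "pderiv p = [:- x, 1:] * pderiv r + r * pderiv [:- x, 1:]"
      unfolding r by (rule pderiv_mult)
    ultimately have "poly (pderiv p) x = 0" by (simp del: mult_pCons_left)
    then obtain q where q: "pderiv p = p * q" using p(4)[OF coeffs_in_pderiv[OF E(1) p(1)]] by blast
    have "degree p > 0"
    proof (rule ccontr)
      assume "\<not> degree p > 0"
      then obtain a where "p = [:a:]" by (metis degree_eq_zeroE neq0_conv)
      thus False using p by simp
    qed
    hence "pderiv p \<noteq> 0" by (simp add: pderiv_eq_0_iff)
    hence "degree p \<le> degree (pderiv p)" using q by (intro dvd_imp_degree_le) auto
    thus False using \<open>degree p > 0\<close> by (simp add: degree_pderiv)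
  qed
  have "degree r = 0"
  proof (rule ccontr)
    assume "degree r \<noteq> 0"
    then obtain y where y: "poly r y = 0" using alg_closed_imp_poly_has_root[of r] by auto
    have "poly p y = 0" using y by (simp add: r)
    then obtain R' where R': "hom_graph R'" "R \<subseteq> R'" "(x, y) \<in> R'"
      using hom_graph_extend[OF R x _ _ rel, unfolded dom, OF p(1,4)] by blast
    obtain \<sigma> where \<sigma>: "\<sigma> \<in> galois" "\<And>a a'. (a, a') \<in> R' \<Longrightarrow> \<sigma> a = a'"
      using hom_graph_galois[OF R'(1)] by blast
    have "\<sigma> e = e" if "e \<in> E" for e using that R'(2) by (intro \<sigma>(2)) (auto simp: R_def)
    hence "\<sigma> x = x" by (rule fixed[OF \<sigma>(1)])
    hence "y = x" using \<sigma>(2)[OF R'(3)] by simp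
    thus False using y rx by simp
  qed
  then obtain a where "r = [:a:]" by (rule degree_eq_zeroE)
  hence "p = [:- (x * a), a:]" by (simp add: r)
  moreover have "a \<noteq> 0" using \<open>p \<noteq> 0\<close> calculation by auto
  ultimately have "p = [:- x, 1:]" using p(2) by simp
  hence "- x \<in> E" using p(1) by (auto simp: coeffs_in_def coeff_pCons split: nat.splits dest: spec[of _ 0])
  thus ?thesis using subfield_uminus[OF E(1), of "- x"] by simp
qed

lemma rational_if_galois_fixed:
  assumes "algebraic x" "\<And>\<sigma>. \<sigma> \<in> galois \<Longrightarrow> \<sigma> x = x"
  shows "x \<in> \<rat>"
  by (rule in_subfield_if_galois_fixed[OF subfield_Rats algebraic_rat]) (use assms in auto)

lemma int_if_galois_fixed:
  assumes "algebraic_int x" "\<And>\<sigma>. \<sigma> \<in> galois \<Longrightarrow> \<sigma> x = x"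
  shows "x \<in> \<int>"
  using rational_algebraic_int_is_int rational_if_galois_fixed assms by blast

lemma galois_eq_on_gen_field:
  assumes \<sigma>: "\<sigma> \<in> galois" "\<tau> \<in> galois" and S: "\<And>s. s \<in> S \<Longrightarrow> algebraic s \<and> \<sigma> s = \<tau> s"
    and x: "x \<in> gen_field S"
  shows "\<sigma> x = \<tau> x"
proof -
  have "is_subfield {x. algebraic x \<and> \<sigma> x = \<tau> x}"
    using \<sigma> subfield_algebraic
    by (auto simp: is_subfield_def galois_add galois_mult galois_uminus galois_inverse)
  from gen_field_minimal[OF this, of S] S x show ?thesis by auto
qed

section \<open>Embeddings and separating families\<close>

text \<open>Every embedding of \<open>K\<close> extends to an automorphism, so restrictions give all
  of them. \<open>restrict\<close> fixes the values outside \<open>K\<close>, so that automorphisms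
  which agree on \<open>K\<close> count once.\<close>

definition embeddings :: "complex set \<Rightarrow> (complex \<Rightarrow> complex) set" where
  "embeddings K = (\<lambda>\<sigma>. restrict \<sigma> K) ` galois"

lemma embedding_galois:
  assumes "u \<in> embeddings K"
  obtains \<sigma> where "\<sigma> \<in> galois" "\<And>x. x \<in> K \<Longrightarrow> u x = \<sigma> x" "u = restrict \<sigma> K"
  using assms by (auto simp: embeddings_def)

lemma finite_embeddings_subset:
  assumes "E \<subseteq> K" "finite (embeddings K)"
  shows "finite (embeddings E)"
proof -
  have "restrict \<sigma> E = restrict (restrict \<sigma> K) E" for \<sigma> :: "complex \<Rightarrow> complex"
    using assms(1) by (auto simp: restrict_def fun_eq_iff)
  hence "embeddings E \<subseteq> (\<lambda>u. restrict u E) ` embeddings K"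
    by (auto simp: embeddings_def image_iff)
  thus ?thesis using assms(2) finite_surj by blast
qed

text \<open>An embedding is determined by its values on the generators, and these are roots of
  finitely many integer polynomials.\<close>

lemma finite_embeddings_gen_field:
  assumes fin: "finite S" and alg: "\<And>s. s \<in> S \<Longrightarrow> algebraic s"
  shows "finite (embeddings (gen_field S))"
proof -
  have "\<forall>s\<in>S. \<exists>p. p \<noteq> 0 \<and> poly (map_poly of_int p) s = 0"
    using alg by (metis algebraicE')
  then obtain p where p: "\<And>s. s \<in> S \<Longrightarrow> p s \<noteq> 0 \<and> poly (map_poly of_int (p s)) s = 0" by metis
  define Z where "Z s = {z :: complex. poly (map_poly of_int (p s)) z = 0}" for s
  have "finite (Z s)" if "s \<in> S" for s
    unfolding Z_def using p[OF that] by (intro poly_roots_finite) auto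
  hence finZ: "finite (PiE S Z)" using fin by (intro finite_PiE) auto
  have "(\<lambda>u. restrict u S) ` embeddings (gen_field S) \<subseteq> PiE S Z"
  proof (intro image_subsetI)
    fix u assume "u \<in> embeddings (gen_field S)"
    then obtain \<sigma> where \<sigma>: "\<sigma> \<in> galois" "\<And>x. x \<in> gen_field S \<Longrightarrow> u x = \<sigma> x"
      using embedding_galois by blast
    have "u s \<in> Z s" if "s \<in> S" for s
      using that \<sigma>(2)[of s] gen_field_superset[of S] galois_poly[OF \<sigma>(1) alg[OF that], of "p s"]
        p[OF that] \<sigma>(1) by (auto simp: Z_def)
    thus "restrict u S \<in> PiE S Z" by auto
  qed
  moreover have "inj_on (\<lambda>u. restrict u S) (embeddings (gen_field S))"
  proof (rule inj_onI)
    fix u v assume u: "u \<in> embeddings (gen_field S)" and v: "v \<in> embeddings (gen_field S)"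
      and eq: "restrict u S = restrict v S"
    obtain \<sigma> where \<sigma>: "\<sigma> \<in> galois" "\<And>x. x \<in> gen_field S \<Longrightarrow> u x = \<sigma> x" "u = restrict \<sigma> (gen_field S)"
      using embedding_galois[OF u] by blast
    obtain \<tau> where \<tau>: "\<tau> \<in> galois" "\<And>x. x \<in> gen_field S \<Longrightarrow> v x = \<tau> x" "v = restrict \<tau> (gen_field S)"
      using embedding_galois[OF v] by blast
    have "\<sigma> s = \<tau> s" if "s \<in> S" for s
      using that fun_cong[OF eq, of s] gen_field_superset[of S] \<sigma>(2)[of s] \<tau>(2)[of s] by auto
    hence "\<sigma> x = \<tau> x" if "x \<in> gen_field S" for x
      using galois_eq_on_gen_field[OF \<sigma>(1) \<tau>(1) _ that] alg by blast
    thus "u = v" unfolding \<sigma>(3) \<tau>(3) by (auto simp: restrict_def fun_eq_iff)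
  qed
  ultimately show ?thesis using finZ by (metis finite_imageD finite_subset)
qed

text \<open>A number field: finiteness of the degree is expressed by finiteness of the set of
  embeddings, a property that passes to subfields by restriction.\<close>

locale alg_field =
  fixes K :: "complex set"
  assumes subfield: "is_subfield K" and algebraic: "\<And>x. x \<in> K \<Longrightarrow> algebraic x"
    and finite_emb: "finite (embeddings K)"
begin

definition act :: "(complex \<Rightarrow> complex) \<Rightarrow> (complex \<Rightarrow> complex) \<Rightarrow> complex \<Rightarrow> complex" where
  "act \<sigma> u = (\<lambda>x\<in>K. \<sigma> (u x))"

lemma act_embedding:
  assumes "\<sigma> \<in> galois" "u \<in> embeddings K"
  shows "act \<sigma> u \<in> embeddings K"
proof -
  obtain \<tau> where \<tau>: "\<tau> \<in> galois" "u = restrict \<tau> K" using embedding_galois[OF assms(2)] by blast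
  have "act \<sigma> u = restrict (\<lambda>x. \<sigma> (\<tau> x)) K" by (auto simp: act_def \<tau>(2))
  thus ?thesis using galois_comp[OF assms(1) \<tau>(1)] by (auto simp: embeddings_def)
qed

lemma embedding_algebraic: "u \<in> embeddings K \<Longrightarrow> x \<in> K \<Longrightarrow> algebraic (u x)"
  by (metis embedding_galois galois_algebraic algebraic)

lemma embedding_algebraic_int: "u \<in> embeddings K \<Longrightarrow> x \<in> K \<Longrightarrow> algebraic_int x \<Longrightarrow> algebraic_int (u x)"
  by (metis embedding_galois galois_algebraic_int)

lemma embedding_ext:
  assumes "u \<in> embeddings K" "v \<in> embeddings K" "\<And>x. x \<in> K \<Longrightarrow> u x = v x"
  shows "u = v"
proof -
  have "u \<in> extensional K" "v \<in> extensional K" using assms by (auto simp: embeddings_def)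
  thus ?thesis using assms(3) by (rule extensionalityI)
qed

lemma act_bij:
  assumes \<sigma>: "\<sigma> \<in> galois" and U: "U \<subseteq> embeddings K" "\<And>u. u \<in> U \<Longrightarrow> act \<sigma> u \<in> U"
  shows "bij_betw (act \<sigma>) U U"
proof -
  have "inj_on (act \<sigma>) U"
  proof (rule inj_onI)
    fix u v assume uv: "u \<in> U" "v \<in> U" "act \<sigma> u = act \<sigma> v"
    show "u = v"
    proof (rule embedding_ext)
      fix x assume x: "x \<in> K"
      have "\<sigma> (u x) = \<sigma> (v x)" using fun_cong[OF uv(3), of x] x by (simp add: act_def)
      thus "u x = v x" using galois_inj[OF \<sigma>] embedding_algebraic uv U x by blast
    qed (use uv U in auto)
  qed
  moreover have "act \<sigma> ` U \<subseteq> U" using U(2) by auto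
  moreover have "finite U" using U(1) finite_emb finite_subset by blast
  ultimately show ?thesis by (simp add: bij_betw_def endo_inj_surj)
qed

text \<open>An automorphism permutes the embeddings in a stable set \<open>U\<close>. Besides the
  full trace this covers the relative trace to a subfield, where \<open>U\<close> consists of the
  embeddings that fix it.\<close>

lemma galois_sum_embeddings:
  assumes "\<sigma> \<in> galois" "U \<subseteq> embeddings K" "\<And>u. u \<in> U \<Longrightarrow> act \<sigma> u \<in> U" "x \<in> K"
  shows "\<sigma> (\<Sum>u\<in>U. u x) = (\<Sum>u\<in>U. u x)"
proof -
  have "\<sigma> (\<Sum>u\<in>U. u x) = (\<Sum>u\<in>U. \<sigma> (u x))"
    using assms(2) by (intro galois_sum[OF assms(1)] embedding_algebraic[OF _ assms(4)]) auto
  also have "\<dots> = (\<Sum>u\<in>U. act \<sigma> u x)" using assms(4) by (simp add: act_def)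
  also have "\<dots> = (\<Sum>u\<in>U. u x)"
    by (rule sum.reindex_bij_betw[OF act_bij[OF assms(1-3)], of "\<lambda>u. u x"])
  finally show ?thesis .
qed

lemma galois_prod_embeddings:
  assumes "\<sigma> \<in> galois" "x \<in> K"
  shows "\<sigma> (\<Prod>u\<in>embeddings K. u x) = (\<Prod>u\<in>embeddings K. u x)"
proof -
  have "\<sigma> (\<Prod>u\<in>embeddings K. u x) = (\<Prod>u\<in>embeddings K. \<sigma> (u x))"
    by (intro galois_prod[OF assms(1)] embedding_algebraic[OF _ assms(2)])
  also have "\<dots> = (\<Prod>u\<in>embeddings K. act \<sigma> u x)" using assms(2) by (simp add: act_def)
  also have "\<dots> = (\<Prod>u\<in>embeddings K. u x)"
    by (rule prod.reindex_bij_betw[OF act_bij[OF assms(1) subset_refl], of "\<lambda>u. u x"])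
      (rule act_embedding[OF assms(1)])
  finally show ?thesis .
qed

lemma trace_int:
  assumes "x \<in> K" "algebraic_int x"
  shows "(\<Sum>u\<in>embeddings K. u x) \<in> \<int>"
proof (rule int_if_galois_fixed)
  show "algebraic_int (\<Sum>u\<in>embeddings K. u x)"
    by (intro algebraic_int_sum embedding_algebraic_int[OF _ assms])
qed (rule galois_sum_embeddings[OF _ subset_refl act_embedding assms(1)])

lemma norm_int:
  assumes "x \<in> K" "algebraic_int x"
  shows "(\<Prod>u\<in>embeddings K. u x) \<in> \<int>"
proof (rule int_if_galois_fixed)
  show "algebraic_int (\<Prod>u\<in>embeddings K. u x)"
    by (intro algebraic_int_prod embedding_algebraic_int[OF _ assms])
qed (rule galois_prod_embeddings[OF _ assms(1)])

end

lemma alg_field_gen_field: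
  assumes "finite S" "\<And>s. s \<in> S \<Longrightarrow> algebraic s"
  shows "alg_field (gen_field S)"
  by (rule alg_field.intro)
    (use assms in \<open>auto intro: subfield_gen_field gen_field_algebraic finite_embeddings_gen_field\<close>)

lemma alg_field_subset: "alg_field K \<Longrightarrow> is_subfield E \<Longrightarrow> E \<subseteq> K \<Longrightarrow> alg_field E"
  unfolding alg_field_def using finite_embeddings_subset by blast

text \<open>An integral separability idempotent of the field \<^term>\<open>K\<close>, up to the factor \<^term>\<open>d\<close>: the
  discriminant of a family of integral generators of \<^term>\<open>K\<close> is such a factor, and \<^term>\<open>d = 1\<close> means
  that \<^term>\<open>K\<close> is unramified.\<close>

definition separating_list :: "complex set \<Rightarrow> int \<Rightarrow> (complex \<times> complex) list \<Rightarrow> bool" where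
  "separating_list K d ps \<longleftrightarrow>
     (\<forall>(y, w)\<in>set ps. algebraic_int y \<and> algebraic_int w \<and> w \<in> K) \<and>
     (\<forall>\<sigma>\<in>galois. (\<Sum>(y, w)\<leftarrow>ps. y * \<sigma> w) = (if \<forall>x\<in>K. \<sigma> x = x then of_int d else 0))"

definition separated :: "complex set \<Rightarrow> int \<Rightarrow> bool" where
  "separated K d \<longleftrightarrow> (\<exists>ps. separating_list K d ps)"

lemma separating_listD:
  assumes "separating_list K d ps"
  shows "\<And>y w. (y, w) \<in> set ps \<Longrightarrow> algebraic_int y \<and> algebraic_int w \<and> w \<in> K"
    "\<And>\<sigma>. \<sigma> \<in> galois \<Longrightarrow> (\<Sum>(y, w)\<leftarrow>ps. y * \<sigma> w) = (if \<forall>x\<in>K. \<sigma> x = x then of_int d else 0)"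
  using assms by (auto simp: separating_list_def)

lemma separatedI:
  assumes "\<And>y w. (y, w) \<in> set ps \<Longrightarrow> algebraic_int y \<and> algebraic_int w \<and> w \<in> K"
    "\<And>\<sigma>. \<sigma> \<in> galois \<Longrightarrow> (\<Sum>(y, w)\<leftarrow>ps. y * \<sigma> w) = (if \<forall>x\<in>K. \<sigma> x = x then of_int d else 0)"
  shows "separated K d"
  unfolding separated_def separating_list_def
  by (rule exI[of _ ps], intro conjI ballI assms(2)) (use assms(1) in auto)

lemma sum_list_product:
  fixes F G :: "_ \<Rightarrow> 'a :: semiring_0"
  shows "(\<Sum>(a, b)\<leftarrow>List.product xs ys. F a * G b) = (\<Sum>a\<leftarrow>xs. F a) * (\<Sum>b\<leftarrow>ys. G b)"
  by (induction xs) (auto simp: o_def distrib_right sum_list_const_mult)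

lemma separated_scale:
  assumes "separated K d"
  shows "separated K (c * d)"
proof -
  obtain ps where "separating_list K d ps" using assms unfolding separated_def by blast
  note ps = separating_listD[OF this]
  define qs where "qs = map (\<lambda>(y, w). (of_int c * y, w)) ps"
  have eq: "(\<Sum>(y, w)\<leftarrow>qs. y * \<sigma> w) = of_int c * (\<Sum>(y, w)\<leftarrow>ps. y * \<sigma> w)" for \<sigma> :: "complex \<Rightarrow> complex"
    unfolding qs_def by (induction ps) (auto simp: algebra_simps)
  show ?thesis
  proof (rule separatedI[of qs])
    fix y w assume "(y, w) \<in> set qs"
    then obtain y' where "(y', w) \<in> set ps" "y = of_int c * y'" by (auto simp: qs_def)
    thus "algebraic_int y \<and> algebraic_int w \<and> w \<in> K" using ps(1)[of y' w] by auto
  next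
    fix \<sigma> assume \<sigma>: "\<sigma> \<in> galois"
    show "(\<Sum>(y, w)\<leftarrow>qs. y * \<sigma> w) = (if \<forall>x\<in>K. \<sigma> x = x then of_int (c * d) else 0)"
      unfolding eq ps(2)[OF \<sigma>] by simp
  qed
qed

lemma separated_add:
  assumes "separated K d" "separated K e"
  shows "separated K (d + e)"
proof -
  obtain ps where "separating_list K d ps" using assms(1) unfolding separated_def by blast
  note ps = separating_listD[OF this]
  obtain qs where "separating_list K e qs" using assms(2) unfolding separated_def by blast
  note qs = separating_listD[OF this]
  show ?thesis
  proof (rule separatedI[of "ps @ qs"])
    fix y w assume "(y, w) \<in> set (ps @ qs)"
    thus "algebraic_int y \<and> algebraic_int w \<and> w \<in> K" using ps(1)[of y w] qs(1)[of y w] by auto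
  next
    fix \<sigma> assume \<sigma>: "\<sigma> \<in> galois"
    show "(\<Sum>(y, w)\<leftarrow>ps @ qs. y * \<sigma> w) = (if \<forall>x\<in>K. \<sigma> x = x then of_int (d + e) else 0)"
      unfolding map_append sum_list_append ps(2)[OF \<sigma>] qs(2)[OF \<sigma>] by simp
  qed
qed

text \<open>By \<open>separated_scale\<close> and \<open>separated_add\<close> the admissible
  factors form an ideal of the integers; Bezout's identity puts 1 into it.\<close>

lemma separated_coprime:
  assumes "separated K d" "separated K e" "coprime d e"
  shows "separated K 1"
proof -
  obtain a b where "a * d + b * e = 1" using assms(3) bezout_int[of d e] by (metis coprime_imp_gcd_eq_1)
  thus ?thesis using separated_add[OF separated_scale[OF assms(1), of a] separated_scale[OF assms(2), of b]] by simp
qed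

lemma separated_Rats: "separated \<rat> 1"
  by (rule separatedI[of "[(1, 1)]"]) (auto simp: galois_rat)

text \<open>For the products of the entries of the two lists the sum factors. One factor is
  \<open>d\<close> or 0 according to whether \<sigma> fixes \<open>K\<close>, the other is
  \<open>e\<close> or 0 according to whether it fixes \<open>E\<close>, and \<sigma> fixes both
  fields iff it fixes \<open>F\<close>.\<close>

lemma separated_compositum:
  assumes K: "separated K d" and E: "separated E e"
    and F: "is_subfield F" "K \<subseteq> F" "E \<subseteq> F"
    and gen: "\<And>\<sigma>. \<sigma> \<in> galois \<Longrightarrow> (\<And>x. x \<in> K \<union> E \<Longrightarrow> \<sigma> x = x) \<Longrightarrow> (\<And>x. x \<in> F \<Longrightarrow> \<sigma> x = x)"
  shows "separated F (d * e)"
proof -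
  obtain ps where "separating_list K d ps" using K unfolding separated_def by blast
  note ps = separating_listD[OF this]
  obtain qs where "separating_list E e qs" using E unfolding separated_def by blast
  note qs = separating_listD[OF this]
  define rs where "rs = map (\<lambda>((y, w), (y', w')). (y * y', w * w')) (List.product ps qs)"
  have "(\<Sum>(y, w)\<leftarrow>rs. y * \<sigma> w) = (if \<forall>x\<in>F. \<sigma> x = x then of_int (d * e) else 0)" if \<sigma>: "\<sigma> \<in> galois" for \<sigma>
  proof -
    have mult: "\<sigma> (w * w') = \<sigma> w * \<sigma> w'" if "(y, w) \<in> set ps" "(y', w') \<in> set qs" for y w y' w'
      using galois_mult[OF \<sigma>, of w w'] ps(1)[OF that(1)] qs(1)[OF that(2)] by blast
    have "(\<Sum>(y, w)\<leftarrow>rs. y * \<sigma> w)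
        = (\<Sum>(p, q)\<leftarrow>List.product ps qs. (case p of (y, w) \<Rightarrow> y * \<sigma> w) * (case q of (y, w) \<Rightarrow> y * \<sigma> w))"
      unfolding rs_def map_map
      by (rule arg_cong[of _ _ sum_list], rule map_cong) (auto simp: mult)
    also have "\<dots> = (\<Sum>(y, w)\<leftarrow>ps. y * \<sigma> w) * (\<Sum>(y, w)\<leftarrow>qs. y * \<sigma> w)"
      by (rule sum_list_product)
    also have "\<dots> = (if (\<forall>x\<in>K. \<sigma> x = x) \<and> (\<forall>x\<in>E. \<sigma> x = x) then of_int (d * e) else 0)"
      unfolding ps(2)[OF \<sigma>] qs(2)[OF \<sigma>] by simp
    also have "(\<forall>x\<in>K. \<sigma> x = x) \<and> (\<forall>x\<in>E. \<sigma> x = x) \<longleftrightarrow> (\<forall>x\<in>F. \<sigma> x = x)"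
      using gen[OF \<sigma>] F(2,3) by blast
    finally show ?thesis .
  qed
  moreover have "algebraic_int y \<and> algebraic_int w \<and> w \<in> F" if "(y, w) \<in> set rs" for y w
  proof -
    from that obtain y1 w1 y2 w2 where "(y1, w1) \<in> set ps" "(y2, w2) \<in> set qs" "y = y1 * y2" "w = w1 * w2"
      by (auto simp: rs_def)
    thus ?thesis using ps(1)[of y1 w1] qs(1)[of y2 w2] F(2,3) subfield_mult[OF F(1), of w1 w2] by auto
  qed
  ultimately show ?thesis by (intro separatedI[of rs])
qed

text \<open>Each \<open>w\<close> is replaced by its relative trace to \<open>E\<close>. Then
  \<sigma> of the trace is the sum of the \<sigma> (u w) over the embeddings u that fix
  \<open>E\<close>, and the composite of \<sigma> and u is the identity of \<open>K\<close> for one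
  u if \<sigma> fixes \<open>E\<close>, for none otherwise.\<close>

lemma separated_subfield:
  assumes K: "alg_field K" "separated K d" and E: "is_subfield E" "E \<subseteq> K"
  shows "separated E d"
proof -
  interpret alg_field K by (rule K(1))
  obtain ps where "separating_list K d ps" using K(2) unfolding separated_def by blast
  note ps = separating_listD[OF this]
  define U where "U = {u \<in> embeddings K. \<forall>e\<in>E. u e = e}"
  have U: "U \<subseteq> embeddings K" "finite U" using finite_emb by (auto simp: U_def)
  define Tr where "Tr x = (\<Sum>u\<in>U. u x)" for x
  have Tr_int: "algebraic_int (Tr x)" if "algebraic_int x" "x \<in> K" for x
    unfolding Tr_def using U(1) by (intro algebraic_int_sum embedding_algebraic_int[OF _ that(2,1)]) auto
  have Tr_E: "Tr x \<in> E" if x: "algebraic_int x" "x \<in> K" for x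
  proof (rule in_subfield_if_galois_fixed[OF E(1)])
    show "algebraic e" if "e \<in> E" for e using that E algebraic by auto
    show "algebraic (Tr x)" using Tr_int[OF x] by auto
    fix \<sigma> assume \<sigma>: "\<sigma> \<in> galois" "\<And>e. e \<in> E \<Longrightarrow> \<sigma> e = e"
    show "\<sigma> (Tr x) = Tr x" unfolding Tr_def
    proof (rule galois_sum_embeddings[OF \<sigma>(1) U(1) _ x(2)])
      fix u assume "u \<in> U"
      thus "act \<sigma> u \<in> U" using act_embedding[OF \<sigma>(1)] \<sigma>(2) E(2) by (auto simp: U_def act_def)
    qed
  qed
  define qs where "qs = map (\<lambda>(y, w). (y, Tr w)) ps"
  have "(\<Sum>(y, w)\<leftarrow>qs. y * \<sigma> w) = (if \<forall>x\<in>E. \<sigma> x = x then of_int d else 0)" if \<sigma>: "\<sigma> \<in> galois" for \<sigma>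
  proof -
    have Tr: "\<sigma> (Tr w) = (\<Sum>u\<in>U. \<sigma> (u w))" if "(y, w) \<in> set ps" for y w
    proof -
      have "w \<in> K" using ps(1)[OF that] by simp
      thus ?thesis unfolding Tr_def using U(1)
        by (intro galois_sum[OF \<sigma>] embedding_algebraic[of _ w]) auto
    qed
    have "(\<Sum>(y, w)\<leftarrow>qs. y * \<sigma> w) = (\<Sum>(y, w)\<leftarrow>ps. \<Sum>u\<in>U. y * \<sigma> (u w))"
      unfolding qs_def map_map
      by (rule arg_cong[of _ _ sum_list], rule map_cong) (auto simp: Tr sum_distrib_left)
    also have "\<dots> = (\<Sum>u\<in>U. \<Sum>(y, w)\<leftarrow>ps. y * \<sigma> (u w))"
      by (simp add: case_prod_beta sum_list_sum_nth) (rule sum.swap)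
    also have "\<dots> = (\<Sum>u\<in>U. if \<forall>x\<in>K. \<sigma> (u x) = x then of_int d else 0)"
    proof (rule sum.cong[OF refl])
      fix u assume "u \<in> U"
      then obtain \<tau> where \<tau>: "\<tau> \<in> galois" "\<And>x. x \<in> K \<Longrightarrow> u x = \<tau> x"
        using U(1) embedding_galois by blast
      have "(\<Sum>(y, w)\<leftarrow>ps. y * \<sigma> (u w)) = (\<Sum>(y, w)\<leftarrow>ps. y * \<sigma> (\<tau> w))"
        by (rule arg_cong[of _ _ sum_list], rule map_cong) (auto simp: \<tau>(2) dest: ps(1))
      also have "\<dots> = (if \<forall>x\<in>K. \<sigma> (\<tau> x) = x then of_int d else 0)"
        by (rule ps(2)[OF galois_comp[OF \<sigma> \<tau>(1)]])
      finally show "(\<Sum>(y, w)\<leftarrow>ps. y * \<sigma> (u w)) = (if \<forall>x\<in>K. \<sigma> (u x) = x then of_int d else 0)"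
        using \<tau>(2) by simp
    qed
    also have "\<dots> = (if \<forall>x\<in>E. \<sigma> x = x then of_int d else 0)"
    proof (cases "\<forall>x\<in>E. \<sigma> x = x")
      case True
      obtain \<tau> where \<tau>: "\<tau> \<in> galois" "\<And>x. algebraic x \<Longrightarrow> \<tau> (\<sigma> x) = x" "\<And>x. algebraic x \<Longrightarrow> \<sigma> (\<tau> x) = x"
        using galois_inv[OF \<sigma>] by blast
      \<comment> \<open>The one embedding that \<sigma> turns into the identity of \<open>K\<close>:
        the restriction of the inverse of \<sigma>, which fixes \<open>E\<close> along with
        \<sigma>.\<close>
      define u0 where "u0 = restrict \<tau> K"
      have "u0 e = e" if "e \<in> E" for e
        using that E(2) True \<tau>(2)[of e] algebraic by (auto simp: u0_def)
      hence u0: "u0 \<in> U" using \<tau>(1) by (auto simp: U_def u0_def embeddings_def)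
      have "(\<forall>x\<in>K. \<sigma> (u x) = x) \<longleftrightarrow> u = u0" if u: "u \<in> U" for u
      proof
        assume *: "\<forall>x\<in>K. \<sigma> (u x) = x"
        show "u = u0"
        proof (rule embedding_ext)
          fix x assume x: "x \<in> K"
          have "\<sigma> (u x) = \<sigma> (u0 x)" using * x \<tau>(3)[of x] algebraic by (simp add: u0_def)
          thus "u x = u0 x" using galois_inj[OF \<sigma>] embedding_algebraic U(1) u u0 x by blast
        qed (use u u0 U in auto)
      qed (use \<tau>(3) algebraic in \<open>auto simp: u0_def\<close>)
      hence "(\<Sum>u\<in>U. if \<forall>x\<in>K. \<sigma> (u x) = x then of_int d else 0)
          = (\<Sum>u\<in>U. if u = u0 then of_int d else (0 :: complex))" by (intro sum.cong) auto
      also have "\<dots> = of_int d" using u0 U(2) by simp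
      finally show ?thesis using True by simp
    next
      case False
      then obtain e where e: "e \<in> E" "\<sigma> e \<noteq> e" by blast
      have "\<not> (\<forall>x\<in>K. \<sigma> (u x) = x)" if "u \<in> U" for u
        using that e E(2) by (auto simp: U_def intro!: bexI[of _ e])
      hence "(\<Sum>u\<in>U. if \<forall>x\<in>K. \<sigma> (u x) = x then of_int d else 0) = (\<Sum>u\<in>U. 0 :: complex)"
        by (intro sum.cong refl if_not_P)
      thus ?thesis unfolding if_not_P[OF False] by simp
    qed
    finally show ?thesis .
  qed
  moreover have "algebraic_int y \<and> algebraic_int w \<and> w \<in> E" if "(y, w) \<in> set qs" for y w
  proof -
    from that obtain v where "(y, v) \<in> set ps" "w = Tr v" by (auto simp: qs_def)
    thus ?thesis using ps(1)[of y v] Tr_int[of v] Tr_E[of v] by auto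
  qed
  ultimately show ?thesis by (intro separatedI[of qs])
qed

section \<open>The rationals have no unramified extension\<close>

lemma det_permuted_rows:
  assumes "p permutes {0..<m}"
  shows "det (mat m m (\<lambda>(i,j). h (p i) j)) = signof p * det (mat m m (\<lambda>(i,j). h i j))"
proof -
  have less: "p i < m" if "i < m" for i
    using permutes_in_image[OF assms, of i] that by simp
  have "mat m m (\<lambda>(i,j). h (p i) j) = mat m m (\<lambda>(i,j). mat m m (\<lambda>(i,j). h i j) $$ (p i, j))"
    by (rule eq_matI) (auto simp: less)
  thus ?thesis using det_permute_rows[OF _ assms, of "mat m m (\<lambda>(i,j). h i j)"] by simp
qed

section \<open>Discriminant matrices of a number field with numbered embeddings\<close>

locale enum_alg_field = alg_field +
  fixes m :: nat and u :: "nat \<Rightarrow> complex \<Rightarrow> complex"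
  assumes u: "bij_betw u {..<m} (embeddings K)"
begin

lemma u_embedding: "i < m \<Longrightarrow> u i \<in> embeddings K"
  using u by (auto simp: bij_betw_def)

lemma u_galois:
  assumes "i < m"
  obtains \<sigma> where "\<sigma> \<in> galois" "\<And>x. x \<in> K \<Longrightarrow> u i x = \<sigma> x"
  using embedding_galois[OF u_embedding[OF assms]] by blast

lemma act_permutes:
  assumes \<sigma>: "\<sigma> \<in> galois"
  obtains p where "p permutes {0..<m}" "\<forall>i<m. \<forall>x\<in>K. \<sigma> (u i x) = u (p i) x"
proof -
  define q where "q = (\<lambda>i. inv_into {..<m} u (act \<sigma> (u i)))"
  have "bij_betw q {..<m} {..<m}"
    unfolding q_def
    using bij_betw_trans[OF bij_betw_trans[OF u act_bij[OF \<sigma> subset_refl act_embedding[OF \<sigma>]]] bij_betw_inv_into[OF u]]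
    by (simp add: o_def)
  define p where "p = (\<lambda>i. if i < m then q i else i)"
  have "bij_betw p {..<m} {..<m}"
    using \<open>bij_betw q {..<m} {..<m}\<close> by (subst bij_betw_cong[of _ p q]) (auto simp: p_def)
  hence "p permutes {..<m}" by (rule bij_imp_permutes) (auto simp: p_def)
  hence "p permutes {0..<m}" by (simp add: atLeast0LessThan)
  moreover have "\<sigma> (u i x) = u (p i) x" if "i < m" "x \<in> K" for i x
  proof -
    have "u (q i) = act \<sigma> (u i)" unfolding q_def
      using u act_embedding[OF \<sigma> u_embedding[OF that(1)]] by (intro f_inv_into_f) (auto simp: bij_betw_def)
    thus ?thesis using that by (simp add: p_def act_def)
  qed
  ultimately show thesis using that by blast
qed

text \<open>The square of its determinant is the discriminant of the tuple \<open>b\<close>.\<close>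

definition disc_mat :: "(nat \<Rightarrow> complex) \<Rightarrow> complex mat" where
  "disc_mat b = mat m m (\<lambda>(i,j). u i (b j))"

lemma disc_mat_carrier: "disc_mat b \<in> carrier_mat m m"
  by (simp add: disc_mat_def)

text \<open>An automorphism permutes the rows, and \<open>s\<close> is the sign of that permutation.
  It is the same for all tuples, which makes the product of two such determinants invariant.\<close>

lemma galois_det_disc_mat:
  assumes \<sigma>: "\<sigma> \<in> galois"
  obtains s :: complex where "s * s = 1"
    "\<forall>b. (\<forall>j<m. b j \<in> K) \<longrightarrow> \<sigma> (det (disc_mat b)) = s * det (disc_mat b)"
proof -
  obtain p where p: "p permutes {0..<m}" "\<forall>i<m. \<forall>x\<in>K. \<sigma> (u i x) = u (p i) x"
    by (rule act_permutes[OF \<sigma>])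
  have "signof p * signof p = (1 :: complex)" by (cases p rule: sign_cases) auto
  moreover have "\<sigma> (det (disc_mat b)) = signof p * det (disc_mat b)" if b: "\<And>j. j < m \<Longrightarrow> b j \<in> K" for b
  proof -
    have "\<sigma> (det (disc_mat b)) = det (mat m m (\<lambda>(i,j). \<sigma> (u i (b j))))"
      unfolding disc_mat_def using b by (intro galois_det[OF \<sigma>] embedding_algebraic u_embedding)
    also have "mat m m (\<lambda>(i,j). \<sigma> (u i (b j))) = mat m m (\<lambda>(i,j). u (p i) (b j))"
      using b p(2) by (intro eq_matI) auto
    also have "det \<dots> = signof p * det (mat m m (\<lambda>(i,j). u i (b j)))"
      by (rule det_permuted_rows[OF p(1)])
    finally show ?thesis by (simp add: disc_mat_def)
  qed
  ultimately show thesis by (intro that[of "signof p"]) auto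
qed

lemma algebraic_int_det_disc_mat:
  assumes "\<And>j. j < m \<Longrightarrow> b j \<in> K \<and> algebraic_int (b j)"
  shows "algebraic_int (det (disc_mat b))"
proof (rule algebraic_int_det[OF disc_mat_carrier])
  fix i j assume "i < m" "j < m"
  thus "algebraic_int (disc_mat b $$ (i, j))"
    using assms embedding_algebraic_int[OF u_embedding] by (simp add: disc_mat_def)
qed

text \<open>The two tuples may differ: for \<open>b\<close> and a modification of it, the product
  shows that a coefficient given by Cramer's rule is rational.\<close>

lemma det_disc_mat_mult_int:
  assumes b: "\<And>j. j < m \<Longrightarrow> b j \<in> K \<and> algebraic_int (b j)"
    and c: "\<And>j. j < m \<Longrightarrow> c j \<in> K \<and> algebraic_int (c j)"
  shows "det (disc_mat b) * det (disc_mat c) \<in> \<int>"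
proof (rule int_if_galois_fixed)
  note int = algebraic_int_det_disc_mat[of b, OF b] algebraic_int_det_disc_mat[of c, OF c]
  show "algebraic_int (det (disc_mat b) * det (disc_mat c))" by (intro algebraic_int_mult int)
  fix \<sigma> assume \<sigma>: "\<sigma> \<in> galois"
  obtain s where s: "s * s = 1" "\<forall>b. (\<forall>j<m. b j \<in> K) \<longrightarrow> \<sigma> (det (disc_mat b)) = s * det (disc_mat b)"
    by (rule galois_det_disc_mat[OF \<sigma>])
  have "\<sigma> (det (disc_mat b) * det (disc_mat c)) = (s * det (disc_mat b)) * (s * det (disc_mat c))"
    using galois_mult[OF \<sigma> algebraic_int_imp_algebraic[OF int(1)] algebraic_int_imp_algebraic[OF int(2)]]
      s(2)[rule_format, of b] s(2)[rule_format, of c] b c by auto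
  also have "\<dots> = (s * s) * (det (disc_mat b) * det (disc_mat c))" by (simp only: mult_ac)
  finally show "\<sigma> (det (disc_mat b) * det (disc_mat c)) = det (disc_mat b) * det (disc_mat c)"
    using s(1) by simp
qed

text \<open>Suppose embeddings i and j agreed on all w of the list. An extension of
  \<open>u j\<close> followed by the inverse of an extension of \<open>u i\<close> would fix all w,
  so its sum would be 1; but it moves some element of \<open>K\<close>, so its sum is 0. Hence some
  integral combination of the w separates all embeddings.\<close>

lemma separating_element:
  assumes sep: "separated K 1"
  obtains \<theta> where "\<theta> \<in> K" "algebraic_int \<theta>" "\<And>i j. i < m \<Longrightarrow> j < m \<Longrightarrow> u i \<theta> = u j \<theta> \<Longrightarrow> i = j"
proof -
  obtain ps where "separating_list K 1 ps" using sep unfolding separated_def by blast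
  note ps = separating_listD[OF this]
  define N where "N = length ps"
  define w where "w l = snd (ps ! l)" for l
  have w: "w l \<in> K" "algebraic_int (w l)" if "l < N" for l
    using ps(1)[of "fst (ps ! l)" "w l"] nth_mem[of l ps] that by (auto simp: N_def w_def)
  \<comment> \<open>A polynomial in a parameter t: its value is the difference of the conjugates i
    and j of the combination with coefficients t^l. Only finitely many t are bad.\<close>
  define P where "P i j = (\<Sum>l<N. monom (u i (w l) - u j (w l)) l)" for i j
  have coeff: "coeff (P i j) l = u i (w l) - u j (w l)" if "l < N" for i j l
    using that by (simp add: P_def coeff_sum coeff_monom if_distrib cong: if_cong)
  have P: "P i j \<noteq> 0" if ij: "i < m" "j < m" "i \<noteq> j" for i j
  proof
    assume "P i j = 0"
    hence eq: "u i (w l) = u j (w l)" if "l < N" for l using coeff[OF that, of i j] by simp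
    obtain \<sigma> where \<sigma>: "\<sigma> \<in> galois" "\<And>x. x \<in> K \<Longrightarrow> u i x = \<sigma> x" by (rule u_galois[OF ij(1)]) blast
    obtain \<tau> where \<tau>: "\<tau> \<in> galois" "\<And>x. x \<in> K \<Longrightarrow> u j x = \<tau> x" by (rule u_galois[OF ij(2)]) blast
    obtain \<sigma>' where \<sigma>': "\<sigma>' \<in> galois" "\<And>x. algebraic x \<Longrightarrow> \<sigma>' (\<sigma> x) = x" "\<And>x. algebraic x \<Longrightarrow> \<sigma> (\<sigma>' x) = x"
      by (rule galois_inv[OF \<sigma>(1)]) blast
    have "u i \<noteq> u j" using u ij by (auto simp: bij_betw_def inj_on_def)
    then obtain x where x: "x \<in> K" "u i x \<noteq> u j x"
      using embedding_ext[OF u_embedding[OF ij(1)] u_embedding[OF ij(2)]] by blast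
    have "\<sigma>' (\<tau> x) \<noteq> x"
      using x \<sigma>'(3)[of "\<tau> x"] galois_algebraic[OF \<tau>(1) algebraic[OF x(1)]] \<sigma>(2)[OF x(1)] \<tau>(2)[OF x(1)] by auto
    hence "(\<Sum>(y, w)\<leftarrow>ps. y * \<sigma>' (\<tau> w)) = 0"
      using ps(2)[OF galois_comp[OF \<sigma>'(1) \<tau>(1)]] x(1) by auto
    moreover have "\<sigma>' (\<tau> v) = v" if "(y, v) \<in> set ps" for y v
    proof -
      from that obtain l where l: "l < N" "v = w l" by (auto simp: in_set_conv_nth N_def w_def)
      have "\<tau> v = \<sigma> v" using eq[OF l(1)] \<sigma>(2) \<tau>(2) w(1)[OF l(1)] l(2) by simp
      thus ?thesis using \<sigma>'(2) algebraic w(1)[OF l(1)] l(2) by simp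
    qed
    hence "(\<Sum>(y, w)\<leftarrow>ps. y * \<sigma>' (\<tau> w)) = (\<Sum>(y, w)\<leftarrow>ps. y * w)"
      by (intro arg_cong[of _ _ sum_list] map_cong) auto
    moreover have "(\<Sum>(y, w)\<leftarrow>ps. y * w) = 1" using ps(2)[OF galois_id] by simp
    ultimately show False by simp
  qed
  define bad where "bad = (\<Union>(i,j)\<in>{(i,j). i < m \<and> j < m \<and> i \<noteq> j}. {t. poly (P i j) t = 0})"
  have "finite {(i,j). i < m \<and> j < m \<and> i \<noteq> j}"
    by (rule finite_subset[of _ "{..<m} \<times> {..<m}"]) auto
  hence "finite bad" unfolding bad_def by (rule finite_UN_I) (auto intro!: poly_roots_finite dest: P)
  moreover have "infinite (range (of_nat :: nat \<Rightarrow> complex))"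
    by (intro range_inj_infinite) (auto simp: inj_def)
  ultimately obtain t :: nat where t: "of_nat t \<notin> bad"
    by (metis finite_subset image_subsetI)
  define \<theta> where "\<theta> = (\<Sum>l<N. of_nat t ^ l * w l)"
  show thesis
  proof (rule that[of \<theta>])
    show "\<theta> \<in> K" unfolding \<theta>_def
      by (intro subfield_sum[OF subfield] subfield_mult[OF subfield] subfield_power[OF subfield] subfield_of_nat[OF subfield] w) simp
    show "algebraic_int \<theta>" unfolding \<theta>_def
      by (intro algebraic_int_sum algebraic_int_mult algebraic_int_power w) auto
    have u\<theta>: "u i \<theta> = (\<Sum>l<N. of_nat t ^ l * u i (w l))" if i: "i < m" for i
    proof -
      obtain \<sigma> where \<sigma>: "\<sigma> \<in> galois" "\<And>x. x \<in> K \<Longrightarrow> u i x = \<sigma> x" by (rule u_galois[OF i]) blast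
      have alg: "algebraic (w l)" "algebraic (of_nat t ^ l :: complex)" if "l < N" for l
        using algebraic w(1)[OF that] by (auto intro!: algebraic_power algebraic_rat)
      have "\<sigma> \<theta> = (\<Sum>l<N. \<sigma> (of_nat t ^ l * w l))" unfolding \<theta>_def
        by (intro galois_sum[OF \<sigma>(1)] algebraic_mult alg) auto
      also have "\<dots> = (\<Sum>l<N. of_nat t ^ l * u i (w l))"
        using alg w(1) \<sigma>(2)
        by (intro sum.cong refl) (auto simp: galois_mult[OF \<sigma>(1)] galois_power[OF \<sigma>(1)] galois_of_nat[OF \<sigma>(1)] algebraic_rat)
      finally show ?thesis using \<sigma>(2)[OF \<open>\<theta> \<in> K\<close>] by simp
    qed
    fix i j assume ij: "i < m" "j < m" "u i \<theta> = u j \<theta>"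
    have "poly (P i j) (of_nat t) = (\<Sum>l<N. (u i (w l) - u j (w l)) * of_nat t ^ l)"
      by (simp add: P_def poly_sum poly_monom)
    also have "\<dots> = u i \<theta> - u j \<theta>" by (simp add: u\<theta> ij(1,2) algebra_simps sum_subtractf)
    finally have "poly (P i j) (of_nat t) = 0" using ij(3) by simp
    thus "i = j" using t ij(1,2) by (auto simp: bad_def)
  qed
qed

text \<open>The powers of a separating element give a Vandermonde matrix: a kernel vector would be a
  nonzero polynomial of degree below \<open>m\<close> with \<open>m\<close> roots.\<close>

lemma exists_det_disc_mat_nonzero:
  assumes sep: "separated K 1"
  obtains b where "\<And>j. j < m \<Longrightarrow> b j \<in> K \<and> algebraic_int (b j)" "det (disc_mat b) \<noteq> 0"
proof -
  obtain \<theta> where \<theta>: "\<theta> \<in> K" "algebraic_int \<theta>" "\<And>i j. i < m \<Longrightarrow> j < m \<Longrightarrow> u i \<theta> = u j \<theta> \<Longrightarrow> i = j"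
    using separating_element[OF sep] by blast
  have "det (disc_mat (\<lambda>j. \<theta> ^ j)) \<noteq> 0"
  proof
    assume "det (disc_mat (\<lambda>j. \<theta> ^ j)) = 0"
    then obtain v where v: "v \<in> carrier_vec m" "v \<noteq> 0\<^sub>v m" "disc_mat (\<lambda>j. \<theta> ^ j) *\<^sub>v v = 0\<^sub>v m"
      using det_0_iff_vec_prod_zero_field[OF disc_mat_carrier] by blast
    define p where "p = (\<Sum>j<m. monom (v $ j) j)"
    have coeff: "coeff p j = (if j < m then v $ j else 0)" for j
      by (simp add: p_def coeff_sum coeff_monom if_distrib cong: if_cong)
    have root: "poly p (u i \<theta>) = 0" if i: "i < m" for i
    proof -
      obtain \<sigma> where \<sigma>: "\<sigma> \<in> galois" "\<And>x. x \<in> K \<Longrightarrow> u i x = \<sigma> x" by (rule u_galois[OF i]) blast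
      have "u i (\<theta> ^ j) = u i \<theta> ^ j" for j
        using \<sigma>(2) \<theta>(1) galois_power[OF \<sigma>(1) algebraic[OF \<theta>(1)]] subfield_power[OF subfield \<theta>(1)] by simp
      hence "poly p (u i \<theta>) = (disc_mat (\<lambda>j. \<theta> ^ j) *\<^sub>v v) $ i"
        using i v(1) by (simp add: p_def poly_sum poly_monom disc_mat_def scalar_prod_def atLeast0LessThan mult.commute)
      thus ?thesis using i v(3) by simp
    qed
    have "p \<noteq> 0"
    proof
      assume "p = 0"
      hence "v $ j = 0" if "j < m" for j using coeff[of j] that by simp
      hence "v = 0\<^sub>v m" using v(1) by (intro eq_vecI) auto
      thus False using v(2) by simp
    qed
    have "inj_on (\<lambda>i. u i \<theta>) {..<m}" using \<theta>(3) by (auto intro!: inj_onI)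
    hence "m = card ((\<lambda>i. u i \<theta>) ` {..<m})" by (simp add: card_image)
    also have "\<dots> \<le> card {x. poly p x = 0}"
      using root \<open>p \<noteq> 0\<close> by (intro card_mono poly_roots_finite) auto
    also have "\<dots> \<le> degree p" using \<open>p \<noteq> 0\<close> by (rule card_poly_roots_bound)
    also have "degree p < m"
    proof (rule ccontr)
      assume "\<not> degree p < m"
      hence "lead_coeff p = 0" using coeff[of "degree p"] by simp
      thus False using \<open>p \<noteq> 0\<close> by simp
    qed
    finally show False by simp
  qed
  thus thesis using \<theta> by (intro that[of "\<lambda>j. \<theta> ^ j"]) (auto intro: subfield_power[OF subfield])
qed

text \<open>A tuple of integers of minimal nonzero discriminant is an integral basis.\<close>

lemma integral_basis:
  assumes sep: "separated K 1"
  obtains b where "\<And>j. j < m \<Longrightarrow> b j \<in> K \<and> algebraic_int (b j)" "det (disc_mat b) \<noteq> 0"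
    "\<And>w. w \<in> K \<Longrightarrow> algebraic_int w \<Longrightarrow>
      \<exists>q :: nat \<Rightarrow> int. \<forall>i<m. u i w = (\<Sum>j<m. of_int (q j) * u i (b j))"
proof -
  define good where "good b \<longleftrightarrow> (\<forall>j<m. b j \<in> K \<and> algebraic_int (b j)) \<and> det (disc_mat b) \<noteq> 0" for b
  \<comment> \<open>Absolute value of the discriminant; for integral tuples it is a natural number,
    so a minimum exists.\<close>
  define size where "size b = cmod (det (disc_mat b) * det (disc_mat b))" for b
  have size_int: "size b \<in> \<nat>" if int: "\<And>j. j < m \<Longrightarrow> b j \<in> K \<and> algebraic_int (b j)" for b
  proof -
    obtain z where z: "det (disc_mat b) * det (disc_mat b) = of_int z"
      using det_disc_mat_mult_int[of b b, OF int int] by (auto elim: Ints_cases)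
    have "size b = of_nat (nat \<bar>z\<bar>)" unfolding size_def z by simp
    thus ?thesis by (simp only: of_nat_in_Nats)
  qed
  have "\<exists>b. good b" using exists_det_disc_mat_nonzero[OF sep] unfolding good_def by metis
  then obtain b where b: "good b" and min: "\<And>c. good c \<Longrightarrow> nat \<lfloor>size b\<rfloor> \<le> nat \<lfloor>size c\<rfloor>"
    using ex_has_least_nat[of good _ "\<lambda>b. nat \<lfloor>size b\<rfloor>"] by blast
  have bK: "b j \<in> K \<and> algebraic_int (b j)" if "j < m" for j using b that by (auto simp: good_def)
  have det: "det (disc_mat b) \<noteq> 0" using b by (simp add: good_def)
  have "\<exists>q :: nat \<Rightarrow> int. \<forall>i<m. u i w = (\<Sum>j<m. of_int (q j) * u i (b j))"
    if w: "w \<in> K" "algebraic_int w" for w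
  proof -
    define B where "B = disc_mat b"
    have B: "B \<in> carrier_mat m m" by (simp add: B_def disc_mat_carrier)
    define uw where "uw = vec m (\<lambda>i. u i w)"
    define x where "x = (1 / det B) \<cdot>\<^sub>v (adj_mat B *\<^sub>v uw)"
    have adj: "adj_mat B \<in> carrier_mat m m" "B * adj_mat B = det B \<cdot>\<^sub>m 1\<^sub>m m" using adj_mat[OF B] by auto
    have uw: "uw \<in> carrier_vec m" by (simp add: uw_def)
    have x: "x \<in> carrier_vec m" using adj(1) uw by (simp add: x_def)
    have "B *\<^sub>v x = (1 / det B) \<cdot>\<^sub>v (B *\<^sub>v (adj_mat B *\<^sub>v uw))"
      unfolding x_def by (rule mult_mat_vec[OF B]) (use adj uw in auto)
    also have "B *\<^sub>v (adj_mat B *\<^sub>v uw) = (B * adj_mat B) *\<^sub>v uw"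
      by (rule assoc_mult_mat_vec[OF B adj(1) uw, symmetric])
    also have "\<dots> = det B \<cdot>\<^sub>v uw" unfolding adj(2)
    proof (rule eq_vecI)
      fix i assume "i < dim_vec (det B \<cdot>\<^sub>v uw)"
      hence i: "i < m" by (simp add: uw_def)
      have "((det B \<cdot>\<^sub>m 1\<^sub>m m) *\<^sub>v uw) $ i = (\<Sum>j = 0..<m. (det B \<cdot>\<^sub>m 1\<^sub>m m) $$ (i, j) * u j w)"
        using i by (auto simp: scalar_prod_def uw_def intro!: sum.cong)
      also have "\<dots> = (\<Sum>j = 0..<m. if j = i then det B * u i w else 0)"
        using i by (intro sum.cong refl) simp
      finally show "((det B \<cdot>\<^sub>m 1\<^sub>m m) *\<^sub>v uw) $ i = (det B \<cdot>\<^sub>v uw) $ i"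
        using i by (simp add: uw_def)
    qed (simp add: uw_def)
    finally have Bx: "B *\<^sub>v x = uw" using det by (simp add: B_def smult_smult_assoc)
    have repr: "u i w = (\<Sum>j<m. x $ j * u i (b j))" if "i < m" for i
    proof -
      have "u i w = (B *\<^sub>v x) $ i" using that by (simp add: Bx uw_def)
      also have "\<dots> = (\<Sum>j<m. x $ j * u i (b j))"
        using that x by (simp add: B_def disc_mat_def scalar_prod_def atLeast0LessThan mult.commute)
      finally show ?thesis .
    qed
    have int: "\<exists>n::int. x $ k = of_int n" if k: "k < m" for k
    proof -
      \<comment> \<open>Cramer's rule: replacing \<open>b k\<close> by \<open>w - n * b k\<close>
        multiplies the determinant by the coefficient of \<open>b k\<close> in the new element,
        which is \<open>x $ k - n\<close>.\<close>
      have change: "det (disc_mat (b(k := w - of_int n * b k))) = (x $ k - of_int n) * det B" for n :: int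
      proof -
        define y where "y = x - of_int n \<cdot>\<^sub>v unit_vec m k"
        have y: "y \<in> carrier_vec m" using x by (simp add: y_def)
        have "(B *\<^sub>v y) $ i = u i (w - of_int n * b k)" if i: "i < m" for i
        proof -
          obtain \<sigma> where \<sigma>: "\<sigma> \<in> galois" "\<And>x. x \<in> K \<Longrightarrow> u i x = \<sigma> x" by (rule u_galois[OF i]) blast
          have alg: "algebraic w" "algebraic (b k)" using bK[OF k] w by auto
          moreover have "algebraic (of_int n * b k)" by (rule algebraic_mult[OF algebraic_rat alg(2)]) simp
          ultimately have alg: "algebraic w" "algebraic (b k)" "algebraic (of_int n * b k)" by auto
          have wK: "w - of_int n * b k \<in> K"
            by (intro subfield_diff[OF subfield] subfield_mult[OF subfield] subfield_of_int[OF subfield] w(1) conjunct1[OF bK] k)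
          have "u i (w - of_int n * b k) = u i w - of_int n * u i (b k)"
            using \<sigma>(2)[OF wK] \<sigma>(2)[OF w(1)] \<sigma>(2)[of "b k"] bK[OF k] alg
            by (simp add: galois_diff[OF \<sigma>(1)] galois_mult[OF \<sigma>(1)] galois_of_int[OF \<sigma>(1)] algebraic_rat)
          moreover have "(B *\<^sub>v y) $ i = (\<Sum>j<m. u i (b j) * (x $ j - of_int n * (if j = k then 1 else 0)))"
            using i x k by (simp add: B_def disc_mat_def scalar_prod_def atLeast0LessThan y_def)
          moreover have "\<dots> = (\<Sum>j<m. x $ j * u i (b j)) - (\<Sum>j<m. if j = k then of_int n * u i (b k) else 0)"
            by (simp only: sum_subtractf[symmetric], rule sum.cong) (auto simp: algebra_simps)
          ultimately show ?thesis using repr[OF i] k by simp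
        qed
        hence "disc_mat (b(k := w - of_int n * b k)) = replace_col B (B *\<^sub>v y) k"
          unfolding replace_col_def using B by (intro eq_matI) (auto simp: B_def disc_mat_def)
        hence "det (disc_mat (b(k := w - of_int n * b k))) = y $ k * det B"
          using cramer_lemma_mat[OF B y k] by simp
        thus ?thesis using k x by (simp add: y_def)
      qed
      have newK: "(b(k := w - of_int n * b k)) j \<in> K \<and> algebraic_int ((b(k := w - of_int n * b k)) j)"
        if "j < m" for j n
        using bK[OF that] bK[OF k] w
        by (auto intro!: subfield_diff[OF subfield] subfield_mult[OF subfield] subfield_of_int[OF subfield])
      have "x $ k \<in> \<rat>"
      proof -
        have "(x $ k - of_int 0) * det B * det B \<in> \<int>" unfolding change[symmetric]
          unfolding B_def by (intro det_disc_mat_mult_int newK bK)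
        moreover have "det B * det B \<in> \<int>" unfolding B_def by (intro det_disc_mat_mult_int bK)
        ultimately have "((x $ k - of_int 0) * det B * det B) / (det B * det B) \<in> \<rat>"
          by (intro Rats_divide) (auto simp: Ints_def)
        thus ?thesis using det by (simp add: B_def)
      qed
      then obtain r :: rat where r: "x $ k = of_rat r" by (auto elim: Rats_cases)
      \<comment> \<open>With \<open>n\<close> the integral part of the coefficient, the discriminant
        is multiplied by the square of the fractional part \<open>e\<close>; minimality forces
        \<open>e = 0\<close>.\<close>
      define n where "n = \<lfloor>r\<rfloor>"
      define e where "e = real_of_rat (r - of_int n)"
      have "0 \<le> r - of_int n" "r - of_int n < 1" by (auto simp: n_def) linarith
      hence e: "0 \<le> e" "e < 1" by (auto simp: e_def zero_le_of_rat_iff of_rat_less_1_iff)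
      have xe: "x $ k - of_int n = of_real e"
      proof -
        have "of_rat r = complex_of_real (of_rat r)" by (cases r) (simp add: of_rat_rat)
        thus ?thesis by (simp add: r e_def of_rat_diff)
      qed
      define c where "c = b(k := w - of_int n * b k)"
      have detc: "det (disc_mat c) = of_real e * det B"
        using change[of n] by (simp add: c_def xe)
      have "size c = e\<^sup>2 * size b"
        by (simp add: size_def detc B_def norm_mult power2_eq_square e(1))
      moreover have "size b > 0" using det by (simp add: size_def)
      moreover have "e\<^sup>2 < 1" using e by (simp add: power_less_one_iff abs_square_less_1)
      ultimately have less: "size c < size b" by simp
      have cK: "c j \<in> K \<and> algebraic_int (c j)" if "j < m" for j using newK[OF that] by (simp add: c_def)
      obtain s t where st: "size b = of_nat s" "size c = of_nat t"
        using size_int[of b, OF bK] size_int[of c, OF cK] by (auto elim!: Nats_cases)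
      have "\<not> good c" using min[of c] less st by auto
      hence "det (disc_mat c) = 0" using cK by (auto simp: good_def)
      hence "e = 0" using detc det by (simp add: B_def)
      thus ?thesis using xe by (intro exI[of _ n]) simp
    qed
    then obtain q :: "nat \<Rightarrow> int" where q: "\<And>k. k < m \<Longrightarrow> x $ k = of_int (q k)" by metis
    show ?thesis using repr q by (intro exI[of _ q]) auto
  qed
  thus thesis using that bK det by blast
qed

text \<open>The separability idempotent expresses the inverse of the discriminant matrix through algebraic
  integers, so the discriminant is a unit.\<close>

lemma unit_discriminant:
  assumes sep: "separated K 1"
    and b: "\<And>j. j < m \<Longrightarrow> b j \<in> K \<and> algebraic_int (b j)"
    and repr: "\<And>w. w \<in> K \<Longrightarrow> algebraic_int w \<Longrightarrow>
      \<exists>q :: nat \<Rightarrow> int. \<forall>i<m. u i w = (\<Sum>j<m. of_int (q j) * u i (b j))"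
  shows "cmod (det (disc_mat b)) = 1"
proof -
  obtain ps where "separating_list K 1 ps" using sep unfolding separated_def by blast
  note ps = separating_listD[OF this]
  obtain Q :: "complex \<Rightarrow> nat \<Rightarrow> int" where
    Q: "\<And>w i. w \<in> K \<Longrightarrow> algebraic_int w \<Longrightarrow> i < m \<Longrightarrow> u i w = (\<Sum>j<m. of_int (Q w j) * u i (b j))"
    using repr by metis
  \<comment> \<open>The idempotent written along the basis: the second entries \<open>w\<close> are
    expanded in the \<open>b k\<close>, and \<open>z k\<close> collects the first entries.\<close>
  define z where "z k = (\<Sum>(y, w)\<leftarrow>ps. y * of_int (Q w k))" for k
  have z_int: "algebraic_int (z k)" for k
  proof -
    have "algebraic_int (\<Sum>(y, w)\<leftarrow>qs. y * of_int (Q w k))" if "set qs \<subseteq> set ps" for qs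
      using that by (induction qs) (auto dest: ps(1))
    thus ?thesis unfolding z_def by blast
  qed
  have "\<forall>i. \<exists>\<sigma>. i < m \<longrightarrow> \<sigma> \<in> galois \<and> (\<forall>x\<in>K. u i x = \<sigma> x)"
    using u_galois by metis
  then obtain g where g: "\<And>i. i < m \<Longrightarrow> g i \<in> galois" "\<And>i x. i < m \<Longrightarrow> x \<in> K \<Longrightarrow> u i x = g i x" by metis
  \<comment> \<open>The conjugates of the \<open>z k\<close> form the inverse of the transposed
    discriminant matrix. For h inverse to \<open>g i\<close>, the sum is \<open>g i\<close> applied
    to the sum of the list at h after \<open>g l\<close>, and this automorphism is the identity on
    \<open>K\<close> only for i = l.\<close>
  have delta: "(\<Sum>k<m. g i (z k) * u l (b k)) = (if i = l then 1 else 0)" if il: "i < m" "l < m" for i l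
  proof -
    obtain h where h: "h \<in> galois" "\<And>x. algebraic x \<Longrightarrow> h (g i x) = x" "\<And>x. algebraic x \<Longrightarrow> g i (h x) = x"
      by (rule galois_inv[OF g(1)[OF il(1)]]) blast
    have "(\<Sum>k<m. g i (z k) * u l (b k)) = g i (\<Sum>k<m. z k * h (u l (b k)))"
    proof -
      have alg: "algebraic (u l (b k))" if "k < m" for k
        using embedding_algebraic[OF u_embedding[OF il(2)]] b[OF that] by blast
      have alg': "algebraic (h (u l (b k)))" "algebraic (z k)" if "k < m" for k
        using galois_algebraic[OF h(1) alg[OF that]] z_int by auto
      have "g i (\<Sum>k<m. z k * h (u l (b k))) = (\<Sum>k<m. g i (z k * h (u l (b k))))"
        by (intro galois_sum[OF g(1)[OF il(1)]] algebraic_mult alg') auto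
      also have "\<dots> = (\<Sum>k<m. g i (z k) * u l (b k))"
        using alg' alg h(3) by (intro sum.cong refl) (auto simp: galois_mult[OF g(1)[OF il(1)]])
      finally show ?thesis by simp
    qed
    also have "(\<Sum>k<m. z k * h (u l (b k))) = (\<Sum>(y, w)\<leftarrow>ps. y * h (u l w))"
    proof -
      have alg: "algebraic (u l (b k))" if "k < m" for k
        using embedding_algebraic[OF u_embedding[OF il(2)]] b[OF that] by blast
      have hu: "h (u l w) = (\<Sum>k<m. of_int (Q w k) * h (u l (b k)))" if "(y, w) \<in> set ps" for y w
      proof -
        have "h (u l w) = h (\<Sum>k<m. of_int (Q w k) * u l (b k))"
          using Q[OF _ _ il(2), of w] ps(1)[OF that] by simp
        also have "\<dots> = (\<Sum>k<m. h (of_int (Q w k) * u l (b k)))"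
          by (intro galois_sum[OF h(1)] algebraic_mult alg algebraic_rat) auto
        also have "\<dots> = (\<Sum>k<m. of_int (Q w k) * h (u l (b k)))"
          using alg by (intro sum.cong refl) (auto simp: galois_mult[OF h(1)] galois_of_int[OF h(1)] algebraic_rat)
        finally show ?thesis .
      qed
      have "(\<Sum>(y, w)\<leftarrow>ps. y * h (u l w)) = (\<Sum>(y, w)\<leftarrow>ps. \<Sum>k<m. y * of_int (Q w k) * h (u l (b k)))"
        by (intro arg_cong[of _ _ sum_list] map_cong) (auto simp: hu sum_distrib_left mult.assoc)
      also have "\<dots> = (\<Sum>k<m. \<Sum>(y, w)\<leftarrow>ps. y * of_int (Q w k) * h (u l (b k)))"
        by (simp add: case_prod_beta sum_list_sum_nth) (rule sum.swap)
      also have "\<dots> = (\<Sum>k<m. z k * h (u l (b k)))"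
        unfolding z_def by (simp add: case_prod_beta sum_list_sum_nth sum_distrib_right)
      finally show ?thesis by simp
    qed
    also have "\<dots> = (\<Sum>(y, w)\<leftarrow>ps. y * h (g l w))"
      by (intro arg_cong[of _ _ sum_list] map_cong) (auto simp: g(2)[OF il(2)] dest: ps(1))
    also have "\<dots> = (if \<forall>x\<in>K. h (g l x) = x then of_int 1 else 0)"
      by (rule ps(2)[OF galois_comp[OF h(1) g(1)[OF il(2)]]])
    also have "(\<forall>x\<in>K. h (g l x) = x) \<longleftrightarrow> i = l"
    proof
      assume *: "\<forall>x\<in>K. h (g l x) = x"
      have "u i x = u l x" if "x \<in> K" for x
        using * that h(3)[of "g l x"] galois_algebraic[OF g(1)[OF il(2)]] algebraic g(2) il by metis
      hence "u i = u l" by (intro embedding_ext u_embedding il)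
      thus "i = l" using u il by (auto simp: bij_betw_def inj_on_def)
    qed (use h(2) algebraic in auto)
    finally show ?thesis using galois_0[OF g(1)[OF il(1)]] galois_1[OF g(1)[OF il(1)]] by (simp split: if_splits)
  qed
  define Z where "Z = mat m m (\<lambda>(i,k). g i (z k))"
  have Z: "Z \<in> carrier_mat m m" by (simp add: Z_def)
  let ?B = "disc_mat b"
  have "Z * transpose_mat ?B = 1\<^sub>m m"
    by (rule eq_matI) (auto simp: Z_def disc_mat_def scalar_prod_def atLeast0LessThan delta)
  hence "det Z * det ?B = 1"
    using det_mult[OF Z transpose_carrier_mat[THEN iffD2, OF disc_mat_carrier], of b] det_transpose[OF disc_mat_carrier, of b] by simp
  hence ZB: "(det Z * det Z) * (det ?B * det ?B) = 1" by (simp add: algebra_simps)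
  obtain n where n: "det ?B * det ?B = of_int n"
    using det_disc_mat_mult_int[of b b, OF b b] by (auto elim: Ints_cases)
  have "det Z * det Z = 1 / of_int n" using ZB n by (metis eq_divide_eq mult_zero_right zero_neq_one)
  moreover have "algebraic_int (det Z * det Z)"
    using g(1) z_int galois_algebraic_int
    by (intro algebraic_int_mult algebraic_int_det[OF Z]) (auto simp: Z_def)
  ultimately have "det Z * det Z \<in> \<int>"
    by (intro rational_algebraic_int_is_int) auto
  then obtain k where "det Z * det Z = of_int k" by (auto elim: Ints_cases)
  hence "of_int (k * n) = (1 :: complex)" using ZB n by simp
  hence "k * n = 1" by (simp only: of_int_eq_1_iff)
  hence "\<bar>n\<bar> = 1" by (auto simp: zmult_eq_1_iff)
  hence "cmod (det ?B * det ?B) = 1" unfolding n by simp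
  hence "(cmod (det ?B))\<^sup>2 = 1" by (simp add: norm_mult power2_eq_square)
  thus ?thesis by (simp add: power2_eq_1_iff) (smt (verit) norm_ge_zero)
qed

end

text \<open>The linear forms \<^term>\<open>Re z + Im z\<close> at all embeddings have determinant of absolute value one.
  Pairing conjugate embeddings, Minkowski's theorem then yields a nonzero integer of norm less than one.\<close>

lemma (in enum_alg_field) unramified_degree_one:
  assumes sep: "separated K 1"
  shows "m \<le> 1"
proof (rule ccontr)
  assume "\<not> m \<le> 1"
  hence m: "m > 1" "m > 0" by auto
  obtain b where b: "\<And>j. j < m \<Longrightarrow> b j \<in> K \<and> algebraic_int (b j)" and "det (disc_mat b) \<noteq> 0"
    and repr: "\<And>w. w \<in> K \<Longrightarrow> algebraic_int w \<Longrightarrow>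
      \<exists>q :: nat \<Rightarrow> int. \<forall>i<m. u i w = (\<Sum>j<m. of_int (q j) * u i (b j))"
    using integral_basis[OF sep] by blast
  have disc: "cmod (det (disc_mat b)) = 1" by (rule unit_discriminant[of b, OF sep b repr])
  \<comment> \<open>Complex conjugation as a permutation of the indices of the embeddings; its fixed
    points are the real embeddings.\<close>
  obtain \<kappa> where \<kappa>: "\<kappa> permutes {0..<m}" "\<forall>i<m. \<forall>x\<in>K. cnj (u i x) = u (\<kappa> i) x"
    by (rule act_permutes[OF galois_cnj])
  have \<kappa>_less: "\<kappa> i < m" if "i < m" for i
    using permutes_in_image[OF \<kappa>(1), of i] that by simp
  have \<kappa>\<kappa>: "\<kappa> (\<kappa> i) = i" if i: "i < m" for i
  proof -
    have "u (\<kappa> (\<kappa> i)) = u i"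
    proof (rule embedding_ext)
      fix x assume x: "x \<in> K"
      have "u (\<kappa> (\<kappa> i)) x = cnj (cnj (u i x))" using \<kappa>(2) i \<kappa>_less[OF i] x by simp
      thus "u (\<kappa> (\<kappa> i)) x = u i x" by simp
    qed (use i \<kappa>_less in \<open>auto intro!: u_embedding\<close>)
    thus ?thesis using u i \<kappa>_less[OF \<kappa>_less[OF i]] by (auto simp: bij_betw_def inj_on_def)
  qed
  \<comment> \<open>Since Re z + Im z = (1 - i)/2 z + (1 + i)/2 cnj z, this matrix turns the
    conjugates into the real forms; for a real embedding the two coefficients fall together and add
    to 1. Its square is the permutation matrix of \<kappa>, so its determinant has absolute value
    1.\<close>
  define U where "U = mat m m (\<lambda>(i,j). (if j = i then (1 - \<i>) / 2 else 0) + (if j = \<kappa> i then (1 + \<i>) / 2 else 0))"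
  define P where "P = mat m m (\<lambda>(i,j). 1\<^sub>m m $$ (\<kappa> i, j) :: complex)"
  have U: "U \<in> carrier_mat m m" by (simp add: U_def)
  have sumU: "(\<Sum>j<m. U $$ (i,j) * h j) = (1 - \<i>) / 2 * h i + (1 + \<i>) / 2 * h (\<kappa> i)" if i: "i < m" for i h
  proof -
    have "(\<Sum>j<m. U $$ (i,j) * h j)
        = (\<Sum>j<m. (if j = i then (1 - \<i>) / 2 * h i else 0) + (if j = \<kappa> i then (1 + \<i>) / 2 * h (\<kappa> i) else 0))"
      using i by (intro sum.cong refl) (auto simp: U_def algebra_simps)
    thus ?thesis using i \<kappa>_less[OF i] by (simp add: sum.distrib)
  qed
  have "U * U = P"
  proof (rule eq_matI)
    fix i j assume "i < dim_row P" "j < dim_col P"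
    hence ij: "i < m" "j < m" by (auto simp: P_def)
    have "(U * U) $$ (i,j) = (\<Sum>k<m. U $$ (i,k) * U $$ (k,j))"
      using ij U by (simp add: scalar_prod_def atLeast0LessThan)
    also have "\<dots> = (1 - \<i>) / 2 * U $$ (i,j) + (1 + \<i>) / 2 * U $$ (\<kappa> i,j)" by (rule sumU[OF ij(1)])
    also have "\<dots> = (if j = \<kappa> i then 1 else 0)"
      using ij \<kappa>_less[OF ij(1)] \<kappa>\<kappa>[OF ij(1)] by (auto simp: U_def algebra_simps complex_eq_iff)
    finally show "(U * U) $$ (i,j) = P $$ (i,j)" using ij \<kappa>_less[OF ij(1)] by (auto simp: P_def)
  qed (auto simp: U_def P_def)
  hence "det U * det U = det P" using det_mult[OF U U] by simp
  also have "det P = signof \<kappa>" unfolding P_def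
    using det_permute_rows[OF one_carrier_mat \<kappa>(1)] by simp
  finally have "cmod (det U * det U) = 1" by (cases \<kappa> rule: sign_cases) auto
  hence "(cmod (det U))\<^sup>2 = 1" by (simp add: norm_mult power2_eq_square)
  hence detU: "cmod (det U) = 1" by (auto simp: power2_eq_1_iff dest: sym intro: order.antisym) (smt (verit) norm_ge_zero)
  define A where "A i j = Re (u i (b j)) + Im (u i (b j))" for i j
  have "map_mat complex_of_real (mat m m (\<lambda>(i,j). A i j)) = U * disc_mat b"
  proof (rule eq_matI)
    fix i j assume "i < dim_row (U * disc_mat b)" "j < dim_col (U * disc_mat b)"
    hence ij: "i < m" "j < m" by (auto simp: U_def disc_mat_def)
    have "(U * disc_mat b) $$ (i,j) = (\<Sum>k<m. U $$ (i,k) * u k (b j))"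
      using ij U by (simp add: scalar_prod_def atLeast0LessThan disc_mat_def)
    also have "\<dots> = (1 - \<i>) / 2 * u i (b j) + (1 + \<i>) / 2 * u (\<kappa> i) (b j)" by (rule sumU[OF ij(1)])
    also have "u (\<kappa> i) (b j) = cnj (u i (b j))" using \<kappa>(2) ij b by simp
    also have "(1 - \<i>) / 2 * u i (b j) + (1 + \<i>) / 2 * cnj (u i (b j)) = complex_of_real (A i j)"
      by (simp add: A_def complex_eq_iff field_simps)
    finally show "map_mat complex_of_real (mat m m (\<lambda>(i,j). A i j)) $$ (i,j) = (U * disc_mat b) $$ (i,j)"
      using ij by simp
  qed (auto simp: U_def disc_mat_def)
  hence "complex_of_real (det (mat m m (\<lambda>(i,j). A i j))) = det U * det (disc_mat b)"
    using det_mult[OF U disc_mat_carrier, of b] by (simp flip: of_real_hom.hom_det)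
  hence "cmod (complex_of_real (det (mat m m (\<lambda>(i,j). A i j)))) = 1"
    using detU disc by (simp add: norm_mult)
  hence "\<bar>det (mat m m (\<lambda>(i,j). A i j))\<bar> = 1" by simp
  then obtain x :: "nat \<Rightarrow> int" where x: "\<exists>j<m. x j \<noteq> 0" "\<bar>\<Sum>j<m. A 0 j * x j\<bar> \<le> 1"
    "\<And>i. 0 < i \<Longrightarrow> i < m \<Longrightarrow> \<bar>\<Sum>j<m. A i j * x j\<bar> < 1"
    using minkowski_linear_forms[OF m(2)] by blast
  define \<xi> where "\<xi> = (\<Sum>j<m. of_int (x j) * b j)"
  have \<xi>: "\<xi> \<in> K" "algebraic_int \<xi>"
    unfolding \<xi>_def using b
    by (auto intro!: subfield_sum[OF subfield] subfield_mult[OF subfield] subfield_of_int[OF subfield])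
  have u\<xi>: "u i \<xi> = (\<Sum>j<m. of_int (x j) * u i (b j))" if i: "i < m" for i
  proof -
    obtain \<sigma> where \<sigma>: "\<sigma> \<in> galois" "\<And>x. x \<in> K \<Longrightarrow> u i x = \<sigma> x" by (rule u_galois[OF i]) blast
    have alg: "algebraic (b j)" if "j < m" for j using b[OF that] by auto
    have "\<sigma> \<xi> = (\<Sum>j<m. \<sigma> (of_int (x j) * b j))" unfolding \<xi>_def
      by (intro galois_sum[OF \<sigma>(1)] algebraic_mult alg algebraic_rat) auto
    also have "\<dots> = (\<Sum>j<m. of_int (x j) * u i (b j))"
      using alg b \<sigma>(2) by (intro sum.cong refl) (auto simp: galois_mult[OF \<sigma>(1)] galois_of_int[OF \<sigma>(1)] algebraic_rat)
    finally show ?thesis using \<sigma>(2)[OF \<xi>(1)] by simp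
  qed
  define l where "l i = Re (u i \<xi>) + Im (u i \<xi>)" for i
  have l: "l i = (\<Sum>j<m. A i j * x j)" if "i < m" for i
    unfolding l_def u\<xi>[OF that] by (simp add: A_def sum.distrib[symmetric] algebra_simps)
  \<comment> \<open>With a and b the real and imaginary part, the forms at the two conjugate
    embeddings are a + b and a - b, and the mean of their squares is a^2 + b^2.\<close>
  have norm_l: "(cmod (u i \<xi>))\<^sup>2 = ((l i)\<^sup>2 + (l (\<kappa> i))\<^sup>2) / 2" if i: "i < m" for i
  proof -
    have "u (\<kappa> i) \<xi> = cnj (u i \<xi>)" using \<kappa>(2) i \<xi>(1) by simp
    thus ?thesis unfolding cmod_power2 by (simp add: l_def power2_eq_square algebra_simps)
  qed
  have l_le: "(l i)\<^sup>2 \<le> 1" if "i < m" for i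
    using x(2,3) l[OF that] that by (cases "i = 0") (auto simp: abs_square_le_1 less_imp_le)
  have l_less: "(l i)\<^sup>2 < 1" if "i < m" "i > 0" for i
    using x(3) l[OF that(1)] that by (auto simp: abs_square_less_1)
  have le1: "(cmod (u i \<xi>))\<^sup>2 \<le> 1" if "i < m" for i
    using norm_l[OF that] l_le[OF that] l_le[OF \<kappa>_less[OF that]] by simp
  \<comment> \<open>Only form 0 is allowed to reach absolute value 1. As \<open>m > 1\<close>,
    embedding 1 exists and gives a strict inequality, which makes the norm an integer of absolute
    value below 1.\<close>
  have less1: "(cmod (u 1 \<xi>))\<^sup>2 < 1"
    using norm_l[OF m(1)] l_less[OF m(1)] l_le[OF \<kappa>_less[OF m(1)]] by simp
  define N where "N = (\<Prod>v\<in>embeddings K. v \<xi>)"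
  have N: "N = (\<Prod>i<m. u i \<xi>)"
    unfolding N_def by (rule prod.reindex_bij_betw[OF u, symmetric])
  have "(cmod N)\<^sup>2 = (\<Prod>i<m. (cmod (u i \<xi>))\<^sup>2)" unfolding N by (simp add: prod_norm[symmetric] prod_power_distrib)
  also have "\<dots> = (cmod (u 1 \<xi>))\<^sup>2 * (\<Prod>i\<in>{..<m} - {1}. (cmod (u i \<xi>))\<^sup>2)"
    using m(1) by (intro prod.remove) auto
  also have "\<dots> \<le> (cmod (u 1 \<xi>))\<^sup>2 * 1"
    using le1 by (intro mult_left_mono prod_le_1) auto
  finally have "(cmod N)\<^sup>2 \<le> (cmod (u 1 \<xi>))\<^sup>2" by (simp only: mult_1_right)
  hence "(cmod N)\<^sup>2 < 1" using less1 by linarith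
  moreover obtain n where n: "N = of_int n"
    using norm_int[OF \<xi>] unfolding N_def by (auto elim: Ints_cases)
  ultimately have "real_of_int (n\<^sup>2) < 1" by simp
  hence "n\<^sup>2 < 1" by linarith
  hence "n = 0" using zero_less_power2[of n] by linarith
  hence "N = 0" using n by simp
  then obtain i where i: "i < m" "u i \<xi> = 0" unfolding N by auto
  have "\<xi> = 0"
  proof -
    obtain \<sigma> where \<sigma>: "\<sigma> \<in> galois" "\<And>x. x \<in> K \<Longrightarrow> u i x = \<sigma> x" by (rule u_galois[OF i(1)]) blast
    have "\<sigma> \<xi> = \<sigma> 0" using \<sigma>(2)[OF \<xi>(1)] i(2) galois_0[OF \<sigma>(1)] by simp
    thus ?thesis using galois_inj[OF \<sigma>(1) algebraic[OF \<xi>(1)], of 0] by auto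
  qed
  have zero: "u k \<xi> = 0" if k: "k < m" for k
  proof -
    obtain \<sigma> where \<sigma>: "\<sigma> \<in> galois" "\<And>x. x \<in> K \<Longrightarrow> u k x = \<sigma> x" by (rule u_galois[OF k]) blast
    show ?thesis using \<sigma>(2)[OF \<xi>(1)] \<open>\<xi> = 0\<close> galois_0[OF \<sigma>(1)] by simp
  qed
  define v :: "complex vec" where "v = vec m (\<lambda>j. of_int (x j))"
  have "disc_mat b *\<^sub>v v = 0\<^sub>v m"
  proof (rule eq_vecI)
    fix i assume "i < dim_vec (0\<^sub>v m)"
    hence i: "i < m" by simp
    show "(disc_mat b *\<^sub>v v) $ i = 0\<^sub>v m $ i"
      using i zero[OF i] u\<xi>[OF i] by (simp add: disc_mat_def v_def scalar_prod_def atLeast0LessThan mult.commute)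
  qed (simp add: disc_mat_def)
  moreover have "v \<noteq> 0\<^sub>v m"
  proof
    assume "v = 0\<^sub>v m"
    obtain j where "j < m" "x j \<noteq> 0" using x(1) by blast
    hence "v $ j \<noteq> 0" by (simp add: v_def)
    thus False using \<open>v = 0\<^sub>v m\<close> \<open>j < m\<close> by simp
  qed
  moreover have "v \<in> carrier_vec m" by (simp add: v_def)
  ultimately have "det (disc_mat b) = 0"
    using det_0_iff_vec_prod_zero_field[OF disc_mat_carrier] by blast
  thus False using disc by simp
qed

lemma unramified_imp_Rats:
  assumes K: "alg_field K" and sep: "separated K 1"
  shows "K = \<rat>"
proof -
  interpret alg_field K by (rule K)
  obtain u where u: "bij_betw u {..<card (embeddings K)} (embeddings K)"
    using ex_bij_betw_nat_finite[OF finite_emb] atLeast0LessThan by auto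
  interpret enum_alg_field K "card (embeddings K)" u
    by unfold_locales (rule u)
  have card: "card (embeddings K) \<le> 1" by (rule unramified_degree_one[OF sep])
  have "x \<in> \<rat>" if x: "x \<in> K" for x
  proof (rule rational_if_galois_fixed)
    show "algebraic x" by (rule algebraic[OF x])
    fix \<sigma> assume \<sigma>: "\<sigma> \<in> galois"
    have "restrict \<sigma> K \<in> embeddings K" "restrict (\<lambda>x. x) K \<in> embeddings K"
      using \<sigma> galois_id by (auto simp: embeddings_def)
    hence eq: "restrict \<sigma> K = restrict (\<lambda>x. x) K"
      using card finite_emb by (metis One_nat_def card_le_Suc0_iff_eq)
    show "\<sigma> x = x" using fun_cong[OF eq, of x] x by (simp only: restrict_apply if_True)
  qed
  thus ?thesis using Rats_subset_subfield[OF subfield] by blast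
qed

section \<open>Fields generated by a root, and the polynomial discriminant\<close>

text \<open>Gauss's lemma by pseudo-division: a primitive polynomial of least degree with root
  \<alpha> divides every integer polynomial with that root, and the irreducible \<open>f\<close>
  equals it up to a unit.\<close>

lemma int_poly_dvd_if_common_root:
  fixes f g :: "int poly" and \<alpha> :: complex
  assumes irr: "irreducible f"
    and f: "poly (map_poly of_int f) \<alpha> = 0" and g: "poly (map_poly of_int g) \<alpha> = 0"
  shows "f dvd g"
proof -
  let ?P = "\<lambda>n. \<exists>p :: int poly. p \<noteq> 0 \<and> poly (map_poly of_int p) \<alpha> = 0 \<and> degree p = n"
  have "?P (degree f)" using irr f by (intro exI[of _ f]) auto
  hence "?P (LEAST n. ?P n)" by (rule LeastI)
  then obtain p0 where p0: "p0 \<noteq> 0" "poly (map_poly of_int p0) \<alpha> = 0" "degree p0 = (LEAST n. ?P n)"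
    by blast
  have min: "degree p0 \<le> degree h" if "h \<noteq> 0" "poly (map_poly of_int h) \<alpha> = 0" for h
    unfolding p0(3) using that by (intro Least_le) blast
  define p where "p = primitive_part p0"
  have p: "content p = 1" "p \<noteq> 0" "degree p = degree p0" using p0(1) by (auto simp: p_def)
  have "map_poly of_int p0 = smult (of_int (content p0)) (map_poly of_int p :: complex poly)"
    unfolding p_def by (metis content_times_primitive_part of_int_hom.map_poly_hom_smult)
  hence root: "poly (map_poly of_int p) \<alpha> = 0" using p0(1,2) by simp
  have dvd: "p dvd h" if h: "poly (map_poly of_int h) \<alpha> = 0" for h
  proof -
    obtain a q where aq: "a \<noteq> 0" "smult a h = p * q + pseudo_mod h p"
      using pseudo_mod(1)[OF p(2), of h] by blast
    have "poly (map_poly of_int (smult a h)) \<alpha> = (0 :: complex)"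
      using h by (simp add: of_int_hom.map_poly_hom_smult)
    hence r: "poly (map_poly of_int (pseudo_mod h p)) \<alpha> = (0 :: complex)"
      unfolding aq(2) using root by (simp add: of_int_poly_hom.hom_add of_int_poly_hom.hom_mult)
    have "pseudo_mod h p = 0"
    proof (rule ccontr)
      assume ne: "pseudo_mod h p \<noteq> 0"
      hence "degree (pseudo_mod h p) < degree p" using pseudo_mod(2)[OF p(2), of h] by blast
      thus False using min[OF ne r] p(3) by simp
    qed
    hence eq: "smult a h = p * q" using aq(2) by simp
    have "content (smult a h) = content q" unfolding eq content_mult p(1) by simp
    moreover have "a dvd normalize a * content h" by (rule dvd_mult2) simp
    ultimately have "a dvd content q" by (simp only: content_smult)
    hence "[:a:] dvd q" by (simp add: const_poly_dvd_iff_dvd_content)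
    then obtain q' where "q = [:a:] * q'" by (elim dvdE)
    hence "smult a h = smult a (p * q')" using eq by simp
    hence "smult a (h - p * q') = 0" by (simp add: smult_diff_right)
    hence "h = p * q'" using aq(1) unfolding smult_eq_0_iff by simp
    thus ?thesis by simp
  qed
  obtain t where t: "f = p * t" using dvd[OF f] by (elim dvdE)
  have "\<not> is_unit p"
  proof
    assume "is_unit p"
    then obtain c where c: "p = [:c:]" unfolding is_unit_poly_iff by blast
    hence "c \<noteq> 0" using p(2) by auto
    thus False using root c by simp
  qed
  hence "is_unit t" using irreducibleD[OF irr t] by simp
  thus ?thesis using dvd[OF g] by (simp add: t mult_unit_dvd_iff)
qed

text \<open>Row \<open>i\<close> lists the coefficients of a power of the variable times
  \<open>p\<close> or \<open>q\<close>, highest degree first, so pairing it with the powers of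
  \<open>x\<close> evaluates that polynomial.\<close>

lemma sylvester_mat_row:
  fixes p q :: "'a :: comm_ring_1 poly"
  defines "m \<equiv> degree p" and "n \<equiv> degree q"
  assumes i: "i < m + n"
  shows "(\<Sum>j<m + n. sylvester_mat p q $$ (i,j) * x ^ (m + n - 1 - j))
    = (if i < n then x ^ (n - 1 - i) * poly p x else x ^ (m + n - 1 - i) * poly q x)"
proof -
  define h where "h = (if i < n then monom 1 (n - 1 - i) * p else monom 1 (m + n - 1 - i) * q)"
  have S: "sylvester_mat p q $$ (i,j) = coeff h (m + n - 1 - j)" if j: "j < m + n" for j
  proof (cases "i < n")
    case True
    thus ?thesis using i j unfolding m_def n_def
      by (subst sylvester_index_mat) (auto simp: h_def coeff_monom_mult m_def n_def coeff_eq_0 intro!: arg_cong[of _ _ "coeff p"])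
  next
    case False
    thus ?thesis using i j unfolding m_def n_def
      by (subst sylvester_index_mat) (auto simp: h_def coeff_monom_mult m_def n_def coeff_eq_0 intro!: arg_cong[of _ _ "coeff q"])
  qed
  have deg: "degree h \<le> m + n - 1"
  proof (cases "i < n")
    case True
    have "degree h \<le> degree (monom 1 (n - 1 - i) :: 'a poly) + degree p"
      using True by (simp add: h_def degree_mult_le)
    also have "\<dots> \<le> (n - 1 - i) + m" using degree_monom_le[of "1::'a" "n - 1 - i"] by (simp add: m_def)
    finally show ?thesis using True by simp
  next
    case False
    have "degree h \<le> degree (monom 1 (m + n - 1 - i) :: 'a poly) + degree q"
      using False by (simp add: h_def degree_mult_le)
    also have "\<dots> \<le> (m + n - 1 - i) + n" using degree_monom_le[of "1::'a" "m + n - 1 - i"] by (simp add: n_def)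
    finally show ?thesis using False i by simp
  qed
  have "(\<Sum>j<m + n. sylvester_mat p q $$ (i,j) * x ^ (m + n - 1 - j))
      = (\<Sum>j<m + n. coeff h (m + n - Suc j) * x ^ (m + n - Suc j))"
    by (intro sum.cong refl) (simp add: S)
  also have "\<dots> = (\<Sum>k<m + n. coeff h k * x ^ k)"
    by (rule sum.nat_diff_reindex)
  also have "\<dots> = (\<Sum>k\<le>m + n - 1. coeff h k * x ^ k)"
    using i by (intro sum.cong) auto
  also have "\<dots> = poly h x"
    unfolding poly_altdef by (rule sum.mono_neutral_right) (use deg in \<open>auto simp: coeff_eq_0\<close>)
  finally show ?thesis by (simp add: h_def poly_monom)
qed

text \<open>The last row of the adjugate of the Sylvester matrix combines its rows into the constant
  polynomial \<open>resultant\<close>. At a root of \<open>f\<close> the rows of \<open>f\<close>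
  drop out, and what remains is \<open>V\<close> times the derivative.\<close>

lemma resultant_linear_combination:
  fixes f :: "int poly"
  assumes deg: "degree f > 0"
  obtains V :: "int poly" where "\<And>x::complex. poly (map_poly of_int f) x = 0 \<Longrightarrow>
    poly (map_poly of_int V) x * poly (map_poly of_int (pderiv f)) x = of_int (resultant f (pderiv f))"
proof -
  let ?g = "pderiv f"
  define m where "m = degree f"
  define n where "n = degree ?g"
  define S where "S = sylvester_mat f ?g"
  have S: "S \<in> carrier_mat (m + n) (m + n)" by (simp add: S_def m_def n_def sylvester_carrier_mat)
  have adj: "adj_mat S \<in> carrier_mat (m + n) (m + n)" "adj_mat S * S = det S \<cdot>\<^sub>m 1\<^sub>m (m + n)"
    using adj_mat[OF S] by auto
  define l where "l = m + n - 1"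
  have l: "l < m + n" using deg by (simp add: l_def m_def)
  define V where "V = (\<Sum>i\<in>{n..<m + n}. monom (adj_mat S $$ (l, i)) (l - i))"
  show thesis
  proof (rule that[of V])
    fix x :: complex assume x: "poly (map_poly of_int f) x = 0"
    have dm: "degree (map_poly of_int f :: complex poly) = m" "degree (map_poly of_int ?g :: complex poly) = n"
      by (auto simp: m_def n_def)
    have row: "(\<Sum>j<m + n. of_int (S $$ (i,j)) * x ^ (l - j))
        = (if i < n then 0 else x ^ (l - i) * poly (map_poly of_int ?g) x)" if i: "i < m + n" for i
    proof -
      have "sylvester_mat (map_poly of_int f) (map_poly of_int ?g :: complex poly) $$ (i,j) = of_int (S $$ (i,j))" if "j < m + n" for j
        using i that by (simp add: S_def sylvester_index_mat dm m_def n_def)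
      thus ?thesis using sylvester_mat_row[of i "map_poly of_int f" "map_poly of_int ?g" x] i x
        unfolding dm l_def by simp
    qed
    have "of_int (resultant f ?g) = (\<Sum>j<m + n. of_int ((det S \<cdot>\<^sub>m 1\<^sub>m (m + n)) $$ (l, j)) * x ^ (l - j))"
    proof -
      have "(\<Sum>j<m + n. of_int ((det S \<cdot>\<^sub>m 1\<^sub>m (m + n)) $$ (l, j)) * x ^ (l - j))
          = (\<Sum>j<m + n. if j = l then of_int (det S) else 0)"
        using l by (intro sum.cong refl) auto
      thus ?thesis using l by (simp add: resultant_def S_def)
    qed
    also have "\<dots> = (\<Sum>j<m + n. \<Sum>i<m + n. of_int (adj_mat S $$ (l,i)) * of_int (S $$ (i,j)) * x ^ (l - j))"
      unfolding adj(2)[symmetric] using l adj(1) S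
      by (intro sum.cong refl) (simp add: scalar_prod_def atLeast0LessThan sum_distrib_right)
    also have "\<dots> = (\<Sum>i<m + n. of_int (adj_mat S $$ (l,i)) * (\<Sum>j<m + n. of_int (S $$ (i,j)) * x ^ (l - j)))"
      by (subst sum.swap) (simp add: sum_distrib_left mult.assoc)
    also have "\<dots> = (\<Sum>i<m + n. if i < n then 0 else of_int (adj_mat S $$ (l,i)) * (x ^ (l - i) * poly (map_poly of_int ?g) x))"
      by (intro sum.cong refl) (simp add: row)
    also have "\<dots> = (\<Sum>i\<in>{n..<m + n}. of_int (adj_mat S $$ (l,i)) * (x ^ (l - i) * poly (map_poly of_int ?g) x))"
      by (intro sum.mono_neutral_cong_right) auto
    also have "\<dots> = poly (map_poly of_int V) x * poly (map_poly of_int ?g) x"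
      by (simp add: V_def hom_distribs poly_sum poly_monom sum_distrib_right mult.assoc map_poly_monom)
    finally show "poly (map_poly of_int V) x * poly (map_poly of_int ?g) x = of_int (resultant f ?g)" by simp
  qed
qed

text \<open>The Sylvester matrix is multiplied by a block matrix whose last columns are the power
  vectors of the roots. There the rows of \<open>F\<close> vanish and the rows of \<open>G\<close>
  give values of \<open>G\<close>, so the product is block triangular and the Vandermonde
  determinant cancels. Its nonvanishing is how distinctness of the roots is stated.\<close>

lemma resultant_prod_roots:
  fixes F G :: "complex poly" and \<rho> :: "nat \<Rightarrow> complex"
  defines "m \<equiv> degree F" and "n \<equiv> degree G"
  assumes m: "m > 0" and root: "\<And>i. i < m \<Longrightarrow> poly F (\<rho> i) = 0"
    and V: "det (mat m m (\<lambda>(k,i). \<rho> i ^ (m - 1 - k))) \<noteq> 0"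
  shows "resultant F G = lead_coeff F ^ n * (\<Prod>i<m. poly G (\<rho> i))"
proof -
  define S where "S = sylvester_mat F G"
  have S: "S \<in> carrier_mat (n + m) (n + m)"
    using sylvester_carrier_mat[of F G] by (simp add: S_def m_def n_def add.commute)
  define Vm where "Vm = mat m m (\<lambda>(k,i). \<rho> i ^ (m - 1 - k))"
  define W where "W = mat n m (\<lambda>(k,i). \<rho> i ^ (m + n - 1 - k))"
  define X where "X = four_block_mat (1\<^sub>m n) W (0\<^sub>m m n) Vm"
  have car: "Vm \<in> carrier_mat m m" "W \<in> carrier_mat n m" by (auto simp: Vm_def W_def)
  have X: "X \<in> carrier_mat (n + m) (n + m)" unfolding X_def using car by (intro four_block_carrier_mat) auto
  have detX: "det X = det Vm" unfolding X_def
    by (subst det_four_block_mat_lower_left_zero[OF one_carrier_mat car(2) refl car(1)]) simp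
  define T where "T = mat n n (\<lambda>(i,j). S $$ (i,j))"
  define Y where "Y = mat m n (\<lambda>(i,j). S $$ (n + i,j))"
  define E where "E = mat m m (\<lambda>(i,j). if i = j then poly G (\<rho> i) else 0)"
  have car': "T \<in> carrier_mat n n" "Y \<in> carrier_mat m n" "E \<in> carrier_mat m m" by (auto simp: T_def Y_def E_def)
  have Xcol: "X $$ (k, n + i) = \<rho> i ^ (m + n - 1 - k)" if "k < n + m" "i < m" for k i
    using that by (auto simp: X_def Vm_def W_def)
  have Xcol0: "X $$ (k, j) = (if k = j then 1 else 0)" if "k < n + m" "j < n" for k j
    using that by (auto simp: X_def Vm_def W_def)
  have "S * X = four_block_mat T (0\<^sub>m n m) Y (Vm * E)"
  proof (rule eq_matI)
    fix i j assume "i < dim_row (four_block_mat T (0\<^sub>m n m) Y (Vm * E))"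
      "j < dim_col (four_block_mat T (0\<^sub>m n m) Y (Vm * E))"
    hence ij: "i < n + m" "j < n + m" by (auto simp: T_def Vm_def E_def)
    have SX: "(S * X) $$ (i,j) = (\<Sum>k<n + m. S $$ (i,k) * X $$ (k,j))"
      using ij S X by (simp add: scalar_prod_def atLeast0LessThan)
    show "(S * X) $$ (i,j) = four_block_mat T (0\<^sub>m n m) Y (Vm * E) $$ (i,j)"
    proof (cases "j < n")
      case True
      have "(S * X) $$ (i,j) = (\<Sum>k<n + m. if k = j then S $$ (i,j) else 0)"
        unfolding SX using True by (intro sum.cong refl) (auto simp: Xcol0)
      also have "\<dots> = S $$ (i,j)" using ij by simp
      finally show ?thesis using ij True by (auto simp: T_def Y_def Vm_def E_def)
    next
      case False
      define i' where "i' = j - n"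
      have i': "i' < m" "j = n + i'" using False ij by (auto simp: i'_def)
      have "(S * X) $$ (i,j) = (\<Sum>k<m + n. sylvester_mat F G $$ (i,k) * \<rho> i' ^ (m + n - 1 - k))"
        unfolding SX
      proof (rule sum.cong)
        fix k assume "k \<in> {..<m + n}"
        hence k: "k < n + m" by simp
        show "S $$ (i,k) * X $$ (k,j) = sylvester_mat F G $$ (i,k) * \<rho> i' ^ (m + n - 1 - k)"
          by (simp only: i'(2) Xcol[OF k i'(1)] S_def)
      qed (simp add: add.commute)
      also have "\<dots> = (if i < n then 0 else \<rho> i' ^ (m + n - 1 - i) * poly G (\<rho> i'))"
        using sylvester_mat_row[of i F G "\<rho> i'"] ij root[OF i'(1)] by (simp add: m_def n_def add.commute)
      finally have eq: "(S * X) $$ (i,j) = (if i < n then 0 else \<rho> i' ^ (m + n - 1 - i) * poly G (\<rho> i'))" .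
      have VE: "(Vm * E) $$ (k, i') = \<rho> i' ^ (m - 1 - k) * poly G (\<rho> i')" if k: "k < m" for k
      proof -
        have "(Vm * E) $$ (k, i') = (\<Sum>l<m. \<rho> l ^ (m - 1 - k) * (if l = i' then poly G (\<rho> l) else 0))"
          using k i' by (simp add: scalar_prod_def atLeast0LessThan Vm_def E_def)
        also have "\<dots> = (\<Sum>l<m. if l = i' then \<rho> i' ^ (m - 1 - k) * poly G (\<rho> i') else 0)"
          by (intro sum.cong refl) auto
        finally show ?thesis using i' by simp
      qed
      have "m - Suc (i - n) = m + n - Suc i" if "\<not> i < n" using that ij by simp
      thus ?thesis using ij i' eq VE[of "i - n"] car car' by auto
    qed
  qed (use S X in \<open>auto simp: T_def Vm_def E_def\<close>)
  hence "det S * det X = det T * det (Vm * E)"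
    using det_mult[OF S X] det_four_block_mat_upper_right_zero[OF car'(1) refl car'(2) mult_carrier_mat[OF car(1) car'(3)]]
    by simp
  also have "det (Vm * E) = det Vm * det E" by (rule det_mult[OF car(1) car'(3)])
  also have "det E = (\<Prod>i<m. poly G (\<rho> i))"
    by (subst det_upper_triangular[OF _ car'(3)])
      (auto simp: E_def prod_list_diag_prod atLeast0LessThan)
  also have "det T = lead_coeff F ^ n"
  proof -
    have "upper_triangular T" unfolding upper_triangular_def
      by (auto simp: T_def S_def sylvester_index_mat m_def n_def)
    hence "det T = (\<Prod>i<n. T $$ (i,i))"
      by (subst det_upper_triangular[OF _ car'(1)]) (auto simp: prod_list_diag_prod atLeast0LessThan T_def)
    also have "\<dots> = (\<Prod>i<n. lead_coeff F)"
      using m by (intro prod.cong refl) (simp add: T_def S_def sylvester_index_mat m_def n_def)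
    finally show ?thesis by simp
  qed
  finally have "det S * det Vm = (lead_coeff F ^ n * (\<Prod>i<m. poly G (\<rho> i))) * det Vm"
    unfolding detX by (simp only: mult_ac)
  thus ?thesis using V by (simp add: Vm_def S_def resultant_def)
qed


text \<open>Synthetic division: the quotient of F(y) - F(x) by y - x, as a polynomial in y, has as
  coefficients the intermediate values of Horner's scheme at x.\<close>

lemma poly_eq_shift:
  fixes F :: "'a :: comm_ring_1 poly"
  shows "poly F y - poly F x = (y - x) * (\<Sum>l<degree F. poly (poly_shift (Suc l) F) x * y ^ l)"
proof -
  have shift: "poly (poly_shift l F) x = coeff F l + x * poly (poly_shift (Suc l) F) x" for l
  proof -
    have "poly_shift l F = pCons (coeff F l) (poly_shift (Suc l) F)"
      by (rule poly_eqI) (auto simp: coeff_poly_shift coeff_pCons split: nat.splits)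
    thus ?thesis by simp
  qed
  have "(y - x) * (\<Sum>l<k. poly (poly_shift (Suc l) F) x * y ^ l)
      = y ^ k * poly (poly_shift k F) x - poly F x + (\<Sum>l<k. coeff F l * y ^ l)" for k
  proof (induction k)
    case (Suc k)
    have "(y - x) * (\<Sum>l<Suc k. poly (poly_shift (Suc l) F) x * y ^ l)
        = y ^ k * poly (poly_shift k F) x - poly F x + (\<Sum>l<k. coeff F l * y ^ l)
          + (y - x) * (poly (poly_shift (Suc k) F) x * y ^ k)"
      using Suc by (simp add: distrib_left)
    also have "\<dots> = y ^ Suc k * poly (poly_shift (Suc k) F) x - poly F x + (\<Sum>l<Suc k. coeff F l * y ^ l)"
      unfolding shift[of k] by (simp add: algebra_simps)
    finally show ?case .
  qed simp
  moreover have "poly (poly_shift (degree F) F) x = lead_coeff F"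
  proof -
    have "poly_shift (degree F) F = [:lead_coeff F:]"
      by (rule poly_eqI) (auto simp: coeff_poly_shift coeff_pCons coeff_eq_0 split: nat.splits)
    thus ?thesis by simp
  qed
  moreover have "poly F y = (\<Sum>l<degree F. coeff F l * y ^ l) + lead_coeff F * y ^ degree F"
    by (simp add: poly_altdef flip: lessThan_Suc_atMost)
  ultimately show ?thesis by (simp add: mult.commute)
qed

text \<open>At y = x the quotient in \<open>poly_eq_shift\<close> becomes the derivative.\<close>

lemma poly_pderiv_shift:
  fixes F :: "'a :: {idom, ring_char_0} poly"
  shows "(\<Sum>l<degree F. poly (poly_shift (Suc l) F) x * x ^ l) = poly (pderiv F) x"
proof -
  define Q where "Q = (\<Sum>l<degree F. smult (poly (poly_shift (Suc l) F) x) (monom 1 l))"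
  have Q: "poly Q y = (\<Sum>l<degree F. poly (poly_shift (Suc l) F) x * y ^ l)" for y
    by (simp add: Q_def poly_sum poly_monom)
  have "poly (F - [:poly F x:]) y = poly ([:- x, 1:] * Q) y" for y
    using poly_eq_shift[of F y x] by (simp add: Q algebra_simps)
  hence "F - [:poly F x:] = [:- x, 1:] * Q" 
    unfolding poly_eq_poly_eq_iff[symmetric] by (rule ext)
  hence "pderiv (F - [:poly F x:]) = pderiv ([:- x, 1:] * Q)" by simp
  hence "poly (pderiv F) x = poly (pderiv ([:- x, 1:] * Q)) x" by (simp add: pderiv_diff)
  also have "\<dots> = poly Q x" unfolding pderiv_mult by (simp add: pderiv_pCons)
  finally show ?thesis by (simp add: Q)
qed

section \<open>The conjugates of a root of an irreducible integer polynomial\<close>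

locale irreducible_root =
  fixes f :: "int poly" and \<alpha> :: complex
  assumes irr: "irreducible f" and deg: "degree f \<ge> 2" and root: "poly (map_poly of_int f) \<alpha> = 0"
begin

abbreviation "F \<equiv> map_poly of_int f :: complex poly"

definition Z :: "complex set" where "Z = {z. poly F z = 0}"

lemma F_nz: "f \<noteq> 0" "F \<noteq> 0"
  using deg by auto

lemma root_pderiv_nonzero:
  assumes "z \<in> Z"
  shows "poly (pderiv F) z \<noteq> 0"
proof
  assume "poly (pderiv F) z = 0"
  hence "poly (map_poly of_int (pderiv f)) z = 0" by (simp add: of_int_hom.map_poly_pderiv)
  hence "f dvd pderiv f" using assms by (intro int_poly_dvd_if_common_root[OF irr, of z]) (auto simp: Z_def)
  moreover have "pderiv f \<noteq> 0" using deg by (simp add: pderiv_eq_0_iff)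
  ultimately have "degree f \<le> degree (pderiv f)" by (rule dvd_imp_degree_le)
  thus False using deg by (simp add: degree_pderiv)
qed

lemma F_decompose: "smult (lead_coeff F) (\<Prod>z\<in>Z. [:- z, 1:]) = F"
  using complex_poly_decompose_rsquarefree[of F] root_pderiv_nonzero
  by (simp add: Z_def rsquarefree_roots)

lemma finite_Z: "finite Z"
  using F_nz by (simp add: Z_def poly_roots_finite)

lemma card_Z: "card Z = degree f"
proof -
  have "degree F = degree (\<Prod>z\<in>Z. [:- z, 1:])"
    by (subst F_decompose[symmetric], subst degree_smult_eq) (use F_nz in auto)
  also have "\<dots> = card Z" by (subst degree_prod_eq_sum_degree) auto
  finally show ?thesis by simp
qed

lemma alpha_Z: "\<alpha> \<in> Z"
  using root by (simp add: Z_def)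

lemma Z_algebraic: "z \<in> Z \<Longrightarrow> algebraic z"
  using F_nz by (intro algebraicI[of F]) (auto simp: Z_def coeff_map_poly)

text \<open>For a root \<open>x\<close> of \<open>F\<close> this is the coefficient of y^l in
  F(y)/(y - x). Written as an integer polynomial at \<open>x\<close>, it lies in the ring generated
  by \<open>x\<close> and is carried by automorphisms to its value at the conjugate root.\<close>

definition s :: "nat \<Rightarrow> complex \<Rightarrow> complex" where
  "s l x = poly (map_poly of_int (poly_shift (Suc l) f)) x"

lemma s_eq: "s l x = poly (poly_shift (Suc l) F) x"
  unfolding s_def by (rule arg_cong[of _ _ "\<lambda>p. poly p x"], rule poly_eqI) (simp add: coeff_poly_shift coeff_map_poly)

text \<open>The sum is the value at \<open>y\<close> of the quotient of \<open>F\<close> by the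
  linear factor of \<open>x\<close>: zero at the other roots, the derivative at \<open>x\<close>
  itself.\<close>

lemma s_sum:
  assumes "x \<in> Z" "y \<in> Z"
  shows "(\<Sum>l<degree f. s l x * y ^ l) = (if x = y then poly (pderiv F) x else 0)"
proof (cases "x = y")
  case True
  thus ?thesis using poly_pderiv_shift[of F x] by (simp add: s_eq)
next
  case False
  have "(y - x) * (\<Sum>l<degree f. s l x * y ^ l) = 0"
    using poly_eq_shift[of F y x] assms by (simp add: s_eq Z_def)
  thus ?thesis using False by simp
qed

text \<open>The coefficients of \<^term>\<open>F div [:- x, 1:]\<close> map the module spanned by the powers of the root
  \<^term>\<open>x\<close> into itself, whence their integrality.\<close>

lemma s_algebraic_int:
  assumes x: "x \<in> Z" and l: "l < degree f"
  shows "algebraic_int (s l x)"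
proof -
  let ?d = "degree f"
  define V where "V = (\<lambda>i. x ^ i) ` {..<?d}"
  have fin: "finite V" by (simp add: V_def)
  have V: "x ^ i \<in> zspan V" if "i < ?d" for i
    by (rule zspan_base[OF fin]) (use that in \<open>auto simp: V_def\<close>)
  have expand: "s l x = (\<Sum>k<?d - l. of_int (coeff f (Suc l + k)) * x ^ k)" for l
  proof -
    have "s l x = (\<Sum>k\<le>degree (poly_shift (Suc l) f). of_int (coeff f (Suc l + k)) * x ^ k)"
      unfolding s_def poly_altdef by (simp add: coeff_map_poly coeff_poly_shift add.commute)
    also have "\<dots> = (\<Sum>k<?d - l. of_int (coeff f (Suc l + k)) * x ^ k)"
    proof (rule sum.mono_neutral_cong)
      fix k assume "k \<in> {..<?d - l} - {..degree (poly_shift (Suc l) f)}"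
      hence "coeff (poly_shift (Suc l) f) k = 0" by (intro coeff_eq_0) auto
      thus "of_int (coeff f (Suc l + k)) * x ^ k = 0" by (simp add: coeff_poly_shift add.commute)
    next
      fix k assume "k \<in> {..degree (poly_shift (Suc l) f)} - {..<?d - l}"
      thus "of_int (coeff f (Suc l + k)) * x ^ k = 0" by (auto simp: coeff_eq_0)
    qed auto
    finally show ?thesis .
  qed
  \<comment> \<open>By f(x) = 0 the high part of f, which is \<open>s l x * x ^ Suc l\<close>, is
    minus the low part. So \<open>s l x * x ^ i\<close> is a combination of powers below the degree:
    directly for i <= l, through this relation for i > l.\<close>
  have rel: "s l x * x ^ Suc l = - (\<Sum>k\<le>l. of_int (coeff f k) * x ^ k)" for l
  proof (induction l)
    case 0
    have "F = pCons (of_int (coeff f 0)) (map_poly of_int (poly_shift (Suc 0) f))"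
      by (rule poly_eqI) (auto simp: coeff_map_poly coeff_poly_shift coeff_pCons split: nat.splits)
    hence "poly F x = of_int (coeff f 0) + x * s 0 x" by (simp add: s_def)
    thus ?case using x by (simp add: Z_def add_eq_0_iff mult.commute)
  next
    case (Suc l)
    have "map_poly of_int (poly_shift (Suc l) f)
        = pCons (of_int (coeff f (Suc l))) (map_poly of_int (poly_shift (Suc (Suc l)) f) :: complex poly)"
      by (rule poly_eqI) (auto simp: coeff_map_poly coeff_poly_shift coeff_pCons split: nat.splits)
    hence "s l x = of_int (coeff f (Suc l)) + x * s (Suc l) x" by (simp add: s_def)
    hence "s (Suc l) x * x ^ Suc (Suc l) = s l x * x ^ Suc l - of_int (coeff f (Suc l)) * x ^ Suc l"
      by (simp add: algebra_simps)
    thus ?case using Suc by simp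
  qed
  show ?thesis
  proof (rule algebraic_int_if_zspan[OF fin, of 1])
    show "1 \<in> V" unfolding V_def using deg by (auto intro!: image_eqI[of _ _ 0])
    fix v assume "v \<in> V"
    then obtain i where i: "i < ?d" "v = x ^ i" by (auto simp: V_def)
    show "s l x * v \<in> zspan V"
    proof (cases "i \<le> l")
      case True
      have "s l x * v = (\<Sum>k<?d - l. of_int (coeff f (Suc l + k)) * x ^ (k + i))"
        unfolding expand i(2) by (simp add: sum_distrib_right power_add mult.assoc)
      also have "\<dots> \<in> zspan V" using True l by (intro zspan_sum zspan_of_int_mult V) auto
      finally show ?thesis .
    next
      case False
      hence "x ^ i = x ^ Suc l * x ^ (i - Suc l)" by (simp flip: power_add power_Suc)
      hence "s l x * v = (s l x * x ^ Suc l) * x ^ (i - Suc l)" using i(2) by simp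
      also have "\<dots> = (\<Sum>k\<le>l. of_int (- coeff f k) * x ^ (k + (i - Suc l)))"
        unfolding rel by (simp add: sum_distrib_right power_add mult.assoc sum_negf)
      also have "\<dots> \<in> zspan V" using i False by (intro zspan_sum zspan_of_int_mult V) auto
      finally show ?thesis .
    qed
  qed auto
qed

text \<open>Powers of a root of a nonmonic \<open>f\<close> need not be integral, but 1 and the
  \<open>s l\<close> with \<open>l < degree f - 1\<close> are. Their discriminant is that of
  \<open>f\<close> up to sign: \<open>s (degree f - 1)\<close> is the leading coefficient, and
  replacing it by 1 divides the determinant by that coefficient.\<close>

lemma disc_square:
  assumes \<rho>: "bij_betw \<rho> {..<degree f} Z"
  defines "w \<equiv> \<lambda>i j. if j = 0 then 1 else s (degree f - 1 - j) (\<rho> i)"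
  shows "\<exists>e. (e = 1 \<or> e = - 1) \<and> (det (mat (degree f) (degree f) (\<lambda>(i,j). w i j)))\<^sup>2 = e * of_int (poly_disc f)"
    and "det (mat (degree f) (degree f) (\<lambda>(i,j). w i j)) \<noteq> 0"
    and "\<exists>e. (e = 1 \<or> e = - 1) \<and> resultant f (pderiv f) = e * lead_coeff f * poly_disc f"
proof -
  define d where "d = degree f"
  have d: "d \<ge> 2" "degree F = d" using deg by (auto simp: d_def)
  define a where "a = lead_coeff f"
  have a: "a \<noteq> 0" using F_nz by (simp add: a_def)
  have \<rho>Z: "\<rho> i \<in> Z" if "i < d" for i using \<rho> that by (auto simp: bij_betw_def d_def)
  define W where "W = mat d d (\<lambda>(i,j). w i j)"
  define C where "C = mat d d (\<lambda>(i,j). s (d - 1 - j) (\<rho> i))"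
  define V where "V = mat d d (\<lambda>(i,j). \<rho> i ^ j)"
  define V' where "V' = mat d d (\<lambda>(k,i). \<rho> i ^ (d - 1 - k))"
  \<comment> \<open>Triangular change from powers to the \<open>s\<close>. The corner entry
    \<open>c\<close> is the leading coefficient for \<open>C\<close> and 1 for \<open>W\<close>; all
    other diagonal entries are the leading coefficient.\<close>
  define T where "T c = mat d d (\<lambda>(k,j). if k \<le> j then (if j = 0 then c else of_int (coeff f (d - j + k))) else (0::complex))" for c
  define E where "E = mat d d (\<lambda>(i,j). if i = j then poly (pderiv F) (\<rho> i) else 0)"
  have car: "W \<in> carrier_mat d d" "C \<in> carrier_mat d d" "V \<in> carrier_mat d d" "V' \<in> carrier_mat d d"
    "T c \<in> carrier_mat d d" "E \<in> carrier_mat d d" for c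
    by (auto simp: W_def C_def V_def V'_def T_def E_def)
  have sj: "s (d - 1 - j) x = (\<Sum>k<d. (if k \<le> j then of_int (coeff f (d - j + k)) else 0) * x ^ k)" if j: "j < d" for j x
  proof -
    have "s (d - 1 - j) x = (\<Sum>k\<le>degree (poly_shift (d - j) f). of_int (coeff f (d - j + k)) * x ^ k)"
      using j unfolding s_def poly_altdef by (simp add: coeff_map_poly coeff_poly_shift add.commute Suc_diff_Suc)
    also have "\<dots> = (\<Sum>k<d. (if k \<le> j then of_int (coeff f (d - j + k)) else 0) * x ^ k)"
    proof (rule sum.mono_neutral_cong)
      fix k assume "k \<in> {..<d} - {..degree (poly_shift (d - j) f)}"
      hence "coeff (poly_shift (d - j) f) k = 0" by (intro coeff_eq_0) auto
      thus "(if k \<le> j then of_int (coeff f (d - j + k)) else 0) * x ^ k = 0" by (simp add: coeff_poly_shift add.commute)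
    next
      fix k assume "k \<in> {..degree (poly_shift (d - j) f)} - {..<d}"
      thus "of_int (coeff f (d - j + k)) * x ^ k = 0" using j by (auto simp: coeff_eq_0 d_def)
    next
      fix k assume "k \<in> {..degree (poly_shift (d - j) f)} \<inter> {..<d}"
      thus "of_int (coeff f (d - j + k)) * x ^ k = (if k \<le> j then of_int (coeff f (d - j + k)) else 0) * x ^ k"
        using j by (auto simp: coeff_eq_0 d_def)
    qed auto
    finally show ?thesis .
  qed
  have detT: "det (T c) = c * of_int a ^ (d - 1)" for c
  proof -
    have "upper_triangular (T c)" by (auto simp: T_def upper_triangular_def)
    hence "det (T c) = (\<Prod>i<d. T c $$ (i,i))"
      by (subst det_upper_triangular[OF _ car(5)]) (auto simp: prod_list_diag_prod atLeast0LessThan T_def)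
    also have "\<dots> = T c $$ (0,0) * (\<Prod>i\<in>{..<d} - {0}. T c $$ (i,i))"
      using d by (intro prod.remove) auto
    also have "(\<Prod>i\<in>{..<d} - {0}. T c $$ (i,i)) = (\<Prod>i\<in>{..<d} - {0}. of_int a)"
      by (intro prod.cong refl) (auto simp: T_def a_def d_def)
    finally show ?thesis using d by (simp add: T_def)
  qed
  have VT: "(V * T c) $$ (i,j) = (\<Sum>k<d. \<rho> i ^ k * T c $$ (k,j))" if "i < d" "j < d" for i j c
    using that by (simp add: V_def scalar_prod_def atLeast0LessThan T_def)
  have "C = V * T (of_int a)"
  proof (rule eq_matI)
    fix i j assume "i < dim_row (V * T (of_int a))" "j < dim_col (V * T (of_int a))"
    hence ij: "i < d" "j < d" by (auto simp: V_def T_def)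
    show "C $$ (i,j) = (V * T (of_int a)) $$ (i,j)"
      unfolding VT[OF ij] using ij sj[OF ij(2), of "\<rho> i"]
      by (auto simp: C_def T_def a_def d_def mult.commute intro!: sum.cong)
  qed (auto simp: C_def V_def T_def)
  hence detC: "det C = of_int a ^ d * det V"
    using det_mult[OF car(3,5)] d by (simp add: detT power_eq_if)
  have "W = V * T 1"
  proof (rule eq_matI)
    fix i j assume "i < dim_row (V * T 1)" "j < dim_col (V * T 1)"
    hence ij: "i < d" "j < d" by (auto simp: V_def T_def)
    show "W $$ (i,j) = (V * T 1) $$ (i,j)"
    proof (cases "j = 0")
      case True
      have "(V * T 1) $$ (i,j) = (\<Sum>k<d. if k = 0 then 1 else 0)"
        unfolding VT[OF ij] using True ij by (intro sum.cong refl) (auto simp: T_def)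
      thus ?thesis using True ij by (simp add: W_def w_def)
    next
      case False
      thus ?thesis unfolding VT[OF ij] using ij sj[OF ij(2), of "\<rho> i"]
        by (auto simp: W_def w_def T_def d_def mult.commute intro!: sum.cong)
    qed
  qed (auto simp: W_def V_def T_def)
  hence detW: "det W = of_int a ^ (d - 1) * det V"
    using det_mult[OF car(3,5)] by (simp add: detT)
  \<comment> \<open>By \<open>s_sum\<close> the two matrices are dual; as the derivative has no zero
    among the roots, both are invertible.\<close>
  have "C * V' = E"
  proof (rule eq_matI)
    fix i j assume "i < dim_row E" "j < dim_col E"
    hence ij: "i < d" "j < d" by (auto simp: E_def)
    have "(C * V') $$ (i,j) = (\<Sum>l<d. s (d - Suc l) (\<rho> i) * \<rho> j ^ (d - Suc l))"
      using ij by (simp add: C_def V'_def scalar_prod_def atLeast0LessThan)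
    also have "\<dots> = (\<Sum>l<d. s l (\<rho> i) * \<rho> j ^ l)" by (rule sum.nat_diff_reindex)
    also have "\<dots> = (if \<rho> i = \<rho> j then poly (pderiv F) (\<rho> i) else 0)"
      using s_sum[OF \<rho>Z[OF ij(1)] \<rho>Z[OF ij(2)]] by (simp add: d_def)
    also have "\<rho> i = \<rho> j \<longleftrightarrow> i = j" using \<rho> ij by (auto simp: bij_betw_def inj_on_def d_def)
    finally show "(C * V') $$ (i,j) = E $$ (i,j)" using ij by (simp add: E_def)
  qed (auto simp: C_def V'_def E_def)
  hence "det C * det V' = det E" using det_mult[OF car(2,4)] by simp
  also have "det E = (\<Prod>i<d. poly (pderiv F) (\<rho> i))"
    by (subst det_upper_triangular[OF _ car(6)]) (auto simp: E_def prod_list_diag_prod atLeast0LessThan)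
  finally have CV: "det C * det V' = (\<Prod>i<d. poly (pderiv F) (\<rho> i))" .
  have nz: "(\<Prod>i<d. poly (pderiv F) (\<rho> i)) \<noteq> 0"
    using root_pderiv_nonzero \<rho>Z by simp
  hence V'nz: "det V' \<noteq> 0" and Cnz: "det C \<noteq> 0" using CV by auto
  thus "det (mat (degree f) (degree f) (\<lambda>(i,j). w i j)) \<noteq> 0"
    using detC detW a by (auto simp: W_def d_def)
  obtain e1 where e1: "e1 = 1 \<or> e1 = - 1" "det V' = e1 * det V"
  proof -
    define p where "p = (\<lambda>k. if k < d then d - 1 - k else k)"
    have "bij_betw p {0..<d} {0..<d}"
      by (rule bij_betwI[of _ _ _ p]) (auto simp: p_def)
    hence p: "p permutes {0..<d}" by (rule bij_imp_permutes) (auto simp: p_def)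
    have "V' = mat d d (\<lambda>(i,j). (\<lambda>i j. \<rho> j ^ i) (p i) j)"
      by (rule eq_matI) (auto simp: V'_def p_def)
    hence "det V' = signof p * det (mat d d (\<lambda>(i,j). \<rho> j ^ i))"
      using det_permuted_rows[OF p, of "\<lambda>i j. \<rho> j ^ i"] by simp
    also have "mat d d (\<lambda>(i,j). \<rho> j ^ i) = transpose_mat V" by (rule eq_matI) (auto simp: V_def)
    also have "det \<dots> = det V" by (rule det_transpose[OF car(3)])
    finally show thesis by (intro that[of "signof p"]) (cases p rule: sign_cases, auto)
  qed
  have dp: "degree (pderiv F) = d - 1" using d by (simp add: degree_pderiv)
  have "resultant F (pderiv F) = of_int a ^ (d - 1) * (\<Prod>i<d. poly (pderiv F) (\<rho> i))"
    using resultant_prod_roots[of F \<rho> "pderiv F"] d \<rho>Z V'nz unfolding dp d(2) V'_def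
    by (simp add: Z_def a_def d_def)
  also have "\<dots> = of_int a ^ (d - 1) * (of_int a ^ d * det V * (e1 * det V))"
    unfolding CV[symmetric] detC e1(2) by simp
  also have "\<dots> = e1 * of_int a * (det W)\<^sup>2"
    unfolding detW using d by (simp add: power2_eq_square power_eq_if algebra_simps)
  finally have "resultant F (pderiv F) = e1 * of_int a * (det W)\<^sup>2" .
  moreover have "resultant F (pderiv F) = of_int (resultant f (pderiv f))"
  proof -
    have pd: "pderiv F = map_poly of_int (pderiv f)" by (simp add: of_int_hom.map_poly_pderiv)
    show ?thesis unfolding pd by (rule of_int_hom.resultant_hom)
  qed
  ultimately have res: "of_int (resultant f (pderiv f)) = e1 * of_int a * (det W)\<^sup>2" by simp
  \<comment> \<open>So the division by the leading coefficient in \<open>poly_disc\<close> is exact: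
    the quotient is rational and, through \<open>W\<close>, an algebraic integer.\<close>
  have Wint: "\<exists>z::int. e1 * (det W)\<^sup>2 = of_int z"
  proof -
    have "algebraic_int (det W)"
    proof (rule algebraic_int_det[OF car(1)])
      fix i j assume "i < d" "j < d"
      thus "algebraic_int (W $$ (i,j))" using s_algebraic_int[OF \<rho>Z, of i "d - 1 - j"] d
        by (simp add: W_def w_def d_def)
    qed
    hence "algebraic_int (e1 * (det W)\<^sup>2)" using e1(1) by (auto intro!: algebraic_int_mult algebraic_int_power)
    moreover have "e1 * (det W)\<^sup>2 = of_int (resultant f (pderiv f)) / of_int a"
      using res a by (simp add: field_simps)
    hence "e1 * (det W)\<^sup>2 \<in> \<rat>" by simp
    ultimately have "e1 * (det W)\<^sup>2 \<in> \<int>" by (rule rational_algebraic_int_is_int)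
    thus ?thesis by (auto elim: Ints_cases)
  qed
  then obtain z :: int where z: "e1 * (det W)\<^sup>2 = of_int z" by blast
  have "of_int (resultant f (pderiv f)) = (of_int (a * z) :: complex)" using res z by simp
  hence "resultant f (pderiv f) = a * z" by (simp only: of_int_eq_iff)
  define e2 :: int where "e2 = (- 1) ^ (d * (d - 1) div 2)"
  have e2: "e2 = 1 \<or> e2 = - 1" unfolding e2_def
    by (cases "even (d * (d - 1) div 2)") (simp_all only: neg_one_even_power neg_one_odd_power, auto)
  have "poly_disc f = e2 * (a * z) div a"
    by (simp add: poly_disc_def Let_def \<open>resultant f (pderiv f) = a * z\<close> e2_def d_def a_def)
  also have "\<dots> = e2 * z" using a by (simp add: mult.left_commute)
  finally have disc: "poly_disc f = e2 * z" .
  have "resultant f (pderiv f) = e2 * lead_coeff f * poly_disc f"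
    using e2 unfolding disc \<open>resultant f (pderiv f) = a * z\<close> a_def by auto
  thus "\<exists>e. (e = 1 \<or> e = - 1) \<and> resultant f (pderiv f) = e * lead_coeff f * poly_disc f"
    using e2 by blast
  have "(det W)\<^sup>2 = (e1 * of_int e2) * of_int (poly_disc f)"
  proof -
    have "(det W)\<^sup>2 = e1 * (e1 * (det W)\<^sup>2)" using e1(1) by auto
    also have "\<dots> = e1 * of_int z" unfolding z by (rule refl)
    finally show ?thesis using e2 unfolding disc by auto
  qed
  thus "\<exists>e. (e = 1 \<or> e = - 1) \<and> (det (mat (degree f) (degree f) (\<lambda>(i,j). w i j)))\<^sup>2 = e * of_int (poly_disc f)"
    using e1(1) e2 by (intro exI[of _ "e1 * of_int e2"]) (auto simp: W_def d_def)
qed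

lemma root_enumeration:
  obtains \<rho> where "bij_betw \<rho> {..<degree f} Z" "\<rho> 0 = \<alpha>"
proof -
  obtain e where e: "bij_betw e {..<degree f} Z"
    using ex_bij_betw_nat_finite[OF finite_Z] card_Z atLeast0LessThan by auto
  then obtain k where k: "k < degree f" "e k = \<alpha>" using alpha_Z
    by (metis bij_betw_imp_surj_on imageE lessThan_iff)
  have "bij_betw (transpose 0 k) {..<degree f} {..<degree f}"
    using k deg by (intro permutes_imp_bij permutes_swap_id) auto
  from bij_betw_trans[OF this e] k show thesis by (intro that[of "e \<circ> transpose 0 k"]) auto
qed

lemma resultant_eq_disc:
  obtains e where "e = 1 \<or> e = - 1" "resultant f (pderiv f) = e * lead_coeff f * poly_disc f"
  using root_enumeration disc_square(3) by metis

lemma galois_Z: "\<sigma> \<in> galois \<Longrightarrow> z \<in> Z \<Longrightarrow> \<sigma> z \<in> Z"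
  using galois_poly[OF _ Z_algebraic, of \<sigma> z f] by (auto simp: Z_def)

lemma galois_s: "\<sigma> \<in> galois \<Longrightarrow> z \<in> Z \<Longrightarrow> \<sigma> (s l z) = s l (\<sigma> z)"
  unfolding s_def by (rule galois_poly[OF _ Z_algebraic])

lemma galois_fixes_gen_field_root:
  assumes "\<sigma> \<in> galois"
  shows "(\<forall>x\<in>gen_field {\<alpha>}. \<sigma> x = x) \<longleftrightarrow> \<sigma> \<alpha> = \<alpha>"
  using galois_eq_on_gen_field[OF assms galois_id, of "{\<alpha>}"] gen_field_superset[of "{\<alpha>}"]
    Z_algebraic[OF alpha_Z] by auto

lemma s_in_gen_field: "s l \<alpha> \<in> gen_field {\<alpha>}"
  unfolding s_def using gen_field_superset[of "{\<alpha>}"]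
  by (intro poly_coeffs_in[OF subfield_gen_field] coeffs_in_of_int[OF subfield_gen_field]) auto

text \<open>The rows of \<open>W\<close> are the conjugates of the integral family of
  \<open>disc_square\<close>, with \<alpha> in row 0. The first column of the adjugate, times det W
  and a sign, pairs with row i to the discriminant if i = 0 and to 0 otherwise; an automorphism
  takes row 0 to the row of its value at \<alpha>.\<close>

lemma separated_root: "separated (gen_field {\<alpha>}) (poly_disc f)"
proof -
  obtain \<rho> where \<rho>: "bij_betw \<rho> {..<degree f} Z" "\<rho> 0 = \<alpha>" by (rule root_enumeration)
  define d where "d = degree f"
  have d: "d \<ge> 2" using deg by (simp add: d_def)
  define w where "w z j = (if j = 0 then 1 else s (d - 1 - j) z)" for z j
  define W where "W = mat d d (\<lambda>(i,j). w (\<rho> i) j)"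
  have W: "W \<in> carrier_mat d d" by (simp add: W_def)
  have \<rho>Z: "\<rho> i \<in> Z" if "i < d" for i using \<rho>(1) that by (auto simp: bij_betw_def d_def)
  have w_int: "algebraic_int (w z j)" if "z \<in> Z" for z j
    using s_algebraic_int[OF that, of "d - 1 - j"] d by (auto simp: w_def d_def)
  obtain e :: complex where e: "e = 1 \<or> e = - 1" "(det W)\<^sup>2 = e * of_int (poly_disc f)"
  proof -
    have "mat (degree f) (degree f) (\<lambda>(i,j). if j = 0 then 1 else s (degree f - 1 - j) (\<rho> i)) = W"
      unfolding W_def w_def d_def by (rule refl)
    thus thesis using disc_square(1)[OF \<rho>(1)] that by auto
  qed
  define y where "y j = e * det W * adj_mat W $$ (j, 0)" for j
  have adj: "adj_mat W \<in> carrier_mat d d" "W * adj_mat W = det W \<cdot>\<^sub>m 1\<^sub>m d" using adj_mat[OF W] by auto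
  have det_int: "algebraic_int (det W)"
    by (rule algebraic_int_det[OF W]) (auto simp: W_def intro: w_int \<rho>Z)
  have y_int: "algebraic_int (y j)" if j: "j < d" for j
  proof -
    have "adj_mat W $$ (j, 0) = (- 1) ^ j * det (mat_delete W 0 j)"
      using j W d by (simp add: adj_mat_def cofactor_def)
    moreover have "algebraic_int (det (mat_delete W 0 j))"
      by (rule algebraic_int_det[OF mat_delete_carrier[OF W]])
        (auto simp: mat_delete_def W_def intro!: w_int \<rho>Z)
    moreover have "algebraic_int ((- 1) ^ j :: complex)" by (auto intro!: algebraic_int_power)
    moreover have "algebraic_int e" using e(1) by auto
    ultimately show ?thesis unfolding y_def using det_int by (auto intro!: algebraic_int_mult)
  qed
  define ps where "ps = map (\<lambda>j. (y j, w \<alpha> j)) [0..<d]"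
  show ?thesis
  proof (rule separatedI[of ps])
    fix y' w' assume "(y', w') \<in> set ps"
    then obtain j where j: "j < d" "y' = y j" "w' = w \<alpha> j" by (auto simp: ps_def)
    have "w \<alpha> j \<in> gen_field {\<alpha>}"
      using s_in_gen_field subfield_1[OF subfield_gen_field] by (auto simp: w_def)
    thus "algebraic_int y' \<and> algebraic_int w' \<and> w' \<in> gen_field {\<alpha>}"
      using j y_int w_int[OF alpha_Z] by auto
  next
    fix \<sigma> assume \<sigma>: "\<sigma> \<in> galois"
    have "\<sigma> \<alpha> \<in> Z" by (rule galois_Z[OF \<sigma> alpha_Z])
    then obtain i where i: "i < d" "\<sigma> \<alpha> = \<rho> i"
      using \<rho>(1) unfolding d_def by (metis bij_betw_imp_surj_on imageE lessThan_iff)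
    have \<sigma>w: "\<sigma> (w \<alpha> j) = w (\<rho> i) j" for j
      using galois_s[OF \<sigma> alpha_Z] galois_1[OF \<sigma>] i(2) by (simp add: w_def)
    have "(\<Sum>(y, w)\<leftarrow>ps. y * \<sigma> w) = (\<Sum>j<d. y j * w (\<rho> i) j)"
      by (simp add: ps_def o_def \<sigma>w interv_sum_list_conv_sum_set_nat atLeast0LessThan)
    also have "\<dots> = e * det W * (\<Sum>j<d. W $$ (i,j) * adj_mat W $$ (j,0))"
      using i(1) by (simp add: y_def W_def sum_distrib_left mult_ac)
    also have "(\<Sum>j<d. W $$ (i,j) * adj_mat W $$ (j,0)) = (W * adj_mat W) $$ (i,0)"
      using i(1) d W adj(1) by (simp add: scalar_prod_def atLeast0LessThan)
    also have "\<dots> = (if i = 0 then det W else 0)" unfolding adj(2) using i(1) d by simp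
    also have "e * det W * (if i = 0 then det W else 0) = (if i = 0 then of_int (poly_disc f) else 0)"
      using e by (auto simp: power2_eq_square mult.assoc)
    also have "i = 0 \<longleftrightarrow> (\<forall>x\<in>gen_field {\<alpha>}. \<sigma> x = x)"
    proof -
      have "i = 0 \<longleftrightarrow> \<rho> i = \<rho> 0"
        using \<rho>(1) i(1) d by (auto simp: bij_betw_def inj_on_def d_def)
      also have "\<dots> \<longleftrightarrow> \<sigma> \<alpha> = \<alpha>" unfolding i(2) \<rho>(2) by (rule refl)
      finally show ?thesis unfolding galois_fixes_gen_field_root[OF \<sigma>] .
    qed
    finally show "(\<Sum>(y, w)\<leftarrow>ps. y * \<sigma> w)
        = (if \<forall>x\<in>gen_field {\<alpha>}. \<sigma> x = x then of_int (poly_disc f) else 0)" .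
  qed
qed

end

section \<open>Linear disjointness\<close>

lemma separated_gen_field_Un:
  assumes "separated (gen_field S) d" "separated (gen_field T) e" "\<And>s. s \<in> S \<union> T \<Longrightarrow> algebraic s"
  shows "separated (gen_field (S \<union> T)) (d * e)"
proof (rule separated_compositum[OF assms(1,2) subfield_gen_field])
  have sub: "S \<union> T \<subseteq> gen_field (S \<union> T)" by (rule gen_field_superset)
  show "gen_field S \<subseteq> gen_field (S \<union> T)"
    by (rule gen_field_minimal[OF subfield_gen_field]) (use sub in auto)
  show "gen_field T \<subseteq> gen_field (S \<union> T)"
    by (rule gen_field_minimal[OF subfield_gen_field]) (use sub in auto)
  fix \<sigma> x assume \<sigma>: "\<sigma> \<in> galois" and fixed: "\<And>x. x \<in> gen_field S \<union> gen_field T \<Longrightarrow> \<sigma> x = x"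
    and x: "x \<in> gen_field (S \<union> T)"
  show "\<sigma> x = x"
  proof (rule galois_eq_on_gen_field[OF \<sigma> galois_id _ x])
    fix s assume s: "s \<in> S \<union> T"
    thus "algebraic s \<and> \<sigma> s = s"
      using assms(3) fixed[of s] gen_field_superset[of S] gen_field_superset[of T] by auto
  qed
qed

lemma gen_field_empty: "gen_field {} = \<rat>"
  using gen_field_minimal[OF subfield_Rats, of "{}"] Rats_subset_subfield[OF subfield_gen_field, of "{}"] by auto

text \<open>A multiple of \<open>h\<close> by a common denominator is an integer polynomial with
  root \<alpha>, hence a multiple of \<open>f\<close>.\<close>

lemma (in irreducible_root) degree_le_if_rational_root:
  assumes h: "coeffs_in \<rat> h" "h \<noteq> 0" "poly h \<alpha> = 0"
  shows "degree f \<le> degree h"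
proof -
  have "\<exists>N::int. N \<noteq> 0 \<and> (\<forall>i. coeff (smult (of_int N) h) i \<in> \<int>)" using h(1)
  proof (induction h)
    case 0
    show ?case by (rule exI[of _ 1]) simp
  next
    case (pCons a h)
    have ah: "a \<in> \<rat>" "coeffs_in \<rat> h"
      using pCons.prems unfolding coeffs_in_pCons[OF subfield_Rats] by blast+
    from pCons.IH[OF ah(2)] obtain N :: int where
      N': "N \<noteq> 0 \<and> (\<forall>i. coeff (smult (of_int N) h) i \<in> \<int>)" ..
    note N = conjunct1[OF N'] conjunct2[OF N', rule_format]
    from ah(1) obtain p q :: int where pq': "q > 0" "Rings.coprime p q" "a = of_int p / of_int q"
      by (rule Rats_cases')
    have pq: "a = of_int p / of_int q" "q \<noteq> 0" using pq' by auto
    have "coeff (smult (of_int (N * q)) (pCons a h)) i \<in> \<int>" for i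
    proof (cases i)
      case 0
      have "of_int (N * q) * a = (of_int (N * p) :: complex)" using pq by simp
      thus ?thesis using 0 by (simp only: coeff_smult coeff_pCons_0 Ints_of_int)
    next
      case (Suc j)
      have "coeff (smult (of_int (N * q)) (pCons a h)) i = of_int q * coeff (smult (of_int N) h) j"
        by (simp add: Suc)
      also have "\<dots> \<in> \<int>" by (intro Ints_mult N) auto
      finally show ?thesis .
    qed
    moreover have "N * q \<noteq> 0" using N(1) pq(2) by simp
    ultimately show ?case by blast
  qed
  then obtain N :: int where N': "N \<noteq> 0 \<and> (\<forall>i. coeff (smult (of_int N) h) i \<in> \<int>)" ..
  note N = conjunct1[OF N'] conjunct2[OF N', rule_format]
  define g where "g = map_poly (\<lambda>x. \<lfloor>Re x\<rfloor>) (smult (of_int N) h)"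
  have floor: "of_int \<lfloor>Re x\<rfloor> = x" if "x \<in> \<int>" for x :: complex
    using that by (rule Ints_cases) simp
  have g: "map_poly of_int g = smult (of_int N) h"
  proof (rule poly_eqI)
    fix i
    have "coeff (map_poly of_int g) i = complex_of_int \<lfloor>Re (coeff (smult (of_int N) h) i)\<rfloor>"
      unfolding g_def by (simp only: coeff_map_poly of_int_0 zero_complex.sel floor_zero)
    also have "\<dots> = coeff (smult (of_int N) h) i" by (rule floor[OF N(2)])
    finally show "coeff (map_poly of_int g) i = coeff (smult (of_int N) h) i" .
  qed
  have "poly (map_poly of_int g) \<alpha> = 0" unfolding g using h(3) by simp
  hence "f dvd g" by (rule int_poly_dvd_if_common_root[OF irr root])
  moreover have "g \<noteq> 0" using g h(2) N(1) by auto
  ultimately have "degree f \<le> degree g" by (rule dvd_imp_degree_le)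
  also have "degree g = degree (map_poly of_int g :: complex poly)" by simp
  also have "\<dots> = degree h" unfolding g using N(1) by simp
  finally show ?thesis .
qed

lemma galois_coeff_prod:
  assumes \<sigma>: "\<sigma> \<in> galois" and S: "finite S" "\<And>s. s \<in> S \<Longrightarrow> algebraic s"
  shows "\<sigma> (coeff (\<Prod>s\<in>S. [:- s, 1:]) j) = coeff (\<Prod>s\<in>S. [:- \<sigma> s, 1:]) j"
    and "algebraic (coeff (\<Prod>s\<in>S. [:- s, 1:]) j)"
proof -
  have "\<sigma> (coeff (\<Prod>s\<in>S. [:- s, 1:]) j) = coeff (\<Prod>s\<in>S. [:- \<sigma> s, 1:]) j
      \<and> algebraic (coeff (\<Prod>s\<in>S. [:- s, 1:]) j)" for j
    using S
  proof (induction S arbitrary: j rule: finite_induct)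
    case empty
    show ?case using galois_0[OF \<sigma>] galois_1[OF \<sigma>] by (auto simp: coeff_1 algebraic_rat)
  next
    case (insert s S)
    define P where "P = (\<Prod>s\<in>S. [:- s, 1:])"
    define P' where "P' = (\<Prod>s\<in>S. [:- \<sigma> s, 1:])"
    have IH': "\<sigma> (coeff P j) = coeff P' j \<and> algebraic (coeff P j)" for j
      unfolding P_def P'_def
    proof (rule insert.IH)
      show "algebraic t" if "t \<in> S" for t using insert.prems[of t] that by simp
    qed
    note IH = IH'[THEN conjunct1] IH'[THEN conjunct2]
    have s: "algebraic s" using insert.prems[of s] by simp
    have sP: "algebraic (s * coeff P j)" "\<sigma> (s * coeff P j) = \<sigma> s * coeff P' j" for j
      by (rule algebraic_mult[OF s IH(2)], simp only: galois_mult[OF \<sigma> s IH(2)] IH(1))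
    have "\<sigma> (coeff ([:- s, 1:] * P) j) = coeff ([:- \<sigma> s, 1:] * P') j \<and> algebraic (coeff ([:- s, 1:] * P) j)"
    proof (cases j)
      case 0
      have "\<sigma> (- (s * coeff P 0)) = - (\<sigma> s * coeff P' 0)" using galois_uminus[OF \<sigma> sP(1)[of 0]] sP(2)[of 0] by simp
      moreover have "algebraic (- (s * coeff P 0))" using sP(1)[of 0] by simp
      ultimately show ?thesis using 0 by simp
    next
      case (Suc k)
      have "\<sigma> (coeff P k - s * coeff P j) = coeff P' k - \<sigma> s * coeff P' j"
        using galois_diff[OF \<sigma> IH(2)[of k] sP(1)[of j]] sP(2)[of j] IH(1)[of k] by simp
      moreover have "algebraic (coeff P k - s * coeff P j)" by (rule algebraic_diff[OF IH(2) sP(1)])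
      ultimately show ?thesis using Suc by simp
    qed
    thus ?case unfolding prod.insert[OF insert.hyps(1,2)] P_def P'_def .
  qed
  thus "\<sigma> (coeff (\<Prod>s\<in>S. [:- s, 1:]) j) = coeff (\<Prod>s\<in>S. [:- \<sigma> s, 1:]) j"
    "algebraic (coeff (\<Prod>s\<in>S. [:- s, 1:]) j)" by blast+
qed

lemma coeffs_in_prod:
  assumes "is_subfield K" "S \<subseteq> K"
  shows "coeffs_in K (\<Prod>s\<in>S. [:- s, 1:])"
  using assms(2)
proof (induction S rule: infinite_finite_induct)
  case (insert s S)
  have "s \<in> K" "S \<subseteq> K" using insert.prems by auto
  hence "coeffs_in K [:- s, 1:]" unfolding coeffs_in_pCons[OF assms(1)]
    by (intro conjI subfield_uminus[OF assms(1)] subfield_1[OF assms(1)] coeffs_in_0[OF assms(1)])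
  from coeffs_in_mult[OF assms(1) this insert.IH[OF \<open>S \<subseteq> K\<close>]]
  show ?case unfolding prod.insert[OF insert.hyps(1,2)] .
qed (auto simp: coeffs_in_1[OF assms(1)])

section \<open>Polynomials with pairwise coprime discriminants\<close>

locale coprime_roots =
  fixes r :: nat and f :: "nat \<Rightarrow> int poly" and \<alpha> :: "nat \<Rightarrow> complex"
  assumes root_i: "\<And>i. i < r \<Longrightarrow> irreducible_root (f i) (\<alpha> i)"
    and disc_coprime: "\<And>i j. i < r \<Longrightarrow> j < r \<Longrightarrow> i \<noteq> j \<Longrightarrow> coprime (poly_disc (f i)) (poly_disc (f j))"
begin

definition Zs :: "nat \<Rightarrow> complex set" where "Zs i = irreducible_root.Z (f i)"

lemma root_Zs:
  assumes "i < r" "z \<in> Zs i"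
  shows "irreducible_root (f i) z"
  using root_i[OF assms(1)] assms(2)
  by (auto simp: irreducible_root_def Zs_def irreducible_root.Z_def[OF root_i[OF assms(1)]])

lemma alpha_algebraic: "i < r \<Longrightarrow> algebraic (\<alpha> i)"
  using irreducible_root.Z_algebraic[OF root_i] irreducible_root.alpha_Z[OF root_i] by blast

lemma Zs_algebraic: "i < r \<Longrightarrow> z \<in> Zs i \<Longrightarrow> algebraic z"
  using irreducible_root.Z_algebraic[OF root_i] by (auto simp: Zs_def)

lemma separated_alphas:
  assumes "k \<le> r"
  shows "separated (gen_field (\<alpha> ` {..<k})) (\<Prod>i<k. poly_disc (f i))"
  using assms
proof (induction k)
  case 0
  thus ?case by (simp add: gen_field_empty separated_Rats)
next
  case (Suc k)
  have "separated (gen_field (\<alpha> ` {..<k} \<union> {\<alpha> k})) ((\<Prod>i<k. poly_disc (f i)) * poly_disc (f k))"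
  proof (rule separated_gen_field_Un)
    show "separated (gen_field (\<alpha> ` {..<k})) (\<Prod>i<k. poly_disc (f i))"
      by (rule Suc.IH) (use Suc.prems in simp)
    show "separated (gen_field {\<alpha> k}) (poly_disc (f k))"
      by (rule irreducible_root.separated_root[OF root_i]) (use Suc.prems in simp)
    fix s assume "s \<in> \<alpha> ` {..<k} \<union> {\<alpha> k}"
    thus "algebraic s" using Suc.prems alpha_algebraic by auto
  qed
  moreover have "\<alpha> ` {..<k} \<union> {\<alpha> k} = \<alpha> ` {..<Suc k}" by (auto simp: lessThan_Suc)
  ultimately show ?case by (simp only: prod.lessThan_Suc)
qed

text \<open>All roots of one polynomial come with the same discriminant as factor, so adjoining them
  one after another produces a power of it and no new prime.\<close>

lemma separated_all_roots:
  assumes k: "k < r" and S: "finite S" "S \<subseteq> Zs k"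
  shows "separated (gen_field S) (poly_disc (f k) ^ card S)"
  using S
proof (induction S rule: finite_induct)
  case empty
  thus ?case by (simp add: gen_field_empty separated_Rats)
next
  case (insert s S)
  have "separated (gen_field (S \<union> {s})) (poly_disc (f k) ^ card S * poly_disc (f k))"
  proof (rule separated_gen_field_Un)
    show "separated (gen_field S) (poly_disc (f k) ^ card S)"
      by (rule insert.IH) (use insert.prems in simp)
    show "separated (gen_field {s}) (poly_disc (f k))"
      by (rule irreducible_root.separated_root[OF root_Zs[OF k]]) (use insert.prems in simp)
    fix t assume "t \<in> S \<union> {s}"
    thus "algebraic t" using insert.prems Zs_algebraic[OF k, of t] by auto
  qed
  moreover have "S \<union> {s} = insert s S" by simp
  ultimately show ?case using insert.hyps by (simp add: mult.commute)
qed

lemma intersection_rational: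
  assumes k: "k < r"
  shows "gen_field (\<alpha> ` {..<k}) \<inter> gen_field (Zs k) = \<rat>"
proof -
  interpret ir: irreducible_root "f k" "\<alpha> k" by (rule root_i[OF k])
  have fin: "finite (Zs k)" using ir.finite_Z by (simp add: Zs_def)
  let ?K = "gen_field (\<alpha> ` {..<k})" and ?E = "gen_field (Zs k)"
  have K: "alg_field ?K" by (rule alg_field_gen_field) (use k in \<open>auto intro: alpha_algebraic\<close>)
  have E: "alg_field ?E" by (rule alg_field_gen_field) (use fin k in \<open>auto intro: Zs_algebraic\<close>)
  have I: "is_subfield (?K \<inter> ?E)" by (intro subfield_Int subfield_gen_field)
  have "separated (?K \<inter> ?E) (\<Prod>i<k. poly_disc (f i))"
    by (rule separated_subfield[OF K separated_alphas I]) (use k in auto)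
  moreover have "separated (?K \<inter> ?E) (poly_disc (f k) ^ card (Zs k))"
    by (rule separated_subfield[OF E separated_all_roots[OF k fin subset_refl] I]) auto
  moreover have "coprime (\<Prod>i<k. poly_disc (f i)) (poly_disc (f k) ^ card (Zs k))"
  proof -
    have "coprime (\<Prod>i<k. poly_disc (f i)) (poly_disc (f k))"
      by (rule prod_coprime_left) (use k in \<open>auto intro: disc_coprime\<close>)
    thus ?thesis by simp
  qed
  ultimately have "separated (?K \<inter> ?E) 1" by (rule separated_coprime)
  thus ?thesis using unramified_imp_Rats[OF alg_field_subset[OF K I]] by auto
qed

text \<open>\<open>B\<close> is the orbit of \<alpha> k under the automorphisms that fix the earlier
  field, and \<open>h\<close> has \<open>B\<close> as its set of roots. The coefficients of
  \<open>h\<close> are fixed by these automorphisms and lie in the field of all roots, so they are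
  rational by \<open>intersection_rational\<close>; hence \<open>B\<close> has at least
  \<open>degree (f k)\<close> elements and contains all roots.\<close>

lemma orbit_full:
  assumes k: "k < r" and z: "z \<in> Zs k"
  shows "\<exists>\<sigma>\<in>galois. (\<forall>i<k. \<sigma> (\<alpha> i) = \<alpha> i) \<and> \<sigma> (\<alpha> k) = z"
proof -
  interpret ir: irreducible_root "f k" "\<alpha> k" by (rule root_i[OF k])
  have Zk: "Zs k = ir.Z" by (simp add: Zs_def)
  let ?K = "gen_field (\<alpha> ` {..<k})"
  define G where "G = {\<sigma> \<in> galois. \<forall>x\<in>?K. \<sigma> x = x}"
  define B where "B = (\<lambda>\<sigma>. \<sigma> (\<alpha> k)) ` G"
  have BZ: "B \<subseteq> ir.Z" unfolding B_def G_def using ir.galois_Z ir.alpha_Z by auto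
  have finB: "finite B" using BZ ir.finite_Z finite_subset by blast
  have algB: "algebraic b" if "b \<in> B" for b using that BZ ir.Z_algebraic by blast
  have KA: "algebraic x" if "x \<in> ?K" for x
    by (rule gen_field_algebraic[OF _ that]) (use k in \<open>auto intro: alpha_algebraic\<close>)
  define h where "h = (\<Prod>b\<in>B. [:- b, 1:])"
  have in_E: "coeffs_in (gen_field (Zs k)) h"
    unfolding h_def using BZ gen_field_superset[of "Zs k"] Zk
    by (intro coeffs_in_prod subfield_gen_field) auto
  have in_K: "coeff h j \<in> ?K" for j
  proof (rule in_subfield_if_galois_fixed[OF subfield_gen_field KA])
    show "algebraic (coeff h j)" unfolding h_def by (rule galois_coeff_prod(2)[OF galois_id finB algB])
    fix \<sigma> assume \<sigma>: "\<sigma> \<in> galois" and fixed: "\<And>e. e \<in> ?K \<Longrightarrow> \<sigma> e = e"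
    have "\<sigma> ` B \<subseteq> B"
    proof
      fix x assume "x \<in> \<sigma> ` B"
      then obtain \<tau> where \<tau>: "\<tau> \<in> G" "x = \<sigma> (\<tau> (\<alpha> k))" by (auto simp: B_def)
      have "(\<lambda>x. \<sigma> (\<tau> x)) \<in> G" using \<tau>(1) galois_comp[OF \<sigma>] fixed by (auto simp: G_def)
      thus "x \<in> B" using \<tau>(2) by (auto simp: B_def)
    qed
    moreover have inj: "inj_on \<sigma> B" by (rule inj_onI, rule galois_inj[OF \<sigma>]) (auto intro: algB)
    ultimately have "\<sigma> ` B = B" using finB by (simp add: endo_inj_surj)
    moreover have "(\<Prod>b\<in>\<sigma> ` B. [:- b, 1:]) = (\<Prod>b\<in>B. [:- \<sigma> b, 1:])"
      by (simp only: prod.reindex[OF inj] o_def)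
    ultimately have eq: "(\<Prod>b\<in>B. [:- \<sigma> b, 1:]) = h" unfolding h_def by (simp only:)
    have "\<sigma> (coeff h j) = coeff (\<Prod>b\<in>B. [:- \<sigma> b, 1:]) j"
      unfolding h_def by (rule galois_coeff_prod(1)[OF \<sigma> finB algB])
    thus "\<sigma> (coeff h j) = coeff h j" unfolding eq .
  qed
  have rat: "coeffs_in \<rat> h" unfolding coeffs_in_def intersection_rational[OF k, symmetric]
    using in_E in_K by (auto simp: coeffs_in_def)
  have "(\<lambda>x. x) \<in> G" using galois_id by (auto simp: G_def)
  hence "\<alpha> k \<in> B" by (auto simp: B_def image_iff)
  hence "poly h (\<alpha> k) = 0" unfolding h_def using finB by (auto simp: poly_prod)
  moreover have "h \<noteq> 0" unfolding h_def using finB by auto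
  ultimately have "degree (f k) \<le> degree h" using ir.degree_le_if_rational_root[OF rat] by blast
  also have "degree h = card B" unfolding h_def by (subst degree_prod_eq_sum_degree) auto
  finally have "card ir.Z \<le> card B" using ir.card_Z by simp
  hence "B = ir.Z" using BZ ir.finite_Z by (simp add: card_seteq)
  hence "z \<in> B" using z Zk by simp
  then obtain \<sigma> where \<sigma>: "\<sigma> \<in> G" "\<sigma> (\<alpha> k) = z" by (auto simp: B_def)
  moreover have "\<sigma> (\<alpha> i) = \<alpha> i" if "i < k" for i
    using \<sigma>(1) that gen_field_superset[of "\<alpha> ` {..<k}"] by (auto simp: G_def)
  ultimately show ?thesis by (auto simp: G_def)
qed

text \<open>If g realises the first k values, \<open>orbit_full\<close> gives an h that fixes the
  earlier roots and takes the next one to the preimage of its target under g; g after h realises k +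
  1 values.\<close>

lemma galois_transitive:
  assumes "k \<le> r" "\<And>i. i < k \<Longrightarrow> t i \<in> Zs i"
  shows "\<exists>\<sigma>\<in>galois. \<forall>i<k. \<sigma> (\<alpha> i) = t i"
  using assms
proof (induction k)
  case 0
  show ?case using galois_id by blast
next
  case (Suc k)
  hence k: "k < r" by simp
  interpret ir: irreducible_root "f k" "\<alpha> k" by (rule root_i[OF k])
  have "\<exists>\<sigma>\<in>galois. \<forall>i<k. \<sigma> (\<alpha> i) = t i" by (rule Suc.IH) (use Suc.prems in auto)
  then obtain g where g: "g \<in> galois" "\<And>i. i < k \<Longrightarrow> g (\<alpha> i) = t i" by blast
  obtain g' where g': "g' \<in> galois" "\<And>x. algebraic x \<Longrightarrow> g' (g x) = x" "\<And>x. algebraic x \<Longrightarrow> g (g' x) = x"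
    by (rule galois_inv[OF g(1)]) blast
  have tk: "t k \<in> ir.Z" using Suc.prems(2)[of k] by (simp add: Zs_def)
  hence "g' (t k) \<in> Zs k" using ir.galois_Z[OF g'(1)] by (simp add: Zs_def)
  then obtain h where h: "h \<in> galois" "\<forall>i<k. h (\<alpha> i) = \<alpha> i" "h (\<alpha> k) = g' (t k)"
    using orbit_full[OF k] by blast
  have "g (h (\<alpha> i)) = t i" if "i < Suc k" for i
    using that h g(2) g'(3)[OF ir.Z_algebraic[OF tk]] by (cases "i = k") auto
  thus ?case using galois_comp[OF g(1) h(1)] by (intro bexI[of _ "\<lambda>x. g (h x)"]) auto
qed

definition L :: "complex set" where "L = gen_field (\<alpha> ` {..<r})"

lemma alg_field_L: "alg_field L"
  unfolding L_def by (rule alg_field_gen_field) (auto intro: alpha_algebraic)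

lemma alpha_L: "i < r \<Longrightarrow> \<alpha> i \<in> L"
  unfolding L_def using gen_field_superset[of "\<alpha> ` {..<r}"] by auto

text \<open>Linear disjointness in the form that is used: the conjugates of the \<alpha> i can be
  prescribed independently of each other, and they determine the embedding.\<close>

lemma embeddings_grid: "bij_betw (\<lambda>u. \<lambda>i\<in>{..<r}. u (\<alpha> i)) (embeddings L) (PiE {..<r} Zs)"
proof (rule bij_betw_imageI)
  show "inj_on (\<lambda>u. \<lambda>i\<in>{..<r}. u (\<alpha> i)) (embeddings L)"
  proof (rule inj_onI)
    fix u v assume u: "u \<in> embeddings L" and v: "v \<in> embeddings L"
      and eq: "(\<lambda>i\<in>{..<r}. u (\<alpha> i)) = (\<lambda>i\<in>{..<r}. v (\<alpha> i))"
    obtain \<sigma> where \<sigma>: "\<sigma> \<in> galois" "\<And>x. x \<in> L \<Longrightarrow> u x = \<sigma> x" by (rule embedding_galois[OF u]) blast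
    obtain \<tau> where \<tau>: "\<tau> \<in> galois" "\<And>x. x \<in> L \<Longrightarrow> v x = \<tau> x" by (rule embedding_galois[OF v]) blast
    have "\<sigma> (\<alpha> i) = \<tau> (\<alpha> i)" if "i < r" for i
      using fun_cong[OF eq, of i] that \<sigma>(2) \<tau>(2) alpha_L by auto
    hence "\<sigma> x = \<tau> x" if "x \<in> L" for x
      by (intro galois_eq_on_gen_field[OF \<sigma>(1) \<tau>(1) _ that[unfolded L_def]]) (auto intro: alpha_algebraic)
    thus "u = v" using \<sigma>(2) \<tau>(2) by (intro alg_field.embedding_ext[OF alg_field_L u v]) auto
  qed
  show "(\<lambda>u. \<lambda>i\<in>{..<r}. u (\<alpha> i)) ` embeddings L = PiE {..<r} Zs"
  proof (intro equalityI subsetI)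
    fix t assume "t \<in> (\<lambda>u. \<lambda>i\<in>{..<r}. u (\<alpha> i)) ` embeddings L"
    then obtain \<sigma> where \<sigma>: "\<sigma> \<in> galois" "t = (\<lambda>i\<in>{..<r}. restrict \<sigma> L (\<alpha> i))" by (auto simp: embeddings_def)
    have "\<sigma> (\<alpha> i) \<in> Zs i" if "i < r" for i
      using irreducible_root.galois_Z[OF root_i[OF that] \<sigma>(1)] irreducible_root.alpha_Z[OF root_i[OF that]]
      by (simp add: Zs_def)
    thus "t \<in> PiE {..<r} Zs" using \<sigma>(2) alpha_L by auto
  next
    fix t assume t: "t \<in> PiE {..<r} Zs"
    then obtain \<sigma> where \<sigma>: "\<sigma> \<in> galois" "\<And>i. i < r \<Longrightarrow> \<sigma> (\<alpha> i) = t i"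
      using galois_transitive[of r t] by auto
    have "t = (\<lambda>i\<in>{..<r}. restrict \<sigma> L (\<alpha> i))"
      using t \<sigma>(2) alpha_L by (auto simp: fun_eq_iff PiE_def extensional_def)
    moreover have "restrict \<sigma> L \<in> embeddings L" using \<sigma>(1) unfolding embeddings_def by (rule imageI)
    ultimately show "t \<in> (\<lambda>u. \<lambda>i\<in>{..<r}. u (\<alpha> i)) ` embeddings L"
      by (rule image_eqI[of t "\<lambda>u. \<lambda>i\<in>{..<r}. u (\<alpha> i)" "restrict \<sigma> L"])
  qed
qed

text \<open>By \<open>embeddings_grid\<close> the left side runs over all tuples of roots, so the
  trace of a product of functions of single roots splits.\<close>

lemma sum_embeddings_prod:
  "(\<Sum>u\<in>embeddings L. \<Prod>i<r. \<Phi> i (u (\<alpha> i))) = (\<Prod>i<r. \<Sum>z\<in>Zs i. \<Phi> i z :: complex)"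
proof -
  have fin: "finite (Zs i)" if "i < r" for i
    using irreducible_root.finite_Z[OF root_i[OF that]] by (simp add: Zs_def)
  have "(\<Sum>u\<in>embeddings L. \<Prod>i<r. \<Phi> i (u (\<alpha> i)))
      = (\<Sum>u\<in>embeddings L. \<Prod>i<r. \<Phi> i ((\<lambda>i\<in>{..<r}. u (\<alpha> i)) i))"
    by (intro sum.cong prod.cong refl) auto
  also have "\<dots> = (\<Sum>t\<in>PiE {..<r} Zs. \<Prod>i<r. \<Phi> i (t i))"
    by (rule sum.reindex_bij_betw[OF embeddings_grid, of "\<lambda>t. \<Prod>i<r. \<Phi> i (t i)"])
  also have "\<dots> = (\<Prod>i<r. \<Sum>z\<in>Zs i. \<Phi> i z)"
    by (rule prod_sum_PiE[symmetric]) (auto intro: fin)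
  finally show ?thesis .
qed

end

section \<open>Quotients of subrings of the complex numbers\<close>

lemma subring_C_sel [simp]:
  "carrier (subring_C A) = A" "x \<otimes>\<^bsub>subring_C A\<^esub> y = x * y" "\<one>\<^bsub>subring_C A\<^esub> = 1"
  "\<zero>\<^bsub>subring_C A\<^esub> = 0" "x \<oplus>\<^bsub>subring_C A\<^esub> y = x + y"
  by (simp_all add: subring_C_def)

locale complex_subring =
  fixes A :: "complex set"
  assumes one_mem: "1 \<in> A" and uminus_mem: "x \<in> A \<Longrightarrow> - x \<in> A"
    and add_mem: "x \<in> A \<Longrightarrow> y \<in> A \<Longrightarrow> x + y \<in> A"
    and mult_mem: "x \<in> A \<Longrightarrow> y \<in> A \<Longrightarrow> x * y \<in> A"
begin

lemma zero_mem: "0 \<in> A"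
  using add_mem[OF one_mem uminus_mem[OF one_mem]] by simp

lemma diff_mem: "x \<in> A \<Longrightarrow> y \<in> A \<Longrightarrow> x - y \<in> A"
  using add_mem[of x "- y"] uminus_mem by simp

lemma of_nat_mem: "of_nat n \<in> A"
  by (induction n) (auto simp: zero_mem one_mem add_mem)

lemma of_int_mem: "of_int k \<in> A"
  by (cases k rule: int_cases2) (auto simp: of_nat_mem uminus_mem)

lemma power_mem: "x \<in> A \<Longrightarrow> x ^ n \<in> A"
  by (induction n) (auto simp: one_mem mult_mem)

lemma sum_mem: "(\<And>i. i \<in> I \<Longrightarrow> g i \<in> A) \<Longrightarrow> sum g I \<in> A"
  by (induction I rule: infinite_finite_induct) (auto simp: zero_mem add_mem)

lemma prod_mem: "(\<And>i. i \<in> I \<Longrightarrow> g i \<in> A) \<Longrightarrow> prod g I \<in> A"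
  by (induction I rule: infinite_finite_induct) (auto simp: one_mem mult_mem)

lemma poly_mem: "x \<in> A \<Longrightarrow> poly (map_poly of_int p) x \<in> A"
  unfolding poly_altdef by (intro sum_mem mult_mem power_mem) (auto simp: coeff_map_poly of_int_mem)

lemma cring: "cring (subring_C A)"
proof (rule cringI)
  show "abelian_group (subring_C A)"
  proof (rule abelian_groupI)
    fix x assume "x \<in> carrier (subring_C A)"
    thus "\<exists>y\<in>carrier (subring_C A). y \<oplus>\<^bsub>subring_C A\<^esub> x = \<zero>\<^bsub>subring_C A\<^esub>"
      using uminus_mem by (intro bexI[of _ "- x"]) auto
  qed (auto simp: add_mem zero_mem)
  show "Group.comm_monoid (subring_C A)"
    by (rule comm_monoidI) (auto simp: mult_mem one_mem)
qed (auto simp: distrib_right)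

lemma ring: "ring (subring_C A)"
  using cring by (rule cring.axioms(1))

lemma idealD:
  assumes "ideal I (subring_C A)"
  shows "I \<subseteq> A" "0 \<in> I" "x \<in> I \<Longrightarrow> y \<in> I \<Longrightarrow> x + y \<in> I" "a \<in> A \<Longrightarrow> x \<in> I \<Longrightarrow> a * x \<in> I"
    "x \<in> I \<Longrightarrow> - x \<in> I" "x \<in> I \<Longrightarrow> y \<in> I \<Longrightarrow> x - y \<in> I"
proof -
  interpret ideal I "subring_C A" by (rule assms)
  show "I \<subseteq> A" using a_subset by simp
  show "0 \<in> I" using additive_subgroup.zero_closed[OF ideal.axioms(1)[OF assms]] by simp
  show add: "x + y \<in> I" if "x \<in> I" "y \<in> I" for x y using additive_subgroup.a_closed[OF ideal.axioms(1)[OF assms] that] by simp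
  show mult: "a * x \<in> I" if "a \<in> A" "x \<in> I" for a x using I_l_closed[OF that(2), of a] that(1) by simp
  show um: "- x \<in> I" if "x \<in> I" for x using mult[OF uminus_mem[OF one_mem] that] by simp
  show "x - y \<in> I" if "x \<in> I" "y \<in> I" for x y using add[OF that(1) um[OF that(2)]] by simp
qed

lemma idealI_C:
  assumes "I \<subseteq> A" "0 \<in> I" "\<And>x y. x \<in> I \<Longrightarrow> y \<in> I \<Longrightarrow> x + y \<in> I"
    "\<And>a x. a \<in> A \<Longrightarrow> x \<in> I \<Longrightarrow> a * x \<in> I"
  shows "ideal I (subring_C A)"
proof (rule idealI[OF ring])
  show "subgroup I (add_monoid (subring_C A))"
  proof (rule subgroup.intro)
    fix x assume x: "x \<in> I"
    have "inv\<^bsub>add_monoid (subring_C A)\<^esub> x = - x"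
    proof (rule group.inv_equality)
      show "group (add_monoid (subring_C A))"
        using ring.axioms(1)[OF ring] abelian_group.a_group by blast
    qed (use x assms(1) uminus_mem in auto)
    moreover have "(- 1) * x \<in> I" using x by (intro assms(4) uminus_mem one_mem)
    ultimately show "inv\<^bsub>add_monoid (subring_C A)\<^esub> x \<in> I" by simp
  qed (use assms(1-3) in auto)
  fix a x assume "a \<in> I" "x \<in> carrier (subring_C A)"
  thus "x \<otimes>\<^bsub>subring_C A\<^esub> a \<in> I" "a \<otimes>\<^bsub>subring_C A\<^esub> x \<in> I"
    using assms(4)[of x a] by (auto simp: mult.commute)
qed

lemma coset_eq: "I +>\<^bsub>subring_C A\<^esub> x = (\<lambda>h. h + x) ` I"
  by (auto simp: a_r_coset_def')

lemma carrier_quot: "carrier (subring_C A Quot I) = (\<lambda>x. I +>\<^bsub>subring_C A\<^esub> x) ` A"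
  by (auto simp: FactRing_def A_RCOSETS_def')

lemma coset_eq_iff:
  assumes I: "ideal I (subring_C A)"
  shows "I +>\<^bsub>subring_C A\<^esub> x = I +>\<^bsub>subring_C A\<^esub> y \<longleftrightarrow> x - y \<in> I"
proof
  assume eq: "I +>\<^bsub>subring_C A\<^esub> x = I +>\<^bsub>subring_C A\<^esub> y"
  have "0 + x \<in> I +>\<^bsub>subring_C A\<^esub> x" unfolding coset_eq using idealD(2)[OF I] by (rule imageI)
  then obtain h where "h \<in> I" "x = h + y" unfolding eq unfolding coset_eq by auto
  thus "x - y \<in> I" by simp
next
  assume xy: "x - y \<in> I"
  show "I +>\<^bsub>subring_C A\<^esub> x = I +>\<^bsub>subring_C A\<^esub> y" unfolding coset_eq
  proof (intro equalityI subsetI)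
    fix z assume "z \<in> (\<lambda>h. h + x) ` I"
    then obtain h where h: "h \<in> I" "z = h + x" by auto
    show "z \<in> (\<lambda>h. h + y) ` I"
      by (rule image_eqI[of _ _ "h + (x - y)"]) (use h xy idealD(3)[OF I] in auto)
  next
    fix z assume "z \<in> (\<lambda>h. h + y) ` I"
    then obtain h where h: "h \<in> I" "z = h + y" by auto
    show "z \<in> (\<lambda>h. h + x) ` I"
      by (rule image_eqI[of _ _ "h - (x - y)"]) (use h xy idealD(6)[OF I] in auto)
  qed
qed

end

text \<open>Says that the integers induce an isomorphism from Z/m onto A/I. For ideals of R it
  replaces the isomorphism and cardinality conditions of \<open>S_eta\<close>.\<close>

definition integers_mod :: "complex set \<Rightarrow> complex set \<Rightarrow> nat \<Rightarrow> bool" where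
  "integers_mod A I m \<longleftrightarrow> (\<forall>x\<in>A. \<exists>k::int. x - of_int k \<in> I) \<and> (\<forall>k::int. of_int k \<in> I \<longleftrightarrow> int m dvd k)"

lemma (in complex_subring) card_quot_integers_mod:
  assumes I: "ideal I (subring_C A)" and mod: "integers_mod A I m" and m: "m > 0"
  shows "card (carrier (subring_C A Quot I)) = m"
proof -
  let ?c = "\<lambda>k::int. I +>\<^bsub>subring_C A\<^esub> of_int k"
  have eq: "?c k = ?c l \<longleftrightarrow> int m dvd k - l" for k l
  proof -
    have "of_int (k - l) \<in> I \<longleftrightarrow> int m dvd k - l" using mod unfolding integers_mod_def by blast
    thus ?thesis unfolding coset_eq_iff[OF I] by (simp only: of_int_diff)
  qed
  have "?c ` {0..<int m} = carrier (subring_C A Quot I)"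
  proof (intro equalityI subsetI)
    fix C assume "C \<in> carrier (subring_C A Quot I)"
    then obtain x where x: "x \<in> A" "C = I +>\<^bsub>subring_C A\<^esub> x" by (auto simp: carrier_quot)
    then obtain k :: int where k: "x - of_int k \<in> I" using mod by (auto simp: integers_mod_def)
    have "C = ?c k" using k x(2) coset_eq_iff[OF I] by blast
    also have "\<dots> = ?c (k mod int m)" unfolding eq minus_mod_eq_mult_div by (rule dvd_triv_left)
    finally show "C \<in> ?c ` {0..<int m}" using m by (intro image_eqI[of _ _ "k mod int m"]) auto
  qed (auto simp: carrier_quot of_int_mem)
  moreover have "inj_on ?c {0..<int m}"
  proof (rule inj_onI)
    fix k l assume kl: "k \<in> {0..<int m}" "l \<in> {0..<int m}" "?c k = ?c l"
    have "k mod int m = l mod int m" unfolding mod_eq_dvd_iff using kl(3) eq by blast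
    thus "k = l" using kl(1,2) by simp
  qed
  ultimately show ?thesis by (metis card_atLeastLessThan_int card_image diff_zero nat_int)
qed

lemma card_image_same_kernel:
  assumes "\<And>x y. x \<in> S \<Longrightarrow> y \<in> S \<Longrightarrow> f x = f y \<longleftrightarrow> g x = g y"
  shows "card (f ` S) = card (g ` S)"
proof (rule bij_betw_same_card)
  show "bij_betw (\<lambda>c. g (inv_into S f c)) (f ` S) (g ` S)"
  proof (rule bij_betw_imageI)
    have inv: "inv_into S f c \<in> S" "f (inv_into S f c) = c" if "c \<in> f ` S" for c
      using that by (auto intro: inv_into_into f_inv_into_f)
    show "inj_on (\<lambda>c. g (inv_into S f c)) (f ` S)"
      by (rule inj_onI) (metis assms inv)
    show "(\<lambda>c. g (inv_into S f c)) ` f ` S = g ` S"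
    proof (intro equalityI subsetI)
      fix y assume "y \<in> g ` S"
      then obtain x where x: "x \<in> S" "y = g x" by auto
      have "g (inv_into S f (f x)) = g x" using assms[of "inv_into S f (f x)" x] inv[of "f x"] x by auto
      thus "y \<in> (\<lambda>c. g (inv_into S f c)) ` f ` S" using x by (auto intro!: image_eqI[of _ _ "f x"])
    qed (use inv in auto)
  qed
qed

text \<open>Serves to turn a congruence between \<open>e ^ i\<close> and \<open>e ^ j\<close> into
  one between the inverse \<open>e\<close> of \<open>H\<close> and a power of \<open>H\<close>; it
  is applied to a positive integer \<open>H\<close>.\<close>

lemma power_mult_diff_if_inverse:
  fixes e H :: complex
  assumes He: "H * e = 1" and ij: "i < j"
  shows "(H ^ j * e) * (e ^ i - e ^ j) = H ^ (j - i - 1) - e"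
proof -
  have pow: "H ^ k * e ^ k = 1" for k
    using He by (metis power_mult_distrib power_one)
  define l where "l = j - i - 1"
  have l: "j = l + Suc i" using ij by (simp add: l_def)
  have "H ^ j * e * e ^ i = H ^ l * (H ^ Suc i * e ^ Suc i)"
    unfolding l power_add by (simp add: mult_ac)
  also have "\<dots> = H ^ l" using pow[of "Suc i"] by simp
  finally have 1: "H ^ j * e * e ^ i = H ^ l" .
  have "H ^ j * e * e ^ j = e * (H ^ j * e ^ j)" by (simp add: mult_ac)
  also have "\<dots> = e" using pow[of j] by simp
  finally have 2: "H ^ j * e * e ^ j = e" .
  show ?thesis using 1 2 by (simp add: right_diff_distrib l_def)
qed

text \<open>If the quotient is finite, some power of \<^term>\<open>x\<close> is congruent to one, so the inverse of \<^term>\<open>x\<close>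
  is congruent to a power of \<^term>\<open>x\<close>.\<close>

lemma (in complex_subring) integers_mod_if_card_quot:
  assumes I: "ideal I (subring_C A)" and \<eta>: "(\<eta>::nat) > 0" and Z: "Z_eta \<eta> \<subseteq> A" "complex_subring (Z_eta \<eta>)"
    and card: "card (carrier (subring_C A Quot I)) = n" "n > 0"
    and card': "card (carrier (subring_C (Z_eta \<eta>) Quot (I \<inter> Z_eta \<eta>))) = n"
  shows "integers_mod A I n"
proof -
  interpret Z: complex_subring "Z_eta \<eta>" by (rule Z(2))
  note I' = idealD[OF I]
  have IZ: "ideal (I \<inter> Z_eta \<eta>) (subring_C (Z_eta \<eta>))"
    by (rule Z.idealI_C) (use I' Z(1) Z.zero_mem Z.add_mem Z.mult_mem in auto)
  let ?c = "\<lambda>x. I +>\<^bsub>subring_C A\<^esub> x"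
  let ?d = "\<lambda>x. (I \<inter> Z_eta \<eta>) +>\<^bsub>subring_C (Z_eta \<eta>)\<^esub> x"
  have fin: "finite (?c ` A)" using card by (auto simp: carrier_quot intro: card_ge_0_finite)
  \<comment> \<open>Two elements of \<open>Z_eta\<close> are congruent modulo \<open>I\<close> iff
    they are so modulo its intersection with \<open>Z_eta\<close>. The image of \<open>Z_eta\<close>
    in the quotient therefore has n elements, which is everything.\<close>
  have "card (?c ` Z_eta \<eta>) = card (?d ` Z_eta \<eta>)"
    by (rule card_image_same_kernel) (auto simp: coset_eq_iff[OF I] Z.coset_eq_iff[OF IZ] Z.diff_mem)
  also have "\<dots> = card (?c ` A)" using card card' by (simp add: carrier_quot Z.carrier_quot)
  finally have surj: "?c ` Z_eta \<eta> = ?c ` A"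
    using Z(1) fin by (intro card_subset_eq) auto
  have repr: "\<exists>z\<in>Z_eta \<eta>. x - z \<in> I" if x: "x \<in> A" for x
  proof -
    have "?c x \<in> ?c ` Z_eta \<eta>" unfolding surj using x by (rule imageI)
    then obtain z where "z \<in> Z_eta \<eta>" "?c x = ?c z" by auto
    thus ?thesis using coset_eq_iff[OF I] by blast
  qed
  have pigeon: "\<exists>i j. i < j \<and> g i - g j \<in> I" if g: "\<And>i. g i \<in> A" for g :: "nat \<Rightarrow> complex"
  proof -
    have "range (\<lambda>i. ?c (g i)) \<subseteq> ?c ` A" using g by auto
    hence "finite (range (\<lambda>i. ?c (g i)))" using fin finite_subset by blast
    hence "\<not> inj (\<lambda>i. ?c (g i))" using finite_imageD infinite_UNIV_nat by blast
    then obtain i j where "i \<noteq> j" "?c (g i) = ?c (g j)" by (auto simp: inj_def)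
    hence "i \<noteq> j" "g i - g j \<in> I" "g j - g i \<in> I" using coset_eq_iff[OF I] by metis+
    thus ?thesis by (metis nat_neq_iff)
  qed
  have "\<exists>m::nat. m > 0 \<and> of_nat m \<in> I"
  proof -
    obtain i j :: nat where ij: "i < j" "of_nat i - of_nat j \<in> I" using pigeon[of of_nat] of_nat_mem by blast
    have "- (of_nat i - of_nat j) \<in> I" by (rule I'(5)[OF ij(2)])
    hence "of_nat (j - i) \<in> I" using ij(1) by (simp add: of_nat_diff)
    thus ?thesis using ij(1) by (intro exI[of _ "j - i"]) auto
  qed
  hence ex: "\<exists>m. 0 < m \<and> (of_nat m :: complex) \<in> I" .
  define m where "m = (LEAST m::nat. m > 0 \<and> (of_nat m :: complex) \<in> I)"
  have m: "m > 0" "of_nat m \<in> I" using LeastI_ex[OF ex] by (auto simp: m_def)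
  have dvd: "of_int k \<in> I \<longleftrightarrow> int m dvd k" for k
  proof
    assume k: "of_int k \<in> I"
    have "of_int (k div int m) * of_nat m \<in> I" by (rule I'(4)[OF of_int_mem m(2)])
    hence "of_int k - of_int (k div int m) * of_nat m \<in> I" by (rule I'(6)[OF k])
    moreover have "k mod int m = k - (k div int m) * int m" by (simp add: minus_div_mult_eq_mod)
    ultimately have "of_int (k mod int m) \<in> I" by (metis of_int_diff of_int_mult of_int_of_nat_eq)
    moreover have r: "0 \<le> k mod int m" "k mod int m < int m" using m(1) by auto
    moreover have "of_nat (nat (k mod int m)) = (of_int (k mod int m) :: complex)" using r by simp
    ultimately have "\<not> 0 < nat (k mod int m)"
      using not_less_Least[of "nat (k mod int m)" "\<lambda>m. m > 0 \<and> (of_nat m :: complex) \<in> I"]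
      by (auto simp: m_def[symmetric] simp del: of_nat_nat)
    thus "int m dvd k" using r by (auto simp: dvd_eq_mod_eq_0)
  next
    assume "int m dvd k"
    then obtain l where "k = int m * l" by (elim dvdE)
    thus "of_int k \<in> I" using I'(4)[OF of_int_mem m(2), of l] by (simp add: mult.commute)
  qed
  \<comment> \<open>The elements congruent to an integer; they are closed under products. Once
    1/\<eta> is found among them, so is all of \<open>Z_eta\<close>, and with \<open>repr\<close>
    all of \<open>A\<close>.\<close>
  define B where "B = {x \<in> A. \<exists>k::int. x - of_int k \<in> I}"
  have inv: "1 / of_nat \<eta> \<in> A"
  proof -
    have "1 / of_nat \<eta> ^ 1 \<in> Z_eta \<eta>" unfolding Z_eta_def localize_def
      by (rule CollectI, rule exI[of _ 1], rule exI[of _ 1]) simp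
    thus ?thesis using Z(1) by auto
  qed
  have B_inv: "1 / of_nat \<eta> \<in> B"
  proof -
    obtain i j where ij: "i < j" "(1 / of_nat \<eta>) ^ i - (1 / of_nat \<eta>) ^ j \<in> I"
      using pigeon[of "\<lambda>i. (1 / of_nat \<eta>) ^ i"] power_mem[OF inv] by blast
    have "(of_nat \<eta> ^ j * (1 / of_nat \<eta>)) * ((1 / of_nat \<eta>) ^ i - (1 / of_nat \<eta>) ^ j) \<in> I"
      by (intro I'(4)[OF _ ij(2)] mult_mem power_mem of_nat_mem inv)
    moreover have "of_nat \<eta> * (1 / of_nat \<eta>) = (1 :: complex)" using \<eta> by simp
    ultimately have "of_nat \<eta> ^ (j - i - 1) - 1 / of_nat \<eta> \<in> I"
      by (simp only: power_mult_diff_if_inverse[OF _ ij(1)])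
    hence "- (of_nat \<eta> ^ (j - i - 1) - 1 / of_nat \<eta>) \<in> I" by (rule I'(5))
    hence "1 / of_nat \<eta> - of_int (int \<eta> ^ (j - i - 1)) \<in> I" by simp
    thus ?thesis unfolding B_def using inv by blast
  qed
  have B_mult: "x * y \<in> B" if xy: "x \<in> B" "y \<in> B" for x y
  proof -
    obtain k l :: int where kl: "x - of_int k \<in> I" "y - of_int l \<in> I" "x \<in> A" "y \<in> A"
      using xy by (auto simp: B_def)
    have "y * (x - of_int k) + of_int k * (y - of_int l) \<in> I" by (intro I'(3,4) kl of_int_mem)
    hence "x * y - of_int (k * l) \<in> I" by (simp add: algebra_simps)
    thus ?thesis unfolding B_def using mult_mem[OF kl(3,4)] by blast
  qed
  have B_int: "of_int k \<in> B" for k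
  proof -
    have "of_int k - of_int k \<in> I" using I'(2) by simp
    thus ?thesis unfolding B_def using of_int_mem[of k] by blast
  qed
  have B_pow: "(1 / of_nat \<eta>) ^ j \<in> B" for j
  proof (induction j)
    case 0
    show ?case using B_int[of 1] by simp
  next
    case (Suc j)
    show ?case unfolding power_Suc by (rule B_mult[OF B_inv Suc])
  qed
  have BZ: "z \<in> B" if z: "z \<in> Z_eta \<eta>" for z
  proof -
    obtain k :: int and j where "z = of_int k / of_nat \<eta> ^ j"
      using z by (auto simp: Z_eta_def localize_def elim!: Ints_cases)
    hence "z = of_int k * (1 / of_nat \<eta>) ^ j" by (simp add: power_one_over)
    thus ?thesis using B_mult[OF B_int B_pow] by simp
  qed
  have "\<exists>k::int. x - of_int k \<in> I" if x: "x \<in> A" for x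
  proof -
    obtain z where z: "z \<in> Z_eta \<eta>" "x - z \<in> I" using repr[OF x] by blast
    obtain k :: int where "z - of_int k \<in> I" using BZ[OF z(1)] by (auto simp: B_def)
    hence "(x - z) + (z - of_int k) \<in> I" using z(2) by (intro I'(3))
    thus ?thesis by auto
  qed
  hence mod: "integers_mod A I m" using dvd by (auto simp: integers_mod_def)
  have "m = n" using card_quot_integers_mod[OF I mod m(1)] card(1) by simp
  thus ?thesis using mod by simp
qed

text \<open>The integers in \<open>S\<close> already represent all classes of \<open>A\<close>
  modulo \<open>I\<close>, so the projection restricted to \<open>S\<close> is onto, with the
  intersection as kernel.\<close>

lemma (in complex_subring) quot_iso_if_integers_mod:
  assumes I: "ideal I (subring_C A)" and mod: "integers_mod A I n"
    and S: "S \<subseteq> A" "complex_subring S"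
  shows "(subring_C A Quot I) \<simeq> (subring_C S Quot (I \<inter> S))"
proof -
  interpret S: complex_subring S by (rule S(2))
  let ?c = "\<lambda>x. I +>\<^bsub>subring_C A\<^esub> x" and ?Q = "subring_C A Quot I"
  note I' = idealD[OF I]
  have Q: "ring ?Q" by (rule ideal.quotient_is_ring[OF I])
  have hom: "?c \<in> Ring.ring_hom (subring_C A) ?Q" by (rule ideal.rcos_ring_hom[OF I])
  have "?c \<in> Ring.ring_hom (subring_C S) ?Q"
  proof (rule ring_hom_memI)
    fix x y assume "x \<in> carrier (subring_C S)" "y \<in> carrier (subring_C S)"
    hence xy: "x \<in> carrier (subring_C A)" "y \<in> carrier (subring_C A)" using S(1) by auto
    show "?c x \<in> carrier ?Q" by (rule ring_hom_closed[OF hom xy(1)])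
    show "?c (x \<otimes>\<^bsub>subring_C S\<^esub> y) = ?c x \<otimes>\<^bsub>?Q\<^esub> ?c y" using ring_hom_mult[OF hom xy] by simp
    show "?c (x \<oplus>\<^bsub>subring_C S\<^esub> y) = ?c x \<oplus>\<^bsub>?Q\<^esub> ?c y" using ring_hom_add[OF hom xy] by simp
  next
    show "?c \<one>\<^bsub>subring_C S\<^esub> = \<one>\<^bsub>?Q\<^esub>" using ring_hom_one[OF hom] by simp
  qed
  then interpret h: ring_hom_ring "subring_C S" ?Q ?c
    by (rule ring_hom_ringI2[OF S.ring Q])
  have "?c ` carrier (subring_C S) = carrier ?Q"
  proof (intro equalityI subsetI)
    fix C assume "C \<in> carrier ?Q"
    then obtain x where x: "x \<in> A" "C = ?c x" by (auto simp: carrier_quot)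
    then obtain k :: int where "x - of_int k \<in> I" using mod by (auto simp: integers_mod_def)
    hence "C = ?c (of_int k)" using x(2) coset_eq_iff[OF I] by blast
    thus "C \<in> ?c ` carrier (subring_C S)" using S.of_int_mem by auto
  qed (use S(1) in \<open>auto simp: carrier_quot\<close>)
  hence iso: "(subring_C S Quot a_kernel (subring_C S) ?Q ?c) \<simeq> ?Q" by (rule h.FactRing_iso)
  have "a_kernel (subring_C S) ?Q ?c = I \<inter> S"
  proof -
    have ker: "?c x = I \<longleftrightarrow> x \<in> I" for x
    proof -
      have "?c 0 = I" by (simp add: coset_eq)
      thus ?thesis using coset_eq_iff[OF I, of x 0] by simp
    qed
    have "\<zero>\<^bsub>?Q\<^esub> = I" by (simp only: FactRing_def ring.simps)
    hence "a_kernel (subring_C S) ?Q ?c = {x \<in> S. ?c x = I}"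
      unfolding a_kernel_def' by (simp only: subring_C_sel)
    thus ?thesis unfolding ker by blast
  qed
  hence iso': "(subring_C S Quot (I \<inter> S)) \<simeq> ?Q" using iso by simp
  have "ideal (I \<inter> S) (subring_C S)"
    by (rule S.idealI_C) (use I' S(1) S.zero_mem S.add_mem S.mult_mem in auto)
  hence "ring (subring_C S Quot (I \<inter> S))" by (rule ideal.quotient_is_ring)
  thus ?thesis using iso' by (rule ring_iso_sym)
qed

section \<open>Degree one ideals\<close>

text \<open>Lagrange interpolation of the constant 1 at the roots: the polynomial has degree below
  that of \<open>f\<close> and takes the value 1 at all roots, which are as many as the
  degree.\<close>

lemma (in irreducible_root) lagrange_sum:
  "(\<Sum>z\<in>Z. (\<Sum>l<degree f. s l z * y ^ l) / poly (pderiv F) z) = 1"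
proof -
  define P where "P = (\<Sum>z\<in>Z. smult (1 / poly (pderiv F) z) (\<Sum>l<degree f. monom (s l z) l))"
  have poly_P: "poly P w = (\<Sum>z\<in>Z. (\<Sum>l<degree f. s l z * w ^ l) / poly (pderiv F) z)" for w
    by (simp add: P_def poly_sum poly_monom)
  have one: "poly P w = 1" if w: "w \<in> Z" for w
  proof -
    have "poly P w = (\<Sum>z\<in>Z. if z = w then 1 else 0)"
      unfolding poly_P using root_pderiv_nonzero w by (intro sum.cong refl) (auto simp: s_sum)
    thus ?thesis using w finite_Z by simp
  qed
  have "P - 1 = 0"
  proof (rule ccontr)
    assume nz: "P - 1 \<noteq> 0"
    have "coeff (P - 1) k = 0" if "k \<ge> degree f" for k
      using that deg by (simp add: P_def coeff_sum coeff_1)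
    hence "degree (P - 1) < degree f" using nz by (metis leading_coeff_0_iff not_le)
    moreover have "card Z \<le> degree (P - 1)"
    proof -
      have "Z \<subseteq> {w. poly (P - 1) w = 0}" using one by auto
      hence "card Z \<le> card {w. poly (P - 1) w = 0}" by (intro card_mono poly_roots_finite nz)
      also have "\<dots> \<le> degree (P - 1)" by (rule card_poly_roots_bound[OF nz])
      finally show ?thesis .
    qed
    ultimately show False using card_Z by simp
  qed
  hence "P = 1" by simp
  thus ?thesis using poly_P[of y] by simp
qed

text \<open>For a monic h with root \<eta>\<alpha>, the integer polynomial h(\<eta>x) has root
  \<alpha> and a power of \<eta> as leading coefficient; \<open>f\<close> divides it over the
  integers.\<close>

lemma (in irreducible_root) lead_coeff_dvd_power:
  assumes "algebraic_int (of_nat \<eta> * \<alpha>)" "(\<eta>::nat) > 0"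
  obtains k where "lead_coeff f dvd int \<eta> ^ k"
proof -
  obtain h where h: "poly (map_poly of_int h) (of_nat \<eta> * \<alpha>) = 0" "lead_coeff h = 1"
    using assms(1) algebraic_int_altdef_ipoly by blast
  define g where "g = pcompose h [:0, int \<eta>:]"
  have "map_poly of_int g = pcompose (map_poly of_int h) [:0, of_nat \<eta> :: complex:]"
    unfolding g_def by (simp add: of_int_hom.map_poly_pcompose of_int_hom.map_poly_pCons_hom)
  hence "poly (map_poly of_int g) \<alpha> = 0" using h(1) by (simp add: poly_pcompose mult.commute)
  hence "f dvd g" by (rule int_poly_dvd_if_common_root[OF irr root])
  then obtain t where "g = f * t" by (elim dvdE)
  hence "lead_coeff f dvd lead_coeff g" by (simp only: lead_coeff_mult dvd_triv_left)
  also have "lead_coeff g = int \<eta> ^ degree h"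
    unfolding g_def using assms(2) h(2) by (subst lead_coeff_comp) auto
  finally show thesis by (rule that)
qed

context alg_field
begin

lemma embedding_mult: "u \<in> embeddings K \<Longrightarrow> x \<in> K \<Longrightarrow> y \<in> K \<Longrightarrow> u (x * y) = u x * u y"
  by (metis embedding_galois galois_mult algebraic subfield_mult[OF subfield])

lemma embedding_of_int: "u \<in> embeddings K \<Longrightarrow> u (of_int k) = of_int k"
  by (metis embedding_galois galois_of_int subfield_of_int[OF subfield])

lemma embedding_prod:
  assumes "u \<in> embeddings K" "\<And>i. i \<in> I \<Longrightarrow> g i \<in> K"
  shows "u (prod g I) = (\<Prod>i\<in>I. u (g i))"
  using assms(2)
proof (induction I rule: infinite_finite_induct)
  case (insert i I)
  have "prod g I \<in> K" using insert.prems by (intro subfield_prod[OF subfield]) auto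
  thus ?case using insert by (simp add: embedding_mult[OF assms(1)])
qed (use embedding_of_int[OF assms(1), of 1] in auto)

lemma embedding_poly:
  assumes "u \<in> embeddings K" "x \<in> K"
  shows "u (poly (map_poly of_int p) x) = poly (map_poly of_int p) (u x)"
proof -
  obtain \<sigma> where \<sigma>: "\<sigma> \<in> galois" "\<And>x. x \<in> K \<Longrightarrow> u x = \<sigma> x" using embedding_galois[OF assms(1)] by blast
  have "poly (map_poly of_int p) x \<in> K"
    by (rule poly_coeffs_in[OF subfield coeffs_in_of_int[OF subfield] assms(2)])
  thus ?thesis using \<sigma>(2) galois_poly[OF \<sigma>(1) algebraic[OF assms(2)]] assms(2) by simp
qed

end

lemma complex_subring_localize:
  assumes A: "complex_subring A" and \<eta>: "(\<eta>::nat) > 0"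
  shows "complex_subring (localize A \<eta>)"
proof -
  interpret complex_subring A by (rule A)
  have I: "x / of_nat \<eta> ^ k \<in> localize A \<eta>" if "x \<in> A" for x k
    unfolding localize_def using that by blast
  have E: "\<exists>a k. a \<in> A \<and> x = a / of_nat \<eta> ^ k" if "x \<in> localize A \<eta>" for x
    using that unfolding localize_def by blast
  show ?thesis
  proof
    show "1 \<in> localize A \<eta>" using I[OF one_mem, of 0] by simp
    fix x assume x: "x \<in> localize A \<eta>"
    obtain a k where a: "a \<in> A" "x = a / of_nat \<eta> ^ k" using E[OF x] by blast
    show "- x \<in> localize A \<eta>" using I[OF uminus_mem[OF a(1)], of k] a(2) by simp
    fix y assume y: "y \<in> localize A \<eta>"
    obtain b l where b: "b \<in> A" "y = b / of_nat \<eta> ^ l" using E[OF y] by blast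
    have "(a * of_nat \<eta> ^ l + b * of_nat \<eta> ^ k) / of_nat \<eta> ^ (k + l) \<in> localize A \<eta>"
      by (intro I add_mem mult_mem power_mem of_nat_mem a b)
    thus "x + y \<in> localize A \<eta>" using \<eta> by (simp add: a(2) b(2) power_add add_divide_distrib)
    show "x * y \<in> localize A \<eta>"
      using I[OF mult_mem[OF a(1) b(1)], of "k + l"] by (simp add: a(2) b(2) power_add)
  qed
qed

section \<open>The ring R and the traces of its elements\<close>

locale degree_one_ideals = coprime_roots +
  fixes \<eta> n :: nat
  assumes eta_pos: "\<eta> > 0" and eta_int: "\<And>i. i < r \<Longrightarrow> of_nat \<eta> * \<alpha> i \<in> ring_of_integers L"
    and n: "n \<ge> 2" "coprime (int n) (int \<eta> * (\<Prod>i<r. poly_disc (f i)))"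
begin

definition R :: "complex set" where "R = localize (ring_of_integers L) \<eta>"

sublocale L: alg_field L
  by (rule alg_field_L)

lemma subring_integers: "complex_subring (ring_of_integers L)"
proof
  show "1 \<in> ring_of_integers L" using subfield_1[OF L.subfield] by (simp add: ring_of_integers_def)
  fix x assume x: "x \<in> ring_of_integers L"
  show "- x \<in> ring_of_integers L"
    using x subfield_uminus[OF L.subfield] by (simp add: ring_of_integers_def)
  fix y assume y: "y \<in> ring_of_integers L"
  show "x + y \<in> ring_of_integers L" "x * y \<in> ring_of_integers L"
    using x y subfield_add[OF L.subfield] subfield_mult[OF L.subfield]
    by (auto simp: ring_of_integers_def)
qed

sublocale R: complex_subring R
  unfolding R_def by (rule complex_subring_localize[OF subring_integers eta_pos])

lemma subring_Z_eta: "complex_subring (Z_eta \<eta>)"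
proof -
  have "complex_subring \<int>" by unfold_locales auto
  thus ?thesis unfolding Z_eta_def by (rule complex_subring_localize[OF _ eta_pos])
qed

sublocale Z: complex_subring "Z_eta \<eta>"
  by (rule subring_Z_eta)

lemma Z_subset_R: "Z_eta \<eta> \<subseteq> R"
proof -
  have "\<int> \<subseteq> ring_of_integers L"
    using subfield_of_int[OF L.subfield] by (auto simp: ring_of_integers_def elim!: Ints_cases)
  thus ?thesis unfolding Z_eta_def R_def localize_def by blast
qed

lemma inverse_eta_Z: "1 / of_nat \<eta> \<in> Z_eta \<eta>"
proof -
  have "1 / of_nat \<eta> ^ 1 \<in> Z_eta \<eta>" unfolding Z_eta_def localize_def
    by (rule CollectI, rule exI[of _ 1], rule exI[of _ 1]) simp
  thus ?thesis by simp
qed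

lemma alpha_R: "i < r \<Longrightarrow> \<alpha> i \<in> R"
proof -
  assume i: "i < r"
  have "of_nat \<eta> * \<alpha> i / of_nat \<eta> ^ 1 \<in> R"
    unfolding R_def localize_def using eta_int[OF i] by blast
  thus ?thesis using eta_pos by simp
qed

lemma R_cases:
  assumes "x \<in> R"
  obtains a k where "a \<in> L" "algebraic_int a" "x = a * (1 / of_nat \<eta>) ^ k"
proof -
  obtain a k where "a \<in> ring_of_integers L" "x = a / of_nat \<eta> ^ k"
    using assms unfolding R_def localize_def by blast
  thus thesis by (intro that[of a k]) (auto simp: ring_of_integers_def power_one_over)
qed

lemma inverse_eta_L: "(1 / of_nat \<eta>) ^ k \<in> L"
  by (intro subfield_power[OF L.subfield] subfield_divide[OF L.subfield] subfield_1[OF L.subfield]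
      subfield_of_nat[OF L.subfield])

lemma R_subset_L: "R \<subseteq> L"
proof
  fix x assume "x \<in> R"
  then obtain a k where "a \<in> L" "x = a * (1 / of_nat \<eta>) ^ k" by (rule R_cases)
  thus "x \<in> L" using subfield_mult[OF L.subfield _ inverse_eta_L] by simp
qed

lemma trace_R:
  assumes "x \<in> R"
  shows "(\<Sum>u\<in>embeddings L. u x) \<in> Z_eta \<eta>"
proof -
  obtain a k where a: "a \<in> L" "algebraic_int a" "x = a * (1 / of_nat \<eta>) ^ k"
    using R_cases[OF assms] by blast
  have "u x = u a * (1 / of_nat \<eta>) ^ k" if u: "u \<in> embeddings L" for u
  proof -
    obtain \<sigma> where \<sigma>: "\<sigma> \<in> galois" "\<And>x. x \<in> L \<Longrightarrow> u x = \<sigma> x" using embedding_galois[OF u] by blast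
    have "\<sigma> ((1 / of_nat \<eta>) ^ k) = (1 / of_nat \<eta>) ^ k" by (intro galois_rat[OF \<sigma>(1)] Rats_power) auto
    thus ?thesis unfolding a(3) using L.embedding_mult[OF u a(1) inverse_eta_L] \<sigma>(2)[OF inverse_eta_L] by simp
  qed
  hence "(\<Sum>u\<in>embeddings L. u x) = (\<Sum>u\<in>embeddings L. u a) * (1 / of_nat \<eta>) ^ k"
    by (simp add: sum_distrib_right)
  moreover have "(\<Sum>u\<in>embeddings L. u a) \<in> \<int>" by (rule L.trace_int[OF a(1,2)])
  then obtain z :: int where "(\<Sum>u\<in>embeddings L. u a) = of_int z" by (rule Ints_cases)
  ultimately show ?thesis using Z.mult_mem[OF Z.of_int_mem Z.power_mem[OF inverse_eta_Z]] by simp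
qed

definition S :: "nat \<Rightarrow> nat \<Rightarrow> complex \<Rightarrow> complex" where
  "S i l z = poly (map_poly of_int (poly_shift (Suc l) (f i))) z"

definition F' :: "nat \<Rightarrow> complex \<Rightarrow> complex" where
  "F' i z = poly (pderiv (map_poly of_int (f i))) z"

lemma S_sum:
  assumes "i < r" "x \<in> Zs i" "y \<in> Zs i"
  shows "(\<Sum>l<degree (f i). S i l x * y ^ l) = (if x = y then F' i x else 0)"
  using irreducible_root.s_sum[OF root_i[OF assms(1)], of x y] assms(2,3)
  by (simp add: S_def F'_def Zs_def irreducible_root.s_def[OF root_i[OF assms(1)]])

lemma lagrange_S:
  assumes "i < r"
  shows "(\<Sum>z\<in>Zs i. (\<Sum>l<degree (f i). S i l z * y ^ l) / F' i z) = 1"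
  using irreducible_root.lagrange_sum[OF root_i[OF assms], of y]
  by (simp add: S_def F'_def Zs_def irreducible_root.s_def[OF root_i[OF assms]])

lemma F'_nonzero: "i < r \<Longrightarrow> z \<in> Zs i \<Longrightarrow> F' i z \<noteq> 0"
  using irreducible_root.root_pderiv_nonzero[OF root_i] by (simp add: F'_def Zs_def)

lemma alpha_Zs: "i < r \<Longrightarrow> \<alpha> i \<in> Zs i"
  using irreducible_root.alpha_Z[OF root_i] by (simp add: Zs_def)

lemma embedding_Zs:
  assumes "i < r" "u \<in> embeddings L"
  shows "u (\<alpha> i) \<in> Zs i"
  using bij_betw_apply[OF embeddings_grid assms(2)] assms(1) by (auto simp: PiE_def Pi_def)

definition Res :: "nat \<Rightarrow> int" where "Res i = resultant (f i) (pderiv (f i))"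

lemma resultant_combination:
  obtains V :: "nat \<Rightarrow> int poly"
    where "\<forall>i<r. \<forall>z\<in>Zs i. poly (map_poly of_int (V i)) z * F' i z = of_int (Res i)"
proof -
  have "\<exists>V :: int poly. \<forall>z\<in>Zs i. poly (map_poly of_int V) z * F' i z = of_int (Res i)" if i: "i < r" for i
  proof -
    interpret ir: irreducible_root "f i" "\<alpha> i" by (rule root_i[OF i])
    have "degree (f i) > 0" using ir.deg by simp
    then obtain V :: "int poly" where V: "\<And>x::complex. poly (map_poly of_int (f i)) x = 0 \<Longrightarrow>
        poly (map_poly of_int V) x * poly (map_poly of_int (pderiv (f i))) x = of_int (Res i)"
      unfolding Res_def using resultant_linear_combination[of "f i"] by blast
    have "F' i z = poly (map_poly of_int (pderiv (f i))) z" for z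
      by (simp add: F'_def of_int_hom.map_poly_pderiv)
    thus ?thesis using V by (intro exI[of _ V]) (auto simp: Zs_def ir.Z_def)
  qed
  then obtain V :: "nat \<Rightarrow> int poly"
    where "\<forall>i. i < r \<longrightarrow> (\<forall>z\<in>Zs i. poly (map_poly of_int (V i)) z * F' i z = of_int (Res i))"
    by metis
  thus thesis by (intro that[of V])
qed

lemma coprime_eta: "coprime (int n) (int \<eta>)"
  using n(2) by simp

text \<open>Each resultant is up to sign the leading coefficient times the discriminant, and the
  leading coefficient divides a power of \<eta>; so both factors are coprime to
  \<open>n\<close>.\<close>

lemma coprime_Res: "coprime (int n) (\<Prod>i<r. Res i)"
proof (rule prod_coprime_right)
  fix i assume "i \<in> {..<r}"
  hence i: "i < r" by simp
  interpret ir: irreducible_root "f i" "\<alpha> i" by (rule root_i[OF i])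
  obtain e where e: "e = 1 \<or> e = - 1" "Res i = e * lead_coeff (f i) * poly_disc (f i)"
    unfolding Res_def by (rule ir.resultant_eq_disc)
  have "algebraic_int (of_nat \<eta> * \<alpha> i)" using eta_int[OF i] by (simp add: ring_of_integers_def)
  then obtain k where k: "lead_coeff (f i) dvd int \<eta> ^ k" using ir.lead_coeff_dvd_power[OF _ eta_pos] by blast
  have "coprime (int n) (int \<eta> ^ k)" using coprime_eta by simp
  hence 1: "coprime (int n) (lead_coeff (f i))" using k by (meson coprime_divisors dvd_refl)
  have "coprime (int n) (\<Prod>i<r. poly_disc (f i))" using n(2) by simp
  moreover have "poly_disc (f i) dvd (\<Prod>i<r. poly_disc (f i))" using i by (intro dvd_prodI) auto
  ultimately have 2: "coprime (int n) (poly_disc (f i))" by (meson coprime_divisors dvd_refl)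
  have "coprime (int n) (lead_coeff (f i) * poly_disc (f i))" using 1 2 by simp
  thus "coprime (int n) (Res i)" using e by auto
qed

text \<open>Up to the factor \<^term>\<open>F'\<close>, the functions \<^term>\<open>S\<close> form the basis dual to the monomials in the
  roots with respect to the trace.\<close>

lemma resultant_mult_in_subring:
  assumes B: "complex_subring B" "Z_eta \<eta> \<subseteq> B" "\<And>i. i < r \<Longrightarrow> \<alpha> i \<in> B" and x: "x \<in> R"
  shows "of_int (\<Prod>i<r. Res i) * x \<in> B"
proof -
  interpret B: complex_subring B by (rule B(1))
  define J where "J = PiE {..<r} (\<lambda>i. {..<degree (f i)})"
  \<comment> \<open>By duality these traces are coefficients of \<open>x\<close> times the product
    of the \<open>F' i (\<alpha> i)\<close> with respect to the monomials in the \<alpha> i; they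
    lie in \<open>Z_eta\<close>.\<close>
  define C where "C j = (\<Sum>u\<in>embeddings L. u (x * (\<Prod>i<r. S i (j i) (\<alpha> i))))" for j
  have S_R: "S i l (\<alpha> i) \<in> R" if "i < r" for i l
    unfolding S_def by (rule R.poly_mem[OF alpha_R[OF that]])
  have C: "C j \<in> B" for j
  proof -
    have "x * (\<Prod>i<r. S i (j i) (\<alpha> i)) \<in> R" by (intro R.mult_mem R.prod_mem x S_R) auto
    thus ?thesis using trace_R B(2) unfolding C_def by blast
  qed
  have uS: "u (x * (\<Prod>i<r. S i (j i) (\<alpha> i))) = u x * (\<Prod>i<r. S i (j i) (u (\<alpha> i)))"
    if u: "u \<in> embeddings L" for u j
  proof -
    have SL: "S i (j i) (\<alpha> i) \<in> L" if "i < r" for i using S_R[OF that] R_subset_L by blast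
    have "u (x * (\<Prod>i<r. S i (j i) (\<alpha> i))) = u x * u (\<Prod>i<r. S i (j i) (\<alpha> i))"
      using x R_subset_L SL by (intro L.embedding_mult[OF u] subfield_prod[OF L.subfield]) auto
    also have "u (\<Prod>i<r. S i (j i) (\<alpha> i)) = (\<Prod>i<r. u (S i (j i) (\<alpha> i)))"
      using SL by (intro L.embedding_prod[OF u]) auto
    also have "\<dots> = (\<Prod>i<r. S i (j i) (u (\<alpha> i)))"
      unfolding S_def by (intro prod.cong refl L.embedding_poly[OF u] alpha_L) simp
    finally show ?thesis .
  qed
  define id' where "id' = restrict (\<lambda>x. x) L"
  have id': "id' \<in> embeddings L" using galois_id by (auto simp: id'_def embeddings_def)
  have is_id: "(\<forall>i<r. u (\<alpha> i) = \<alpha> i) \<longleftrightarrow> u = id'" if u: "u \<in> embeddings L" for u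
  proof
    assume "\<forall>i<r. u (\<alpha> i) = \<alpha> i"
    hence "(\<lambda>i\<in>{..<r}. u (\<alpha> i)) = (\<lambda>i\<in>{..<r}. id' (\<alpha> i))"
      using alpha_L by (auto simp: id'_def fun_eq_iff)
    thus "u = id'" using embeddings_grid u id' by (auto simp: bij_betw_def inj_on_def)
  qed (use alpha_L in \<open>auto simp: id'_def\<close>)
  have "(\<Sum>j\<in>J. C j * (\<Prod>i<r. \<alpha> i ^ j i))
      = (\<Sum>j\<in>J. \<Sum>u\<in>embeddings L. u x * (\<Prod>i<r. S i (j i) (u (\<alpha> i)) * \<alpha> i ^ j i))"
    unfolding C_def sum_distrib_right
    by (intro sum.cong refl) (simp add: uS prod.distrib mult.assoc)
  also have "\<dots> = (\<Sum>u\<in>embeddings L. u x * (\<Sum>j\<in>J. \<Prod>i<r. S i (j i) (u (\<alpha> i)) * \<alpha> i ^ j i))"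
    by (subst sum.swap) (simp add: sum_distrib_left)
  also have "\<dots> = (\<Sum>u\<in>embeddings L. u x * (\<Prod>i<r. \<Sum>l<degree (f i). S i l (u (\<alpha> i)) * \<alpha> i ^ l))"
    unfolding J_def by (subst prod_sum_PiE) auto
  \<comment> \<open>A factor vanishes as soon as \<open>u\<close> moves its root, so only the
    identity remains.\<close>
  also have "\<dots> = (\<Sum>u\<in>embeddings L. if u = id' then x * (\<Prod>i<r. F' i (\<alpha> i)) else 0)"
  proof (rule sum.cong[OF refl])
    fix u assume u: "u \<in> embeddings L"
    have "(\<Prod>i<r. \<Sum>l<degree (f i). S i l (u (\<alpha> i)) * \<alpha> i ^ l)
        = (\<Prod>i<r. if u (\<alpha> i) = \<alpha> i then F' i (\<alpha> i) else 0)"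
      by (intro prod.cong refl) (auto simp: S_sum embedding_Zs[OF _ u] alpha_Zs)
    also have "\<dots> = (if \<forall>i<r. u (\<alpha> i) = \<alpha> i then \<Prod>i<r. F' i (\<alpha> i) else 0)"
      by auto
    finally show "u x * (\<Prod>i<r. \<Sum>l<degree (f i). S i l (u (\<alpha> i)) * \<alpha> i ^ l)
        = (if u = id' then x * (\<Prod>i<r. F' i (\<alpha> i)) else 0)"
      unfolding is_id[OF u] using x R_subset_L by (auto simp: id'_def)
  qed
  also have "\<dots> = x * (\<Prod>i<r. F' i (\<alpha> i))" using id' L.finite_emb by simp
  finally have dual: "(\<Sum>j\<in>J. C j * (\<Prod>i<r. \<alpha> i ^ j i)) = x * (\<Prod>i<r. F' i (\<alpha> i))" .
  have "(\<Sum>j\<in>J. C j * (\<Prod>i<r. \<alpha> i ^ j i)) \<in> B"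
    by (intro B.sum_mem B.mult_mem B.prod_mem B.power_mem C B(3)) auto
  hence xF: "x * (\<Prod>i<r. F' i (\<alpha> i)) \<in> B" by (simp only: dual)
  obtain V where V: "\<forall>i<r. \<forall>z\<in>Zs i. poly (map_poly of_int (V i)) z * F' i z = of_int (Res i)"
    by (rule resultant_combination)
  have "(\<Prod>i<r. poly (map_poly of_int (V i)) (\<alpha> i)) * (x * (\<Prod>i<r. F' i (\<alpha> i))) \<in> B"
    by (intro B.mult_mem B.prod_mem xF B.poly_mem B(3)) auto
  also have "(\<Prod>i<r. poly (map_poly of_int (V i)) (\<alpha> i)) * (x * (\<Prod>i<r. F' i (\<alpha> i)))
      = (\<Prod>i<r. poly (map_poly of_int (V i)) (\<alpha> i) * F' i (\<alpha> i)) * x"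
    by (simp add: prod.distrib mult_ac)
  also have "(\<Prod>i<r. poly (map_poly of_int (V i)) (\<alpha> i) * F' i (\<alpha> i)) = (\<Prod>i<r. of_int (Res i))"
    using V alpha_Zs by (intro prod.cong refl) auto
  finally show ?thesis by simp
qed

text \<open>The quotient (f_i(v_i) - f_i(z))/(v_i - z) as a polynomial in z with integer
  coefficients, hence an element of R at \<alpha> i.\<close>

definition q :: "(nat \<Rightarrow> int) \<Rightarrow> nat \<Rightarrow> complex \<Rightarrow> complex" where
  "q v i z = (\<Sum>l<degree (f i). S i l z * of_int (v i) ^ l)"

lemma q_mult:
  assumes "i < r"
  shows "(\<alpha> i - of_int (v i)) * q v i (\<alpha> i) = - of_int (poly (f i) (v i))"
proof -
  interpret ir: irreducible_root "f i" "\<alpha> i" by (rule root_i[OF assms])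
  have "poly ir.F (of_int (v i)) - poly ir.F (\<alpha> i) = (of_int (v i) - \<alpha> i) * q v i (\<alpha> i)"
    using poly_eq_shift[of ir.F "of_int (v i)" "\<alpha> i"]
    by (simp add: q_def S_def ir.s_eq[symmetric] ir.s_def)
  moreover have "poly ir.F (\<alpha> i) = 0" by (rule ir.root)
  moreover have "poly ir.F (of_int (v i)) = of_int (poly (f i) (v i))" by simp
  ultimately show ?thesis by (simp add: algebra_simps)
qed

lemma q_R: "i < r \<Longrightarrow> q v i (\<alpha> i) \<in> R"
  unfolding q_def S_def by (intro R.sum_mem R.mult_mem R.power_mem R.of_int_mem R.poly_mem alpha_R)

text \<open>Before the trace is taken, each \<open>q\<close> is multiplied by Res/F' at the root.
  The trace of the product is then the product of the \<open>Res i\<close> by Lagrange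
  interpolation, while the right side has \<open>n\<close> times an element of \<open>Z_eta\<close>
  as its trace. As the resultants and \<eta> are coprime to \<open>n\<close>, it follows that
  \<open>n\<close> divides \<open>k\<close>.\<close>

lemma dvd_if_mult_q:
  assumes y: "y \<in> R" and eq: "of_int k * (\<Prod>i<r. q v i (\<alpha> i)) = of_nat n * y"
  shows "int n dvd k"
proof -
  obtain V where V: "\<forall>i<r. \<forall>z\<in>Zs i. poly (map_poly of_int (V i)) z * F' i z = of_int (Res i)"
    by (rule resultant_combination)
  define W where "W i z = poly (map_poly of_int (V i)) z" for i and z :: complex
  have W_R: "W i (\<alpha> i) \<in> R" if "i < r" for i unfolding W_def by (rule R.poly_mem[OF alpha_R[OF that]])
  define P where "P = (\<Prod>i<r. q v i (\<alpha> i) * W i (\<alpha> i))"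
  have "P \<in> R" unfolding P_def by (intro R.prod_mem R.mult_mem q_R W_R) simp_all
  hence P_L: "P \<in> L" using R_subset_L by blast
  define Y where "Y = y * (\<Prod>i<r. W i (\<alpha> i))"
  have Y_R: "Y \<in> R" unfolding Y_def by (intro R.mult_mem y R.prod_mem W_R) simp
  have kP: "of_int k * P = of_int (int n) * Y"
  proof -
    have "P = (\<Prod>i<r. q v i (\<alpha> i)) * (\<Prod>i<r. W i (\<alpha> i))" unfolding P_def by (rule prod.distrib)
    hence "of_int k * P = (of_int k * (\<Prod>i<r. q v i (\<alpha> i))) * (\<Prod>i<r. W i (\<alpha> i))" by (simp only: mult.assoc)
    thus ?thesis unfolding eq Y_def by (simp only: mult.assoc of_int_of_nat_eq)
  qed
  have uP: "u P = (\<Prod>i<r. q v i (u (\<alpha> i)) * W i (u (\<alpha> i)))" if u: "u \<in> embeddings L" for u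
  proof -
    \<comment> \<open>An integer polynomial with value \<open>q * W\<close>, so that an embedding
      acts by moving the argument.\<close>
    define p where "p i = (\<Sum>l<degree (f i). poly_shift (Suc l) (f i) * [:v i ^ l:]) * V i" for i
    have p: "q v i z * W i z = poly (map_poly of_int (p i)) z" for i z
      by (simp add: q_def S_def W_def p_def hom_distribs poly_sum)
    have "u P = (\<Prod>i<r. u (poly (map_poly of_int (p i)) (\<alpha> i)))"
      unfolding P_def p
      by (intro L.embedding_prod[OF u] poly_coeffs_in[OF L.subfield coeffs_in_of_int[OF L.subfield]] alpha_L) simp
    also have "\<dots> = (\<Prod>i<r. poly (map_poly of_int (p i)) (u (\<alpha> i)))"
      by (intro prod.cong refl L.embedding_poly[OF u] alpha_L) simp
    finally show ?thesis by (simp only: p)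
  qed
  have "(\<Sum>u\<in>embeddings L. u P) = (\<Sum>u\<in>embeddings L. \<Prod>i<r. q v i (u (\<alpha> i)) * W i (u (\<alpha> i)))"
    by (intro sum.cong refl uP)
  also have "\<dots> = (\<Prod>i<r. \<Sum>z\<in>Zs i. q v i z * W i z)" by (rule sum_embeddings_prod)
  also have "\<dots> = (\<Prod>i<r. of_int (Res i))"
  proof (intro prod.cong refl)
    fix i assume "i \<in> {..<r}"
    hence i: "i < r" by simp
    have "(\<Sum>z\<in>Zs i. q v i z * W i z) = (\<Sum>z\<in>Zs i. of_int (Res i) * (q v i z / F' i z))"
    proof (intro sum.cong refl)
      fix z assume z: "z \<in> Zs i"
      have "W i z = of_int (Res i) / F' i z"
        using V i z F'_nonzero[OF i z] by (simp add: W_def eq_divide_eq)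
      thus "q v i z * W i z = of_int (Res i) * (q v i z / F' i z)" by simp
    qed
    also have "\<dots> = of_int (Res i) * (\<Sum>z\<in>Zs i. q v i z / F' i z)" by (rule sum_distrib_left[symmetric])
    also have "(\<Sum>z\<in>Zs i. q v i z / F' i z) = 1" unfolding q_def by (rule lagrange_S[OF i])
    finally show "(\<Sum>z\<in>Zs i. q v i z * W i z) = of_int (Res i)" by simp
  qed
  finally have trP: "(\<Sum>u\<in>embeddings L. u P) = (\<Prod>i<r. of_int (Res i))" .
  have um: "u (of_int c * x) = of_int c * u x" if "u \<in> embeddings L" "x \<in> L" for u c x
    using L.embedding_mult[OF that(1) subfield_of_int[OF L.subfield] that(2)] L.embedding_of_int[OF that(1)] by simp
  have "of_int k * (\<Sum>u\<in>embeddings L. u P) = (\<Sum>u\<in>embeddings L. u (of_int k * P))"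
    using um[OF _ P_L] by (simp add: sum_distrib_left)
  also have "\<dots> = (\<Sum>u\<in>embeddings L. u (of_int (int n) * Y))" by (simp only: kP)
  also have "\<dots> = of_int (int n) * (\<Sum>u\<in>embeddings L. u Y)"
  proof -
    have "Y \<in> L" using Y_R R_subset_L by blast
    thus ?thesis using um[of _ Y "int n"] by (simp add: sum_distrib_left)
  qed
  finally have tr: "of_int k * (\<Prod>i<r. of_int (Res i)) = of_int (int n) * (\<Sum>u\<in>embeddings L. u Y)"
    unfolding trP .
  obtain c :: int and j where c: "(\<Sum>u\<in>embeddings L. u Y) = of_int c / of_nat \<eta> ^ j"
    using trace_R[OF Y_R] unfolding Z_eta_def localize_def by (auto elim!: Ints_cases)
  have "of_int (k * (\<Prod>i<r. Res i) * int \<eta> ^ j) = (of_int (int n * c) :: complex)"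
    using tr eta_pos unfolding c by (simp add: field_simps)
  hence "k * (\<Prod>i<r. Res i) * int \<eta> ^ j = int n * c" by (simp only: of_int_eq_iff)
  hence "int n dvd k * ((\<Prod>i<r. Res i) * int \<eta> ^ j)" by (metis dvd_triv_left mult.assoc)
  moreover have "coprime (int n) ((\<Prod>i<r. Res i) * int \<eta> ^ j)"
    using coprime_Res coprime_eta by simp
  ultimately show ?thesis by (simp add: coprime_dvd_mult_left_iff)
qed

section \<open>The ideals attached to tuples of roots modulo n\<close>

definition T :: "(nat \<Rightarrow> int) set" where
  "T = {v \<in> {..<r} \<rightarrow>\<^sub>E {0..<int n}. \<forall>i<r. int n dvd poly (f i) (v i)}"

definition \<psi> :: "(nat \<Rightarrow> int) \<Rightarrow> complex set" where
  "\<psi> v = Idl\<^bsub>subring_C R\<^esub> ((\<lambda>i. \<alpha> i - of_int (v i)) ` {..<r} \<union> {of_nat n})"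

lemma gens_R: "(\<lambda>i. \<alpha> i - of_int (v i)) ` {..<r} \<union> {of_nat n} \<subseteq> R"
  using R.diff_mem[OF alpha_R R.of_int_mem] R.of_nat_mem by auto

lemma ideal_\<psi>: "ideal (\<psi> v) (subring_C R)"
  unfolding \<psi>_def by (rule ring.genideal_ideal[OF R.ring]) (use gens_R in simp)

lemma gens_\<psi>: "i < r \<Longrightarrow> \<alpha> i - of_int (v i) \<in> \<psi> v" "of_nat n \<in> \<psi> v"
  unfolding \<psi>_def using ring.genideal_self[OF R.ring, of "(\<lambda>i. \<alpha> i - of_int (v i)) ` {..<r} \<union> {of_nat n}"] gens_R
  by auto

lemma \<psi>_minimal: "ideal I (subring_C R) \<Longrightarrow> (\<And>i. i < r \<Longrightarrow> \<alpha> i - of_int (v i) \<in> I) \<Longrightarrow> of_nat n \<in> I \<Longrightarrow> \<psi> v \<subseteq> I"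
  unfolding \<psi>_def by (rule ring.genideal_minimal[OF R.ring]) auto

lemma int_in_\<psi>:
  assumes v: "v \<in> T" and k: "of_int k \<in> \<psi> v"
  shows "int n dvd k"
proof -
  define W where "W = (\<Prod>i<r. q v i (\<alpha> i))"
  have W: "W \<in> R" unfolding W_def by (intro R.prod_mem q_R) simp
  \<comment> \<open>An ideal that contains all generators of \<open>\<psi> v\<close>: \<alpha> i - v
    i times its own factor \<open>q\<close> is -f_i(v_i), a multiple of \<open>n\<close>. So
    multiplication by \<open>W\<close> takes every element of \<open>\<psi> v\<close> into
    \<open>n\<close> R, without any expansion in generators.\<close>
  define I where "I = {x \<in> R. \<exists>y\<in>R. x * W = of_nat n * y}"
  have "ideal I (subring_C R)"
  proof (rule R.idealI_C)
    show "I \<subseteq> R" by (auto simp: I_def)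
    have "0 * W = of_nat n * 0" by simp
    thus "0 \<in> I" unfolding I_def using R.zero_mem by blast
    fix x assume "x \<in> I"
    then obtain y where y: "x \<in> R" "y \<in> R" "x * W = of_nat n * y" by (auto simp: I_def)
    show "x + x' \<in> I" if "x' \<in> I" for x'
    proof -
      from that obtain y' where y': "x' \<in> R" "y' \<in> R" "x' * W = of_nat n * y'" by (auto simp: I_def)
      have "(x + x') * W = of_nat n * (y + y')" by (simp add: distrib_right distrib_left y(3) y'(3))
      thus ?thesis unfolding I_def using R.add_mem y(1,2) y'(1,2) by blast
    qed
    show "a * x \<in> I" if "a \<in> R" for a
    proof -
      have "(a * x) * W = of_nat n * (a * y)" by (simp only: mult.assoc y(3) mult.left_commute)
      thus ?thesis unfolding I_def using R.mult_mem[OF that] y(1,2) by blast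
    qed
  qed
  moreover have "\<alpha> i - of_int (v i) \<in> I" if i: "i < r" for i
  proof -
    have "int n dvd poly (f i) (v i)" using v i unfolding T_def by blast
    then obtain c where c: "poly (f i) (v i) = int n * c" by (rule dvdE)
    define W' where "W' = (\<Prod>j\<in>{..<r} - {i}. q v j (\<alpha> j))"
    have W': "W' \<in> R" unfolding W'_def by (intro R.prod_mem q_R) simp
    have "W = q v i (\<alpha> i) * W'" unfolding W_def W'_def using i by (intro prod.remove) auto
    hence "(\<alpha> i - of_int (v i)) * W = ((\<alpha> i - of_int (v i)) * q v i (\<alpha> i)) * W'" by (simp only: mult.assoc)
    also have "\<dots> = of_nat n * (of_int (- c) * W')" unfolding q_mult[OF i] c by simp
    finally have "(\<alpha> i - of_int (v i)) * W = of_nat n * (of_int (- c) * W')" .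
    thus ?thesis unfolding I_def
      by (intro CollectI conjI bexI[of _ "of_int (- c) * W'"] R.diff_mem alpha_R[OF i] R.of_int_mem R.mult_mem W')
  qed
  moreover have "of_nat n \<in> I" unfolding I_def
    by (intro CollectI conjI bexI[of _ W] R.of_nat_mem refl W)
  ultimately have "\<psi> v \<subseteq> I" by (rule \<psi>_minimal)
  hence "of_int k \<in> I" using k by blast
  then obtain y where "y \<in> R" "of_int k * W = of_nat n * y" unfolding I_def by blast
  thus ?thesis unfolding W_def by (rule dvd_if_mult_q)
qed

lemma unit_mod_n:
  assumes "coprime (int n) c"
  obtains a b where "a * c + b * int n = 1"
proof -
  obtain b a where "b * int n + a * c = 1"
    using bezout_int[of "int n" c] assms by (metis coprime_imp_gcd_eq_1)
  thus thesis by (intro that[of a b]) simp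
qed

text \<open>The elements congruent to integers form a subring \<open>B\<close> that contains
  \<open>n\<close> R, the \<alpha> i and, \<eta> being invertible modulo \<open>n\<close>, also
  1/\<eta>. By duality it contains the product of the resultants times R; that product is invertible
  modulo \<open>n\<close>, so \<open>B\<close> is R.\<close>

lemma integers_mod_\<psi>:
  assumes v: "v \<in> T"
  shows "integers_mod R (\<psi> v) n"
proof -
  note I = R.idealD[OF ideal_\<psi>[of v]]
  have nI: "of_int (int n) * x \<in> \<psi> v" if "x \<in> R" for x
    using I(4)[OF that gens_\<psi>(2)] by (simp add: mult.commute)
  define B where "B = {x \<in> R. \<exists>k::int. x - of_int k \<in> \<psi> v}"
  have B_I: "x \<in> B" if "x \<in> R" "x - of_int k \<in> \<psi> v" for x k
    using that unfolding B_def by blast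
  have B_E: "\<exists>k::int. x \<in> R \<and> x - of_int k \<in> \<psi> v" if "x \<in> B" for x
    using that unfolding B_def by blast
  have B_int: "of_int k \<in> B" for k by (rule B_I[OF R.of_int_mem, of _ k]) (simp add: I(2))
  have B_mult: "x * y \<in> B" if xy: "x \<in> B" "y \<in> B" for x y
  proof -
    obtain k :: int where k: "x \<in> R \<and> x - of_int k \<in> \<psi> v" using B_E[OF xy(1)] ..
    obtain l :: int where l: "y \<in> R \<and> y - of_int l \<in> \<psi> v" using B_E[OF xy(2)] ..
    note kl = conjunct1[OF k] conjunct2[OF k] conjunct1[OF l] conjunct2[OF l]
    have "y * (x - of_int k) + of_int k * (y - of_int l) \<in> \<psi> v" by (intro I(3,4) kl R.of_int_mem)
    moreover have "y * (x - of_int k) + of_int k * (y - of_int l) = x * y - of_int (k * l)"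
      by (simp add: algebra_simps)
    ultimately have "x * y - of_int (k * l) \<in> \<psi> v" by (simp only:)
    thus ?thesis by (rule B_I[OF R.mult_mem[OF kl(1,3)]])
  qed
  have B_add: "x + y \<in> B" if xy: "x \<in> B" "y \<in> B" for x y
  proof -
    obtain k :: int where k: "x \<in> R \<and> x - of_int k \<in> \<psi> v" using B_E[OF xy(1)] ..
    obtain l :: int where l: "y \<in> R \<and> y - of_int l \<in> \<psi> v" using B_E[OF xy(2)] ..
    note kl = conjunct1[OF k] conjunct2[OF k] conjunct1[OF l] conjunct2[OF l]
    have "(x - of_int k) + (y - of_int l) \<in> \<psi> v" by (intro I(3) kl)
    moreover have "(x - of_int k) + (y - of_int l) = x + y - of_int (k + l)" by simp
    ultimately have "x + y - of_int (k + l) \<in> \<psi> v" by (simp only:)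
    thus ?thesis by (rule B_I[OF R.add_mem[OF kl(1,3)]])
  qed
  have "- x \<in> B" if "x \<in> B" for x using B_mult[OF B_int[of "- 1"] that] by simp
  hence subring: "complex_subring B" using B_int[of 1] by unfold_locales (auto intro: B_mult B_add)
  interpret B: complex_subring B by (rule subring)
  have nB: "of_int (int n) * x \<in> B" if "x \<in> R" for x
    by (rule B_I[of _ 0], rule R.mult_mem[OF R.of_int_mem that], simp only: of_int_0 diff_zero nI[OF that])
  have "1 / of_nat \<eta> \<in> B"
  proof -
    obtain a b where ab: "a * int \<eta> + b * int n = 1" by (rule unit_mod_n[OF coprime_eta])
    have inv_R: "1 / of_nat \<eta> \<in> R" using inverse_eta_Z Z_subset_R by blast
    have "of_int a + of_int b * (of_int (int n) * (1 / of_nat \<eta>)) \<in> B"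
      by (intro B_add B_mult B_int nB inv_R)
    also have "of_int a + of_int b * (of_int (int n) * (1 / of_nat \<eta>)) = of_int (a * int \<eta> + b * int n) * (1 / of_nat \<eta> :: complex)"
      using eta_pos by (simp add: field_simps)
    finally show ?thesis unfolding ab by simp
  qed
  have Z_B: "Z_eta \<eta> \<subseteq> B"
  proof
    fix z assume "z \<in> Z_eta \<eta>"
    then obtain k :: int and j where "z = of_int k / of_nat \<eta> ^ j"
      by (auto simp: Z_eta_def localize_def elim!: Ints_cases)
    hence "z = of_int k * (1 / of_nat \<eta>) ^ j" by (simp add: power_one_over)
    thus "z \<in> B" using B.mult_mem[OF B_int B.power_mem[OF \<open>1 / of_nat \<eta> \<in> B\<close>]] by simp
  qed
  have alpha_B: "\<alpha> i \<in> B" if "i < r" for i by (rule B_I[OF alpha_R[OF that] gens_\<psi>(1)[OF that]])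
  have all_B: "x \<in> B" if x: "x \<in> R" for x
  proof -
    obtain a b where ab: "a * (\<Prod>i<r. Res i) + b * int n = 1" by (rule unit_mod_n[OF coprime_Res])
    have "of_int a * (of_int (\<Prod>i<r. Res i) * x) + of_int b * (of_int (int n) * x) \<in> B"
      by (intro B_add B_mult B_int nB x resultant_mult_in_subring[OF subring Z_B alpha_B])
    also have "of_int a * (of_int (\<Prod>i<r. Res i) * x) + of_int b * (of_int (int n) * x)
        = of_int (a * (\<Prod>i<r. Res i) + b * int n) * x"
      by (simp only: of_int_add of_int_mult distrib_right mult.assoc)
    finally show ?thesis unfolding ab by simp
  qed
  have "\<exists>k::int. x - of_int k \<in> \<psi> v" if "x \<in> R" for x
    using B_E[OF all_B[OF that]] by (elim exE conjE) (rule exI)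
  moreover have "of_int k \<in> \<psi> v \<longleftrightarrow> int n dvd k" for k
  proof
    assume "int n dvd k"
    then obtain c where "k = int n * c" by (elim dvdE)
    thus "of_int k \<in> \<psi> v" using nI[OF R.of_int_mem, of c] by simp
  qed (rule int_in_\<psi>[OF v])
  ultimately show ?thesis unfolding integers_mod_def by (intro conjI ballI allI)
qed

text \<open>In the direction from right to left, \<open>n >= 2\<close> excludes {0} and R: the
  nonzero number \<open>n\<close> lies in the ideal, while 1 does not.\<close>

lemma S_eta_iff:
  "a \<in> S_eta (ring_of_integers L) \<eta> n \<longleftrightarrow> ideal a (subring_C R) \<and> integers_mod R a n"
proof -
  have S: "a \<in> S_eta (ring_of_integers L) \<eta> n \<longleftrightarrow> ideal a (subring_C R) \<and> a \<noteq> {0} \<and> a \<noteq> R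
      \<and> (subring_C R Quot a) \<simeq> (subring_C (Z_eta \<eta>) Quot (a \<inter> Z_eta \<eta>)) \<and> card (carrier (subring_C R Quot a)) = n"
    unfolding S_eta_def Let_def R_def by blast
  show ?thesis
  proof
    assume a: "a \<in> S_eta (ring_of_integers L) \<eta> n"
    hence I: "ideal a (subring_C R)" and iso: "(subring_C R Quot a) \<simeq> (subring_C (Z_eta \<eta>) Quot (a \<inter> Z_eta \<eta>))"
      and card: "card (carrier (subring_C R Quot a)) = n" unfolding S by blast+
    have "card (carrier (subring_C (Z_eta \<eta>) Quot (a \<inter> Z_eta \<eta>))) = n"
      using ring_iso_same_card[OF iso] card by simp
    moreover have "n > 0" using n(1) by simp
    ultimately show "ideal a (subring_C R) \<and> integers_mod R a n"
      using R.integers_mod_if_card_quot[OF I eta_pos Z_subset_R subring_Z_eta card] I by blast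
  next
    assume "ideal a (subring_C R) \<and> integers_mod R a n"
    hence I: "ideal a (subring_C R)" and mod: "integers_mod R a n" by blast+
    have dvd: "of_int k \<in> a \<longleftrightarrow> int n dvd k" for k using mod unfolding integers_mod_def by blast
    have "of_int (int n) \<in> a" unfolding dvd by simp
    hence "a \<noteq> {0}" using n(1) by auto
    moreover have "of_int 1 \<notin> a" unfolding dvd using n(1) by simp
    hence "a \<noteq> R" using R.one_mem by auto
    moreover have "card (carrier (subring_C R Quot a)) = n"
      using R.card_quot_integers_mod[OF I mod] n(1) by simp
    ultimately show "a \<in> S_eta (ring_of_integers L) \<eta> n" unfolding S
      using I R.quot_iso_if_integers_mod[OF I mod Z_subset_R subring_Z_eta] by blast
  qed
qed

lemma beta_at_eqI:
  assumes I: "ideal a (subring_C R)" and mod: "integers_mod R a n"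
    and k: "0 \<le> k" "k < int n" "x - of_int k \<in> a"
  shows "beta_at x n a = k"
  unfolding beta_at_def
proof (rule the_equality)
  fix l assume l: "0 \<le> l \<and> l < int n \<and> x - of_int l \<in> a"
  hence l': "0 \<le> l" "l < int n" "x - of_int l \<in> a" by blast+
  have "(x - of_int k) - (x - of_int l) \<in> a" by (rule R.idealD(6)[OF I k(3) l'(3)])
  moreover have "(x - of_int k) - (x - of_int l) = of_int (l - k)" by simp
  ultimately have "of_int (l - k) \<in> a" by (simp only:)
  hence "int n dvd l - k" using mod unfolding integers_mod_def by blast
  hence "l mod int n = k mod int n" unfolding mod_eq_dvd_iff .
  thus "l = k" using l'(1,2) k(1,2) by simp
qed (intro conjI k)

lemma beta_at:
  assumes I: "ideal a (subring_C R)" and mod: "integers_mod R a n" and x: "x \<in> R"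
  shows "0 \<le> beta_at x n a" "beta_at x n a < int n" "x - of_int (beta_at x n a) \<in> a"
proof -
  obtain k :: int where k: "x - of_int k \<in> a" using mod x unfolding integers_mod_def by blast
  have "int n dvd k - k mod int n" unfolding minus_mod_eq_mult_div by (rule dvd_triv_left)
  hence "of_int (k - k mod int n) \<in> a" using mod unfolding integers_mod_def by blast
  hence "(x - of_int k) + of_int (k - k mod int n) \<in> a" by (rule R.idealD(3)[OF I k])
  moreover have "(x - of_int k) + of_int (k - k mod int n) = x - of_int (k mod int n)"
    by (simp only: of_int_diff) simp
  ultimately have m: "x - of_int (k mod int n) \<in> a" by (simp only:)
  have "beta_at x n a = k mod int n"
    by (rule beta_at_eqI[OF I mod _ _ m]) (use n(1) in auto)
  thus "0 \<le> beta_at x n a" "beta_at x n a < int n" "x - of_int (beta_at x n a) \<in> a"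
    using m n(1) by auto
qed

definition \<phi> :: "complex set \<Rightarrow> nat \<Rightarrow> int" where
  "\<phi> a = (\<lambda>i\<in>{..<r}. beta_at (\<alpha> i) n a)"

abbreviation "SS \<equiv> S_eta (ring_of_integers L) \<eta> n"

text \<open>Multiplying \<open>\<alpha> i - \<phi> a i\<close> by \<open>q\<close> leaves the
  integer -f_i(\<phi> a i) in the ideal, and the integers of the ideal are multiples of
  \<open>n\<close>.\<close>

lemma \<phi>_in_T:
  assumes "a \<in> SS"
  shows "\<phi> a \<in> T"
proof -
  have I: "ideal a (subring_C R)" and mod: "integers_mod R a n" using assms unfolding S_eta_iff by blast+
  have "int n dvd poly (f i) (\<phi> a i)" if i: "i < r" for i
  proof -
    have "\<alpha> i - of_int (\<phi> a i) \<in> a" using beta_at(3)[OF I mod alpha_R[OF i]] i by (simp add: \<phi>_def)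
    hence "q (\<phi> a) i (\<alpha> i) * (\<alpha> i - of_int (\<phi> a i)) \<in> a" by (rule R.idealD(4)[OF I q_R[OF i]])
    hence "- of_int (poly (f i) (\<phi> a i)) \<in> a" using q_mult[OF i, of "\<phi> a"] by (simp only: mult.commute)
    hence "of_int (- poly (f i) (\<phi> a i)) \<in> a" by simp
    hence "int n dvd - poly (f i) (\<phi> a i)" using mod unfolding integers_mod_def by blast
    thus ?thesis by simp
  qed
  moreover have "\<phi> a \<in> {..<r} \<rightarrow>\<^sub>E {0..<int n}"
    using beta_at(1,2)[OF I mod alpha_R] by (auto simp: \<phi>_def)
  ultimately show ?thesis by (simp add: T_def)
qed

lemma \<psi>_in_S: "v \<in> T \<Longrightarrow> \<psi> v \<in> SS"
  unfolding S_eta_iff using ideal_\<psi> integers_mod_\<psi> by blast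

lemma \<phi>_\<psi>:
  assumes v: "v \<in> T"
  shows "\<phi> (\<psi> v) = v"
proof
  fix i
  show "\<phi> (\<psi> v) i = v i"
  proof (cases "i < r")
    case True
    have "v i \<in> {0..<int n}" using v True by (auto simp: T_def)
    hence "beta_at (\<alpha> i) n (\<psi> v) = v i"
      by (intro beta_at_eqI[OF ideal_\<psi> integers_mod_\<psi>[OF v]] gens_\<psi>(1)[OF True]) auto
    thus ?thesis using True by (simp add: \<phi>_def)
  next
    case False
    thus ?thesis using v by (auto simp: \<phi>_def T_def PiE_def extensional_def)
  qed
qed

text \<open>\<open>\<psi> (\<phi> a)\<close> lies in \<open>a\<close>, and both have the integers
  modulo \<open>n\<close> as quotient: an element of \<open>a\<close> differs from an integer by an
  element of the smaller ideal, and this integer, lying in \<open>a\<close>, is a multiple of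
  \<open>n\<close>.\<close>

lemma \<psi>_\<phi>:
  assumes a: "a \<in> SS"
  shows "\<psi> (\<phi> a) = a"
proof
  have I: "ideal a (subring_C R)" and mod: "integers_mod R a n" using a unfolding S_eta_iff by blast+
  have dvd: "of_int k \<in> a \<longleftrightarrow> int n dvd k" for k using mod unfolding integers_mod_def by blast
  show sub: "\<psi> (\<phi> a) \<subseteq> a"
  proof (rule \<psi>_minimal[OF I])
    show "\<alpha> i - of_int (\<phi> a i) \<in> a" if "i < r" for i
      using beta_at(3)[OF I mod alpha_R[OF that]] that by (simp add: \<phi>_def)
    show "of_nat n \<in> a" using dvd[of "int n"] by simp
  qed
  have mod': "integers_mod R (\<psi> (\<phi> a)) n" by (rule integers_mod_\<psi>[OF \<phi>_in_T[OF a]])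
  show "a \<subseteq> \<psi> (\<phi> a)"
  proof
    fix x assume x: "x \<in> a"
    hence "x \<in> R" using R.idealD(1)[OF I] by blast
    then obtain k :: int where k: "x - of_int k \<in> \<psi> (\<phi> a)" using mod' unfolding integers_mod_def by blast
    have "x - of_int k \<in> a" using sub k by (rule subsetD)
    hence "x - (x - of_int k) \<in> a" by (rule R.idealD(6)[OF I x])
    moreover have "x - (x - of_int k) = of_int k" by simp
    ultimately have "of_int k \<in> a" by (simp only:)
    hence "int n dvd k" unfolding dvd .
    hence "of_int k \<in> \<psi> (\<phi> a)" using mod' unfolding integers_mod_def by blast
    hence "(x - of_int k) + of_int k \<in> \<psi> (\<phi> a)" by (rule R.idealD(3)[OF ideal_\<psi> k])
    moreover have "(x - of_int k) + of_int k = x" by simp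
    ultimately show "x \<in> \<psi> (\<phi> a)" by (simp only:)
  qed
qed

lemma bijections:
  "bij_betw \<phi> SS T \<and> bij_betw \<psi> T SS \<and> (\<forall>a\<in>SS. \<psi> (\<phi> a) = a) \<and> (\<forall>v\<in>T. \<phi> (\<psi> v) = v)"
proof (intro conjI ballI)
  show "bij_betw \<phi> SS T"
    by (rule bij_betw_byWitness[of _ \<psi>]) (auto simp: \<phi>_\<psi> \<psi>_\<phi> \<phi>_in_T \<psi>_in_S)
  show "bij_betw \<psi> T SS"
    by (rule bij_betw_byWitness[of _ \<phi>]) (auto simp: \<phi>_\<psi> \<psi>_\<phi> \<phi>_in_T \<psi>_in_S)
qed (auto simp: \<phi>_\<psi> \<psi>_\<phi>)

end

theorem theorem4p3:
  fixes r :: nat and f :: "nat \<Rightarrow> int poly" and \<alpha> :: "nat \<Rightarrow> complex"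
    and L Ok :: "complex set" and \<eta> :: nat
  assumes prim: "\<And>i. i < r \<Longrightarrow> content (f i) = 1"
    and irr: "\<And>i. i < r \<Longrightarrow> irreducible (f i)"
    and deg: "\<And>i. i < r \<Longrightarrow> degree (f i) \<ge> 2"
    and disc_coprime: "\<And>i j. i < r \<Longrightarrow> j < r \<Longrightarrow> i \<noteq> j \<Longrightarrow>
                          coprime (poly_disc (f i)) (poly_disc (f j))"
    and root: "\<And>i. i < r \<Longrightarrow> poly (map_poly of_int (f i)) (\<alpha> i) = 0"
    and L_def: "L = gen_field (\<alpha> ` {..<r})"
    and O_def: "Ok = ring_of_integers L"
    and eta_pos: "\<eta> > 0"
    and eta_int: "\<And>i. i < r \<Longrightarrow> of_nat \<eta> * \<alpha> i \<in> Ok"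
  shows "\<forall>n::nat. n \<ge> 2 \<and> coprime (int n) (int \<eta> * (\<Prod>i<r. poly_disc (f i))) \<longrightarrow>
    (let R = localize Ok \<eta>;
         S = S_eta Ok \<eta> n;
         T = {v \<in> {..<r} \<rightarrow>\<^sub>E {0..<int n}. \<forall>i<r. int n dvd poly (f i) (v i)};
         \<phi> = (\<lambda>a. \<lambda>i\<in>{..<r}. beta_at (\<alpha> i) n a);
         \<psi> = (\<lambda>v. Idl\<^bsub>subring_C R\<^esub> ((\<lambda>i. \<alpha> i - of_int (v i)) ` {..<r} \<union> {of_nat n}))
     in bij_betw \<phi> S T \<and> bij_betw \<psi> T S
        \<and> (\<forall>a\<in>S. \<psi> (\<phi> a) = a) \<and> (\<forall>v\<in>T. \<phi> (\<psi> v) = v))"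
proof (intro allI impI)
  fix n :: nat
  assume n: "n \<ge> 2 \<and> coprime (int n) (int \<eta> * (\<Prod>i<r. poly_disc (f i)))"
  \<comment> \<open>The interpretation below brings another fact named \<open>L_def\<close>; the new
    name keeps the hypothesis accessible.\<close>
  note L_gen = L_def
  interpret coprime_roots r f \<alpha>
  proof (rule coprime_roots.intro)
    fix i assume i: "i < r"
    show "irreducible_root (f i) (\<alpha> i)"
      by (rule irreducible_root.intro[OF irr[OF i] deg[OF i] root[OF i]])
  qed (rule disc_coprime)
  have L: "L = coprime_roots.L r \<alpha>" unfolding L_gen coprime_roots.L_def[OF coprime_roots_axioms] by (rule refl)
  have Ok: "Ok = ring_of_integers (coprime_roots.L r \<alpha>)" unfolding O_def L by (rule refl)
  interpret degree_one_ideals r f \<alpha> \<eta> n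
    by (intro degree_one_ideals.intro degree_one_ideals_axioms.intro coprime_roots_axioms eta_pos
        eta_int[unfolded Ok] conjunct1[OF n] conjunct2[OF n])
  show "let R = localize Ok \<eta>;
         S = S_eta Ok \<eta> n;
         T = {v \<in> {..<r} \<rightarrow>\<^sub>E {0..<int n}. \<forall>i<r. int n dvd poly (f i) (v i)};
         \<phi> = (\<lambda>a. \<lambda>i\<in>{..<r}. beta_at (\<alpha> i) n a);
         \<psi> = (\<lambda>v. Idl\<^bsub>subring_C R\<^esub> ((\<lambda>i. \<alpha> i - of_int (v i)) ` {..<r} \<union> {of_nat n}))
     in bij_betw \<phi> S T \<and> bij_betw \<psi> T S
        \<and> (\<forall>a\<in>S. \<psi> (\<phi> a) = a) \<and> (\<forall>v\<in>T. \<phi> (\<psi> v) = v)"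
    using bijections unfolding Let_def Ok T_def \<phi>_def[abs_def] \<psi>_def[abs_def] R_def .
qed

end
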